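(* Let $\mathcal{M}=(M,g)$ be a Riemannian manifold, let $P\in M$ and $\xi\in T_PM$. Let $\mathcal{H}_k(\xi)=\mathcal{H}_k(P;\xi)$ be the degree-$k$ homogeneous term of the Taylor series at $\xi=0$ of the volume density $\tilde\Theta_{\mathcal{M}}(P;\xi)$, and let $\mathcal{J}_k(\xi)=\nabla^k_\xi\mathcal{J}(\xi)$, where $\mathcal{J}=\mathcal{J}_0$ is the Jacobi operator (all defined in the context). Then: (1) $\mathcal{H}_2(\xi)=-\frac{\operatorname{Tr}\{\mathcal{J}(\xi)\}}{6}$. (2) $\mathcal{H}_3(\xi)=-\frac{\operatorname{Tr}\{\mathcal{J}_1(\xi)\}}{12}$. (3) $\mathcal{H}_4(\xi)=\frac{\operatorname{Tr}\{\mathcal{J}(\xi)\}^2}{72}-\frac{\operatorname{Tr}\{\mathcal{J}(\xi)^2\}}{180}-\frac{\operatorname{Tr}\{\mathcal{J}_2(\xi)\}}{40}$. (4) $\mathcal{H}_5(\xi)=\frac{\operatorname{Tr}\{\mathcal{J}(\xi)\}\operatorname{Tr}\{\mathcal{J}_1(\xi)\}}{72}-\frac{\operatorname{Tr}\{\mathcal{J}(\xi)\mathcal{J}_1(\xi)\}}{180}-\frac{\operatorname{Tr}\{\mathcal{J}_3(\xi)\}}{180}$. (5) $\mathcal{H}_6(\xi)=-\frac{\operatorname{Tr}\{\mathcal{J}(\xi)\}^3}{1296}+\frac{\operatorname{Tr}\{\mathcal{J}(\xi)\}\operatorname{Tr}\{\mathcal{J}(\xi)^2\}}{1080}+\frac{\operatorname{Tr}\{\mathcal{J}(\xi)\}\operatorname{Tr}\{\mathcal{J}_2(\xi)\}}{240}-\frac{\operatorname{Tr}\{\mathcal{J}(\xi)^3\}}{2835}-\frac{\operatorname{Tr}\{\mathcal{J}(\xi)\mathcal{J}_2(\xi)\}}{630}+\frac{\operatorname{Tr}\{\mathcal{J}_1(\xi)\}^2}{288}-\frac{\operatorname{Tr}\{\mathcal{J}_1(\xi)^2\}}{672}-\frac{\operatorname{Tr}\{\mathcal{J}_4(\xi)\}}{1008}$.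 (6) $\mathcal{H}_7(\xi)=\frac{\operatorname{Tr}\{\mathcal{J}(\xi)\}\operatorname{Tr}\{\mathcal{J}(\xi)\mathcal{J}_1(\xi)\}}{1080}-\frac{\operatorname{Tr}\{\mathcal{J}(\xi)\}^2\operatorname{Tr}\{\mathcal{J}_1(\xi)\}}{864}-\frac{\operatorname{Tr}\{\mathcal{J}_5(\xi)\}}{6720}+\frac{\operatorname{Tr}\{\mathcal{J}(\xi)\}\operatorname{Tr}\{\mathcal{J}_3(\xi)\}}{1080}+\frac{\operatorname{Tr}\{\mathcal{J}(\xi)^2\}\operatorname{Tr}\{\mathcal{J}_1(\xi)\}}{2160}-\frac{\operatorname{Tr}\{\mathcal{J}(\xi)^2\mathcal{J}_1(\xi)\}}{1890}-\frac{\operatorname{Tr}\{\mathcal{J}(\xi)\mathcal{J}_3(\xi)\}}{3024}+\frac{\operatorname{Tr}\{\mathcal{J}_1(\xi)\}\operatorname{Tr}\{\mathcal{J}_2(\xi)\}}{480}-\frac{\operatorname{Tr}\{\mathcal{J}_1(\xi)\mathcal{J}_2(\xi)\}}{1120}$. (7) $\mathcal{H}_8(\xi)=\frac{\operatorname{Tr}\{\mathcal{J}(\xi)\}^4}{31104}-\frac{\operatorname{Tr}\{\mathcal{J}(\xi)\}^2\operatorname{Tr}\{\mathcal{J}(\xi)^2\}}{12960}-\frac{\operatorname{Tr}\{\mathcal{J}(\xi)\}^2\operatorname{Tr}\{\mathcal{J}_2(\xi)\}}{2880}+\frac{\operatorname{Tr}\{\mathcal{J}(\xi)\}\operatorname{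Tr}\{\mathcal{J}(\xi)^3\}}{17010}+\frac{\operatorname{Tr}\{\mathcal{J}(\xi)\}\operatorname{Tr}\{\mathcal{J}(\xi)\mathcal{J}_2(\xi)\}}{3780}-\frac{\operatorname{Tr}\{\mathcal{J}_6(\xi)\}}{51840}-\frac{\operatorname{Tr}\{\mathcal{J}(\xi)\}\operatorname{Tr}\{\mathcal{J}_1(\xi)\}^2}{1728}+\frac{\operatorname{Tr}\{\mathcal{J}(\xi)\}\operatorname{Tr}\{\mathcal{J}_1(\xi)^2\}}{4032}-\frac{\operatorname{Tr}\{\mathcal{J}_2(\xi)^2\}}{7200}+\frac{\operatorname{Tr}\{\mathcal{J}(\xi)\}\operatorname{Tr}\{\mathcal{J}_4(\xi)\}}{6048}+\frac{\operatorname{Tr}\{\mathcal{J}(\xi)^2\}\operatorname{Tr}\{\mathcal{J}_2(\xi)\}}{7200}+\frac{\operatorname{Tr}\{\mathcal{J}(\xi)^2\}^2}{64800}-\frac{\operatorname{Tr}\{\mathcal{J}(\xi)^4\}}{37800}-\frac{17\operatorname{Tr}\{\mathcal{J}(\xi)^2\mathcal{J}_2(\xi)\}}{113400}+\frac{\operatorname{Tr}\{\mathcal{J}(\xi)\mathcal{J}_1(\xi)\}\operatorname{Tr}\{\mathcal{J}_1(\xi)\}}{2160}-\frac{5\operatorname{Tr}\{\mathcal{J}(\xi)\mathcal{J}_1(\xi)^2\}}{18144}-\frac{\operatorname{Tr}\{\mathcal{J}(\xi)\mathcal{J}_4(\xi)\}}{18144}+\frac{\operatorname{Tr}\{\mathc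al{J}_1(\xi)\}\operatorname{Tr}\{\mathcal{J}_3(\xi)\}}{2160}-\frac{\operatorname{Tr}\{\mathcal{J}_1(\xi)\mathcal{J}_3(\xi)\}}{5184}+\frac{\operatorname{Tr}\{\mathcal{J}_2(\xi)\}^2}{3200}$.
   Context: Let $\mathcal{M}=(M,g)$ be a (smooth) Riemannian manifold of dimension $m$ with Riemannian measure $\operatorname{dvol}_{\mathcal{M}}$ and Levi-Civita connection $\nabla$. Identify a neighborhood of $P\in M$ with a neighborhood of $0\in T_PM$ via $\exp_P$, and let $d\xi$ be the Lebesgue measure of the inner product space $T_PM$. The density $\tilde\Theta_{\mathcal{M}}(P;\xi)$ is defined for $\xi$ near $0$ by $\exp_P^*\{\operatorname{dvol}_{\mathcal{M}}\}(\xi)=\tilde\Theta_{\mathcal{M}}(P;\xi)\,d\xi$; equivalently $\tilde\Theta_{\mathcal{M}}(P;\xi)=\sqrt{\det(g_{ij}(\xi))}$ in geodesic normal coordinates at $P$ given by an orthonormal basis of $T_PM$. Its formal Taylor series at $\xi=0$ is $\tilde\Theta_{\mathcal{M}}(P;\xi)\sim 1+\sum_{k=2}^\infty\mathcal{H}_k(P;\xi)$ with $\mathcal{H}_k(P;c\xi)=c^k\mathcal{H}_k(P;\xi)$. Curvature conventions: $R(\xi,\eta)=\nabla_\xi\nabla_\eta-\nabla_\eta\nabla_\xi-\nabla_{[\xi,\eta]}$ and $R(\xi_1,\xi_2,\xi_3,\xi_4)=g(R(\xi_1,\xi_2)\xi_3,\xi_4)$. The Jacobi operator is $\mathcal{J}(\xi)\eta=R(\eta,\xi)\xi$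 (so $\operatorname{Tr}\{\mathcal{J}(\xi)\}$ is the Ricci tensor evaluated on $(\xi,\xi)$). For $k\ge0$, $\mathcal{J}_k(\xi)$ is the endomorphism of $T_PM$ defined by $g(\mathcal{J}_k(\xi)\xi_1,\xi_2)=(\nabla^kR)(\xi_1,\xi,\xi,\xi_2;\xi,\dots,\xi)$, with $k$ copies of $\xi$ after the semicolon ($k$-th covariant derivative of $R$ in the direction $\xi$); $\mathcal{J}_0=\mathcal{J}$. *)

theory Defs
  imports "HOL-Analysis.Analysis"
begin

section \<open>Smooth functions\<close>

fun higher_differentiable_on ::
  "'a::real_normed_vector set \<Rightarrow> ('a \<Rightarrow> 'b::real_normed_vector) \<Rightarrow> nat \<Rightarrow> bool" where
  "higher_differentiable_on S f 0 \<longleftrightarrow> continuous_on S f"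
| "higher_differentiable_on S f (Suc n) \<longleftrightarrow>
     (\<forall>x\<in>S. f differentiable (at x)) \<and>
     (\<forall>v. higher_differentiable_on S (\<lambda>x. frechet_derivative f (at x) v) n)"

text \<open>Only used for open \<open>S\<close>.\<close>
definition smooth_on :: "'a::real_normed_vector set \<Rightarrow> ('a \<Rightarrow> 'b::real_normed_vector) \<Rightarrow> bool" where
  "smooth_on S f \<longleftrightarrow> (\<forall>n. higher_differentiable_on S f n)"


section \<open>Riemannian manifolds\<close>

text \<open>A chart is a pair of its domain and its coordinate map. The underlying set of the manifold
  is the union of the chart domains.\<close>

type_synonym ('a, 'm) chart = "'a set \<times> ('a \<Rightarrow> real ^ 'm)"

definition is_chart :: "('a::topological_space, 'm::finite) chart \<Rightarrow> bool" where
  "is_chart c \<longleftrightarrow> open (fst c) \<and> open (snd c ` fst c) \<and>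
     (\<exists>\<psi>. homeomorphism (fst c) (snd c ` fst c) (snd c) \<psi>)"

definition transition :: "('a, 'm::finite) chart \<Rightarrow> ('a, 'm) chart \<Rightarrow> real ^ 'm \<Rightarrow> real ^ 'm" where
  "transition c d = snd d \<circ> inv_into (fst c) (snd c)"

definition smooth_atlas ::
  "('a::{t2_space, second_countable_topology}, 'm::finite) chart set \<Rightarrow> bool" where
  "smooth_atlas A \<longleftrightarrow> (\<forall>c\<in>A. is_chart c) \<and>
     (\<forall>c\<in>A. \<forall>d\<in>A. smooth_on (snd c ` (fst c \<inter> fst d)) (transition c d))"

definition manifold_carrier :: "('a, 'm) chart set \<Rightarrow> 'a set" where
  "manifold_carrier A = (\<Union>c\<in>A. fst c)"

text \<open>\<open>g c x\<close> is the matrix of the metric with respect to the coordinate frame of the chart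
  \<open>c\<close>, at the point whose coordinates in \<open>c\<close> are \<open>x\<close>.\<close>

type_synonym ('a, 'm) metric = "('a, 'm) chart \<Rightarrow> real ^ 'm \<Rightarrow> real ^ 'm ^ 'm"

definition riemannian_metric ::
  "('a::{t2_space, second_countable_topology}, 'm::finite) chart set \<Rightarrow> ('a, 'm) metric \<Rightarrow> bool"
  where
  "riemannian_metric A g \<longleftrightarrow>
     (\<forall>c\<in>A. smooth_on (snd c ` fst c) (g c) \<and>
        (\<forall>x\<in>snd c ` fst c. transpose (g c x) = g c x \<and>
           (\<forall>v. v \<noteq> 0 \<longrightarrow> 0 < v \<bullet> (g c x *v v)))) \<and>
     (\<forall>c\<in>A. \<forall>d\<in>A. \<forall>x\<in>snd c ` (fst c \<inter> fst d).
        let D = matrix (frechet_derivative (transition c d) (at x))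
        in g c x = transpose D ** g d (transition c d x) ** D)"

definition riemannian_manifold ::
  "('a::{t2_space, second_countable_topology}, 'm::finite) chart set \<Rightarrow> ('a, 'm) metric \<Rightarrow> bool"
  where
  "riemannian_manifold A g \<longleftrightarrow> smooth_atlas A \<and> riemannian_metric A g"


section \<open>Levi-Civita connection and curvature in a chart\<close>

text \<open>In this section \<open>G\<close> is the matrix of the metric as a function of the coordinates of a
  fixed chart. Vector fields are given by their components in that chart.\<close>

definition metric_at :: "(real ^ 'm \<Rightarrow> real ^ 'm ^ 'm) \<Rightarrow> real ^ 'm \<Rightarrow>
    real ^ 'm \<Rightarrow> real ^ 'm \<Rightarrow> real" where
  "metric_at G x u v = u \<bullet> (G x *v v)"

definition partial_deriv :: "'m::finite \<Rightarrow> (real ^ 'm \<Rightarrow> real) \<Rightarrow> real ^ 'm \<Rightarrow> real" where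
  "partial_deriv i f x = frechet_derivative f (at x) (axis i 1)"

definition christoffel ::
  "(real ^ 'm::finite \<Rightarrow> real ^ 'm ^ 'm) \<Rightarrow> real ^ 'm \<Rightarrow> 'm \<Rightarrow> 'm \<Rightarrow> 'm \<Rightarrow> real" where
  "christoffel G x k i j =
     (1/2) * (\<Sum>l\<in>UNIV. matrix_inv (G x) $ k $ l *
       (partial_deriv i (\<lambda>y. G y $ j $ l) x + partial_deriv j (\<lambda>y. G y $ i $ l) x
         - partial_deriv l (\<lambda>y. G y $ i $ j) x))"

definition christoffel_form :: "(real ^ 'm::finite \<Rightarrow> real ^ 'm ^ 'm) \<Rightarrow> real ^ 'm \<Rightarrow>
    real ^ 'm \<Rightarrow> real ^ 'm \<Rightarrow> real ^ 'm" where
  "christoffel_form G x u v =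
     (\<chi> k. \<Sum>i\<in>UNIV. \<Sum>j\<in>UNIV. christoffel G x k i j * u $ i * v $ j)"

definition levi_civita :: "(real ^ 'm::finite \<Rightarrow> real ^ 'm ^ 'm) \<Rightarrow>
    (real ^ 'm \<Rightarrow> real ^ 'm) \<Rightarrow> (real ^ 'm \<Rightarrow> real ^ 'm) \<Rightarrow> real ^ 'm \<Rightarrow> real ^ 'm" where
  "levi_civita G X Y x = frechet_derivative Y (at x) (X x) + christoffel_form G x (X x) (Y x)"

definition lie_bracket ::
  "(real ^ 'm::finite \<Rightarrow> real ^ 'm) \<Rightarrow> (real ^ 'm \<Rightarrow> real ^ 'm) \<Rightarrow> real ^ 'm \<Rightarrow> real ^ 'm" where
  "lie_bracket X Y x = frechet_derivative Y (at x) (X x) - frechet_derivative X (at x) (Y x)"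

definition curvature :: "(real ^ 'm::finite \<Rightarrow> real ^ 'm ^ 'm) \<Rightarrow> (real ^ 'm \<Rightarrow> real ^ 'm) \<Rightarrow>
    (real ^ 'm \<Rightarrow> real ^ 'm) \<Rightarrow> (real ^ 'm \<Rightarrow> real ^ 'm) \<Rightarrow> real ^ 'm \<Rightarrow> real ^ 'm" where
  "curvature G X Y Z x =
     levi_civita G X (levi_civita G Y Z) x - levi_civita G Y (levi_civita G X Z) x
       - levi_civita G (lie_bracket X Y) Z x"

text \<open>A covariant tensor field of rank \<open>r\<close> is a function of a point and of a list of \<open>r\<close>
  tangent vectors. Since the curvature is tensorial, its value on tangent vectors may be computed
  by extending them to vector fields with constant components.\<close>

type_synonym 'm tensor_field = "real ^ 'm \<Rightarrow> (real ^ 'm) list \<Rightarrow> real"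

definition riemann_tensor :: "(real ^ 'm::finite \<Rightarrow> real ^ 'm ^ 'm) \<Rightarrow> 'm tensor_field" where
  "riemann_tensor G x vs =
     metric_at G x (curvature G (\<lambda>_. vs ! 0) (\<lambda>_. vs ! 1) (\<lambda>_. vs ! 2) x) (vs ! 3)"

text \<open>The direction of differentiation is the last argument:
  \<open>(\<nabla>T)(v\<^sub>1, \<dots>, v\<^sub>r; w) = w(T(v\<^sub>1, \<dots>, v\<^sub>r)) - \<Sum>i. T(v\<^sub>1, \<dots>, \<nabla>\<^sub>w v\<^sub>i, \<dots>, v\<^sub>r)\<close>, where the
  vectors \<open>v\<^sub>i\<close> are extended with constant components.\<close>

definition tensor_cov_deriv ::
  "(real ^ 'm::finite \<Rightarrow> real ^ 'm ^ 'm) \<Rightarrow> 'm tensor_field \<Rightarrow> 'm tensor_field" where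
  "tensor_cov_deriv G T x ws =
     (let vs = butlast ws; w = last ws in
       frechet_derivative (\<lambda>y. T y vs) (at x) w
         - (\<Sum>i<length vs. T x (vs[i := levi_civita G (\<lambda>_. w) (\<lambda>_. vs ! i) x])))"

text \<open>The operator \<open>J\<^sub>k(\<xi>)\<close> on the tangent space at the point with coordinates \<open>x\<close>, as a matrix
  with respect to the coordinate basis.\<close>

definition jacobi_operator ::
  "(real ^ 'm::finite \<Rightarrow> real ^ 'm ^ 'm) \<Rightarrow> real ^ 'm \<Rightarrow> nat \<Rightarrow> real ^ 'm \<Rightarrow> real ^ 'm ^ 'm" where
  "jacobi_operator G x k \<xi> =
     (THE J. \<forall>u v. metric_at G x (J *v u) v =
        (tensor_cov_deriv G ^^ k) (riemann_tensor G) x ([u, \<xi>, \<xi>, v] @ replicate k \<xi>))"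


section \<open>Exponential map and volume density\<close>

definition geodesic_on :: "('a::{t2_space, second_countable_topology}, 'm::finite) chart set \<Rightarrow>
    ('a, 'm) metric \<Rightarrow> real set \<Rightarrow> (real \<Rightarrow> 'a) \<Rightarrow> bool" where
  "geodesic_on A g I \<gamma> \<longleftrightarrow> continuous_on I \<gamma> \<and> \<gamma> ` I \<subseteq> manifold_carrier A \<and>
     (\<forall>c\<in>A. \<exists>v. \<forall>t\<in>I. \<gamma> t \<in> fst c \<longrightarrow>
        ((snd c \<circ> \<gamma>) has_vector_derivative v t) (at t within I) \<and>
        (v has_vector_derivative - christoffel_form (g c) (snd c (\<gamma> t)) (v t) (v t))
          (at t within I))"

text \<open>Tangent vectors at \<open>P\<close> are given by their components in the chart \<open>c\<close> around \<open>P\<close>. The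
  geodesic itself may leave the domain of \<open>c\<close>.\<close>

definition exp_map :: "('a::{t2_space, second_countable_topology}, 'm::finite) chart set \<Rightarrow>
    ('a, 'm) metric \<Rightarrow> ('a, 'm) chart \<Rightarrow> 'a \<Rightarrow> real ^ 'm \<Rightarrow> 'a" where
  "exp_map A g c P \<xi> =
     (THE q. \<exists>\<gamma>. geodesic_on A g {0..1} \<gamma> \<and> \<gamma> 0 = P \<and>
        ((snd c \<circ> \<gamma>) has_vector_derivative \<xi>) (at 0 within {0..1}) \<and> \<gamma> 1 = q)"

text \<open>Indexed by \<open>'m\<close>, an orthonormal family is automatically a basis.\<close>

definition orthonormal_basis_at :: "(real ^ 'm::finite \<Rightarrow> real ^ 'm ^ 'm) \<Rightarrow> real ^ 'm \<Rightarrow>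
    ('m \<Rightarrow> real ^ 'm) \<Rightarrow> bool" where
  "orthonormal_basis_at G x e \<longleftrightarrow>
     (\<forall>i j. metric_at G x (e i) (e j) = (if i = j then 1 else 0))"

text \<open>The matrix \<open>g\<^sub>i\<^sub>j\<close> of the metric in the geodesic normal coordinates \<open>y\<close> at \<open>P\<close> given by
  the basis \<open>e\<close>. It is expressed through the chart \<open>c\<close>, which contains \<open>exp\<^sub>P(\<xi>)\<close> for \<open>\<xi>\<close> near 0;
  only the germ at 0 is meaningful.\<close>

definition normal_metric :: "('a::{t2_space, second_countable_topology}, 'm::finite) chart set \<Rightarrow>
    ('a, 'm) metric \<Rightarrow> ('a, 'm) chart \<Rightarrow> 'a \<Rightarrow> ('m \<Rightarrow> real ^ 'm) \<Rightarrow> real ^ 'm \<Rightarrow> real ^ 'm ^ 'm"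
  where
  "normal_metric A g c P e y =
     (let F = (\<lambda>z. snd c (exp_map A g c P (\<Sum>i\<in>UNIV. z $ i *\<^sub>R e i)));
          DF = frechet_derivative F (at y)
      in \<chi> i j. metric_at (g c) (F y) (DF (axis i 1)) (DF (axis j 1)))"

text \<open>The normal coordinates of \<open>exp\<^sub>P(\<xi>)\<close> are the components \<open>g(\<xi>, e\<^sub>i)\<close> of \<open>\<xi>\<close> in the
  orthonormal basis.\<close>

definition volume_density :: "('a::{t2_space, second_countable_topology}, 'm::finite) chart set \<Rightarrow>
    ('a, 'm) metric \<Rightarrow> ('a, 'm) chart \<Rightarrow> 'a \<Rightarrow> ('m \<Rightarrow> real ^ 'm) \<Rightarrow> real ^ 'm \<Rightarrow> real" where
  "volume_density A g c P e \<xi> =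
     sqrt (det (normal_metric A g c P e (\<chi> i. metric_at (g c) (snd c P) \<xi> (e i))))"

text \<open>The homogeneous part of degree \<open>k\<close> of the Taylor series of \<open>f\<close> at 0.\<close>

definition taylor_term :: "('v::real_normed_vector \<Rightarrow> real) \<Rightarrow> nat \<Rightarrow> 'v \<Rightarrow> real" where
  "taylor_term f k \<xi> = (deriv ^^ k) (\<lambda>t. f (t *\<^sub>R \<xi>)) 0 / fact k"

end

theory Submission
  imports Defs
begin

text \<open>In a parallel orthonormal frame along the geodesic \<open>t \<mapsto> exp(t \<xi>)\<close> the Jacobi fields vanishing at
  \<open>0\<close> form a matrix \<open>A\<close> with \<open>A'' = - R A\<close>, \<open>A(0) = 0\<close>, \<open>A'(0) = 1\<close>, where \<open>R\<close> is the matrix of the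
  Jacobi operator of the velocity. The frame being parallel, the \<open>k\<close>-th derivative of \<open>R\<close> at \<open>0\<close> is the
  matrix of \<open>J\<^sub>k(\<xi>)\<close>, and the density at \<open>t \<xi>\<close> is \<open>D(t) = det(A(t)/t)\<close>. The logarithmic derivative
  \<open>V\<close> of \<open>A(t)/t\<close> solves the Riccati equation \<open>t V' + 2 V + t V\<^sup>2 = - t R\<close>, and \<open>D' = D tr V\<close>; comparing
  coefficients determines the Taylor series of \<open>V\<close> and then of \<open>D\<close>. Since the volume density only involves
  first derivatives of the exponential map, differentiability of the geodesic flow in the initial data suffices.\<close>

section \<open>Finite differentiability\<close>

text \<open>The obstacle is \<open>exp_map\<close>: a definite description over geodesics of the
  whole manifold, which may leave the chart used for the computation. It acquires a value through
  two facts. A solution of the geodesic equation in one chart is a geodesic in every chart, by the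
  transformation law of the Christoffel symbols; and no competing curve can branch off, by a
  connectedness argument that rests on the Hausdorff property. The other difficulty is that the
  Riccati equation is singular at t = 0. Hadamard's lemma makes B = A/t a smooth curve with B(0) =
  1, so V = B' B^-1 is smooth through 0, and the coefficient of t^(k+1) reads (k+3) V_(k+1) = -
  R^(k)(0)/k! - sum of V_i V_(k-i). The density is a Gram determinant under a root, hence |det B|;
  positivity near 0 removes the absolute value. For H_8 the traces of V_1, ..., V_7 are required,
  but the last two reduce to traces of J_5, J_6 and of products of V_1, ..., V_5, so no longer
  matrix expansions occur. The return from the frame to the chart is a conjugation, invisible to
  traces of products.\<close>

abbreviation hd_on :: "'a::real_normed_vector set \<Rightarrow> ('a \<Rightarrow> 'b::real_normed_vector) \<Rightarrow> nat \<Rightarrow> bool"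
  where "hd_on \<equiv> higher_differentiable_on"

lemma has_derivative_frechet: "f differentiable (at x) \<Longrightarrow> (f has_derivative frechet_derivative f (at x)) (at x)"
  by (simp add: frechet_derivative_works)

lemma frechet_derivativeI: "(f has_derivative f') (at x) \<Longrightarrow> frechet_derivative f (at x) = f'"
  by (metis frechet_derivative_at)

lemma hd_on_cong:
  assumes "open S" "hd_on S f n" "\<And>x. x \<in> S \<Longrightarrow> f x = g x"
  shows "hd_on S g n"
  using assms(2,3)
proof (induction n arbitrary: f g)
  case 0
  then show ?case by (metis continuous_on_cong higher_differentiable_on.simps(1))
next
  case (Suc n)
  have d: "f differentiable (at x)" if "x \<in> S" for x using Suc that by simp
  have g: "(g has_derivative frechet_derivative f (at x)) (at x)" if "x \<in> S" for x
    using has_derivative_transform_within_open[OF has_derivative_frechet[OF d[OF that]] assms(1) that]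
      Suc.prems by blast
  have "frechet_derivative g (at x) = frechet_derivative f (at x)" if "x \<in> S" for x
    using g[OF that] by (rule frechet_derivativeI)
  moreover have "g differentiable (at x)" if "x \<in> S" for x using g[OF that] by (auto simp: differentiable_def)
  ultimately show ?case
    using Suc.IH[of "\<lambda>x. frechet_derivative f (at x) v" "\<lambda>x. frechet_derivative g (at x) v" for v]
      Suc.prems by auto
qed

text \<open>Working rule for derivatives known in closed form: the definition speaks of the
  derivative selected by \<open>frechet_derivative\<close>, which equals \<open>f'\<close> on the
  open set by uniqueness.\<close>

lemma hd_on_SucI:
  assumes "open S" "\<And>x. x \<in> S \<Longrightarrow> (f has_derivative f' x) (at x)" "\<And>v. hd_on S (\<lambda>x. f' x v) n"
  shows "hd_on S f (Suc n)"
proof -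
  have "hd_on S (\<lambda>x. frechet_derivative f (at x) v) n" for v
    by (rule hd_on_cong[OF assms(1) assms(3)[of v]]) (simp add: frechet_derivativeI[OF assms(2)])
  then show ?thesis using assms(2) by (auto simp: differentiable_def)
qed

lemma hd_on_Suc_has_derivative:
  "hd_on S f (Suc n) \<Longrightarrow> x \<in> S \<Longrightarrow> (f has_derivative frechet_derivative f (at x)) (at x)"
  by (simp add: has_derivative_frechet)

lemma hd_on_SucD: "hd_on S f (Suc n) \<Longrightarrow> hd_on S f n"
proof (induction n arbitrary: f)
  case 0
  then show ?case
    by (auto simp: continuous_on_eq_continuous_within
        intro!: continuous_at_imp_continuous_at_within[OF differentiable_imp_continuous_within])
qed auto

lemma hd_on_mono: "hd_on S f n \<Longrightarrow> m \<le> n \<Longrightarrow> hd_on S f m"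
proof (induction n)
  case (Suc n)
  then show ?case using hd_on_SucD by (metis le_Suc_eq)
qed simp

lemma hd_on_imp_continuous_on: "hd_on S f n \<Longrightarrow> continuous_on S f"
  using hd_on_mono[of S f n 0] by simp

lemma hd_on_subset: "hd_on S f n \<Longrightarrow> T \<subseteq> S \<Longrightarrow> hd_on T f n"
  by (induction n arbitrary: f) (auto intro: continuous_on_subset)

lemma hd_on_const [simp]: "hd_on S (\<lambda>x. c) n"
  by (induction n arbitrary: c) auto

lemma hd_on_ident: "open A \<Longrightarrow> hd_on A (\<lambda>x. x) n"
  by (cases n) (auto intro!: hd_on_SucI[OF _ has_derivative_ident] continuous_intros)

lemma hd_on_add:
  assumes "open S" "hd_on S f n" "hd_on S g n"
  shows "hd_on S (\<lambda>x. f x + g x) n"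
  using assms(2,3)
proof (induction n arbitrary: f g)
  case (Suc n)
  show ?case
    by (rule hd_on_SucI[OF assms(1)], rule has_derivative_add)
      (use Suc in \<open>auto intro: has_derivative_frechet\<close>)
qed (auto intro: continuous_intros)

lemma hd_on_bounded_linear:
  assumes "open S" "bounded_linear L" "hd_on S f n"
  shows "hd_on S (\<lambda>x. L (f x)) n"
  using assms(3)
proof (induction n arbitrary: f)
  case 0
  then show ?case using assms(2) by (auto intro: bounded_linear.continuous_on)
next
  case (Suc n)
  show ?case
    by (rule hd_on_SucI[OF assms(1)], rule bounded_linear.has_derivative[OF assms(2)])
      (use Suc in \<open>auto intro: has_derivative_frechet\<close>)
qed

lemma hd_on_bilinear:
  assumes "open S" "bounded_bilinear b" "hd_on S f n" "hd_on S g n"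
  shows "hd_on S (\<lambda>x. b (f x) (g x)) n"
  using assms(3,4)
proof (induction n arbitrary: f g)
  case 0
  then show ?case using assms(2) by (auto intro: bounded_bilinear.continuous_on)
next
  case (Suc n)
  note hd = hd_on_SucD[OF Suc.prems(1)] hd_on_SucD[OF Suc.prems(2)]
  show ?case
    by (rule hd_on_SucI[OF assms(1)], rule bounded_bilinear.FDERIV[OF assms(2)])
      (use Suc hd in \<open>auto intro!: has_derivative_frechet hd_on_add[OF assms(1)]\<close>)
qed

lemmas hd_on_mult = hd_on_bilinear[OF _ bounded_bilinear_mult]
lemmas hd_on_scaleR = hd_on_bilinear[OF _ bounded_bilinear_scaleR]
lemmas hd_on_inner = hd_on_bilinear[OF _ bounded_bilinear_inner]
lemmas hd_on_vec_nth = hd_on_bounded_linear[OF _ bounded_linear_vec_nth]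

lemma hd_on_minus: "open S \<Longrightarrow> hd_on S f n \<Longrightarrow> hd_on S (\<lambda>x. - f x) n"
  by (rule hd_on_bounded_linear[OF _ bounded_linear_minus[OF bounded_linear_ident]])

lemma hd_on_diff: "open S \<Longrightarrow> hd_on S f n \<Longrightarrow> hd_on S g n \<Longrightarrow> hd_on S (\<lambda>x. f x - g x) n"
  using hd_on_add[of S f n "\<lambda>x. - g x"] hd_on_minus[of S g n] by simp

lemma hd_on_sum:
  assumes "open S" "\<And>i. i \<in> I \<Longrightarrow> hd_on S (f i) n"
  shows "hd_on S (\<lambda>x. \<Sum>i\<in>I. f i x) n"
  using assms(2) by (induction I rule: infinite_finite_induct) (auto intro: hd_on_add[OF assms(1)])

lemma hd_on_prod:
  fixes f :: "'i \<Rightarrow> 'a::real_normed_vector \<Rightarrow> real"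
  assumes "open S" "\<And>i. i \<in> I \<Longrightarrow> hd_on S (f i) n"
  shows "hd_on S (\<lambda>x. \<Prod>i\<in>I. f i x) n"
  using assms(2) by (induction I rule: infinite_finite_induct) (auto intro: hd_on_mult[OF assms(1)])

lemma linear_axis: "linear (axis i :: 'b::real_vector \<Rightarrow> 'b ^ 'm)"
  by (rule linearI) (auto simp: axis_def vec_eq_iff)

lemma vec_lambda_eq_sum_axis: "(\<chi> i. f i) = (\<Sum>i\<in>UNIV. axis i (f i :: 'b::real_vector))"
  by (auto simp: vec_eq_iff axis_def if_distrib[where f="\<lambda>f. f _"])

lemma hd_on_vec_lambda:
  fixes f :: "'m::finite \<Rightarrow> 'a::real_normed_vector \<Rightarrow> 'b::euclidean_space"
  assumes "open S" "\<And>i. hd_on S (f i) n"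
  shows "hd_on S (\<lambda>x. \<chi> i. f i x) n"
  unfolding vec_lambda_eq_sum_axis
  by (intro hd_on_sum hd_on_bounded_linear[where L="axis _"] assms linear_conv_bounded_linear[THEN iffD1, OF linear_axis])

lemma hd_on_vec_iff:
  fixes f :: "'a::real_normed_vector \<Rightarrow> 'b::euclidean_space ^ 'm::finite"
  assumes "open S"
  shows "hd_on S f n \<longleftrightarrow> (\<forall>i. hd_on S (\<lambda>x. f x $ i) n)"
  using hd_on_vec_lambda[OF assms, of "\<lambda>i x. f x $ i"] hd_on_vec_nth[OF assms, of f] by auto

lemma frechet_derivative_basis_expansion:
  fixes f :: "'b::euclidean_space \<Rightarrow> 'c::real_normed_vector"
  assumes "f differentiable (at x)"
  shows "frechet_derivative f (at x) h = (\<Sum>b\<in>Basis. (h \<bullet> b) *\<^sub>R frechet_derivative f (at x) b)"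
proof -
  have "linear (frechet_derivative f (at x))" using assms by (rule linear_frechet_derivative)
  then have "frechet_derivative f (at x) (\<Sum>b\<in>Basis. (h \<bullet> b) *\<^sub>R b) =
      (\<Sum>b\<in>Basis. (h \<bullet> b) *\<^sub>R frechet_derivative f (at x) b)"
    by (simp add: linear_sum linear_scale)
  then show ?thesis by (simp add: euclidean_representation)
qed

text \<open>The definition controls derivatives in fixed directions only, whereas the chain rule
  evaluates the derivative of \<open>f\<close> in a direction that moves with \<open>x\<close>.
  Expanding this direction in the basis leaves finitely many fixed-direction derivatives of
  \<open>f\<close>, to which the induction hypothesis applies.\<close>

lemma hd_on_compose:
  fixes f :: "'b::euclidean_space \<Rightarrow> 'c::real_normed_vector"
  assumes "open S" "open T" "hd_on S f n" "hd_on T h n" "h ` T \<subseteq> S"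
  shows "hd_on T (\<lambda>x. f (h x)) n"
  using assms(3,4)
proof (induction n arbitrary: f)
  case 0
  then show ?case using assms(5) by (auto intro: continuous_on_compose2)
next
  case (Suc n)
  have d: "f differentiable (at (h x))" if "x \<in> T" for x using Suc.prems(1) assms(5) that by auto
  have h: "(h has_derivative frechet_derivative h (at x)) (at x)" if "x \<in> T" for x
    using Suc.prems(2) that by (rule hd_on_Suc_has_derivative)
  have "((\<lambda>x. f (h x)) has_derivative
      (\<lambda>v. \<Sum>b\<in>Basis. (frechet_derivative h (at x) v \<bullet> b) *\<^sub>R frechet_derivative f (at (h x)) b)) (at x)"
    if "x \<in> T" for x
    using diff_chain_at[OF h[OF that] has_derivative_frechet[OF d[OF that]]]
    by (simp add: o_def frechet_derivative_basis_expansion[OF d[OF that], symmetric])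
  then show ?case
  proof (rule hd_on_SucI[OF assms(2)])
    fix v
    show "hd_on T (\<lambda>x. \<Sum>b\<in>Basis. (frechet_derivative h (at x) v \<bullet> b) *\<^sub>R frechet_derivative f (at (h x)) b) n"
      using Suc.prems hd_on_SucD[OF Suc.prems(2)]
      by (intro hd_on_sum hd_on_scaleR hd_on_inner Suc.IH assms(2)) auto
  qed
qed

section \<open>Quotients, determinants and inverse matrices\<close>

lemma hd_on_inverse:
  fixes f :: "'a::real_normed_vector \<Rightarrow> real"
  assumes "open S" "hd_on S f n" "\<And>x. x \<in> S \<Longrightarrow> f x \<noteq> 0"
  shows "hd_on S (\<lambda>x. inverse (f x)) n"
  using assms(2)
proof (induction n)
  case 0
  then show ?case using assms(3) by (auto intro: continuous_intros)
next
  case (Suc n)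
  note hd = hd_on_SucD[OF Suc.prems]
  show ?case
  proof (rule hd_on_SucI[OF assms(1)])
    fix x assume "x \<in> S"
    with assms(3) hd_on_Suc_has_derivative[OF Suc.prems]
    show "((\<lambda>x. inverse (f x)) has_derivative
        (\<lambda>v. - (inverse (f x) * frechet_derivative f (at x) v * inverse (f x)))) (at x)"
      by (intro Deriv.has_derivative_inverse) auto
  next
    fix v
    show "hd_on S (\<lambda>x. - (inverse (f x) * frechet_derivative f (at x) v * inverse (f x))) n"
      using Suc.prems Suc.IH hd by (intro hd_on_minus hd_on_mult assms(1)) auto
  qed
qed

lemma hd_on_divide:
  fixes f g :: "'a::real_normed_vector \<Rightarrow> real"
  assumes "open S" "hd_on S f n" "hd_on S g n" "\<And>x. x \<in> S \<Longrightarrow> g x \<noteq> 0"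
  shows "hd_on S (\<lambda>x. f x / g x) n"
  using hd_on_mult[OF assms(1,2) hd_on_inverse[OF assms(1,3,4)]] by (simp add: divide_inverse)

lemma hd_on_det:
  fixes M :: "'a::real_normed_vector \<Rightarrow> real ^ 'm::finite ^ 'm"
  assumes "open S" "\<And>i j. hd_on S (\<lambda>x. M x $ i $ j) n"
  shows "hd_on S (\<lambda>x. det (M x)) n"
  unfolding det_def using assms(2) by (intro hd_on_sum hd_on_mult hd_on_prod assms(1)) auto

lemma matrix_inv_mult:
  assumes "invertible M"
  shows "M ** matrix_inv M = mat 1" "matrix_inv M ** M = mat 1"
  using someI_ex[OF assms[unfolded invertible_def]] unfolding matrix_inv_def by auto

text \<open>Cramer's rule for column \<open>l\<close> of the inverse. The entries become quotients
  of polynomials in the entries of \<open>M\<close>, and so inherit differentiability of every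
  order.\<close>

lemma matrix_inv_component:
  fixes M :: "real ^ 'm::finite ^ 'm"
  assumes "invertible M"
  shows "matrix_inv M $ k $ l = det (\<chi> i j. if j = k then axis l 1 $ i else M $ i $ j) / det M"
proof -
  have d: "det M \<noteq> 0" using assms by (simp add: invertible_det_nz)
  have "M *v (matrix_inv M *v axis l 1) = axis l 1"
    by (simp add: matrix_vector_mul_assoc matrix_inv_mult[OF assms])
  then have "matrix_inv M *v axis l 1 = (\<chi> k. det (\<chi> i j. if j = k then axis l 1 $ i else M $ i $ j) / det M)"
    using cramer[OF d, of "matrix_inv M *v axis l 1" "axis l 1"] by simp
  then have "(matrix_inv M *v axis l 1) $ k = det (\<chi> i j. if j = k then axis l 1 $ i else M $ i $ j) / det M"
    by simp
  then show ?thesis by (simp add: matrix_vector_mul_component inner_axis)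
qed

lemma hd_on_matrix_inv:
  fixes M :: "'a::real_normed_vector \<Rightarrow> real ^ 'm::finite ^ 'm"
  assumes "open S" "hd_on S M n" "\<And>x. x \<in> S \<Longrightarrow> invertible (M x)"
  shows "hd_on S (\<lambda>x. matrix_inv (M x)) n"
proof -
  have *: "hd_on S (\<lambda>x. M x $ i $ j) n" for i j
    by (intro hd_on_vec_nth assms)
  have **: "hd_on S (\<lambda>x. if j = k then axis l 1 $ i else M x $ i $ j) n" for i j k l
    by (cases "j = k") (auto intro: *)
  have "hd_on S (\<lambda>x. matrix_inv (M x) $ k $ l) n" for k l
    by (rule hd_on_cong[OF assms(1), where f="\<lambda>x. det (\<chi> i j. if j = k then axis l 1 $ i else M x $ i $ j) / det (M x)"])
      (use assms in \<open>auto simp: matrix_inv_component invertible_det_nz intro!: hd_on_divide hd_on_det * **\<close>)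
  then show ?thesis by (simp add: hd_on_vec_iff[OF assms(1)])
qed

lemma bounded_bilinear_matrix_mult:
  "bounded_bilinear ((**) :: real^'n::finite^'m::finite \<Rightarrow> real^'p::finite^'n \<Rightarrow> real^'p^'m)"
  unfolding bilinear_conv_bounded_bilinear[symmetric] bilinear_def
  by (auto intro!: linearI simp: matrix_matrix_mult_def vec_eq_iff sum_distrib_left algebra_simps sum.distrib)

lemma bounded_bilinear_matrix_vector_mult:
  "bounded_bilinear ((*v) :: real^'n::finite^'m::finite \<Rightarrow> real^'n \<Rightarrow> real^'m)"
  unfolding bilinear_conv_bounded_bilinear[symmetric] bilinear_def
  by (auto intro!: linearI simp: matrix_vector_mult_def vec_eq_iff sum_distrib_left algebra_simps sum.distrib)

lemma bounded_linear_trace: "bounded_linear (trace :: real^'n::finite^'n \<Rightarrow> real)"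
  unfolding linear_conv_bounded_linear[symmetric]
  by (rule linearI) (auto simp: trace_def sum.distrib sum_distrib_left)

lemmas hd_on_matrix_mult = hd_on_bilinear[OF _ bounded_bilinear_matrix_mult]
lemmas hd_on_matrix_vector_mult = hd_on_bilinear[OF _ bounded_bilinear_matrix_vector_mult]

lemma smooth_on_imp_hd_on: "smooth_on S f \<Longrightarrow> hd_on S f n"
  by (simp add: smooth_on_def)

lemma smooth_on_has_derivative:
  "smooth_on S f \<Longrightarrow> x \<in> S \<Longrightarrow> (f has_derivative frechet_derivative f (at x)) (at x)"
  by (rule hd_on_Suc_has_derivative[OF smooth_on_imp_hd_on[of _ _ "Suc 0"]])

lemma smooth_on_frechet_derivative: "smooth_on S f \<Longrightarrow> smooth_on S (\<lambda>x. frechet_derivative f (at x) v)"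
  unfolding smooth_on_def by (metis higher_differentiable_on.simps(2))

section \<open>Curves and vector derivatives\<close>

lemma hd_on_Suc_vectorI:
  assumes "open I" "\<And>t. t \<in> I \<Longrightarrow> (f has_vector_derivative f' t) (at t)" "hd_on I f' n"
  shows "hd_on I f (Suc n)"
  using assms by (intro hd_on_SucI[where f'="\<lambda>t h. h *\<^sub>R f' t"]) (auto simp: has_vector_derivative_def intro!: hd_on_scaleR)

lemma hd_on_Suc_vectorD:
  assumes "open I" "hd_on I f (Suc n)" "\<And>t. t \<in> I \<Longrightarrow> (f has_vector_derivative f' t) (at t)"
  shows "hd_on I f' n"
proof -
  have "hd_on I (\<lambda>t. frechet_derivative f (at t) 1) n" using assms(2) by simp
  then show ?thesis
    by (rule hd_on_cong[OF assms(1)])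
      (use assms(3) frechet_derivativeI in \<open>fastforce simp: has_vector_derivative_def\<close>)
qed

lemma hd_on_imp_vector_derivative:
  assumes "hd_on I f (Suc n)" "t \<in> I"
  shows "(f has_vector_derivative vector_derivative f (at t)) (at t)"
  using assms by (simp add: vector_derivative_works[symmetric])

section \<open>Ordinary differential equations\<close>

lemma vector_derivative_norm_bound:
  fixes f :: "real \<Rightarrow> 'a::real_normed_vector"
  assumes "\<And>t. t \<in> {a..b} \<Longrightarrow> (f has_vector_derivative f' t) (at t within {a..b})"
    "\<And>t. t \<in> {a..b} \<Longrightarrow> norm (f' t) \<le> B" "s \<in> {a..b}" "t \<in> {a..b}"
  shows "norm (f s - f t) \<le> B * \<bar>s - t\<bar>"
proof -
  have "norm (f s - f t) \<le> B * norm (s - t)"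
  proof (rule differentiable_bound)
    show "(f has_derivative (\<lambda>h. h *\<^sub>R f' u)) (at u within {a..b})" if "u \<in> {a..b}" for u
      using assms(1)[OF that] by (simp add: has_vector_derivative_def)
    show "onorm (\<lambda>h. h *\<^sub>R f' u) \<le> B" if "u \<in> {a..b}" for u
      using assms(2)[OF that] by (intro onorm_le) (simp add: mult.commute[of B] mult_left_mono)
  qed (use assms in auto)
  then show ?thesis by simp
qed

text \<open>On a short interval the supremum of the norm can be absorbed, which replaces Gronwall's inequality.\<close>

lemma ode_estimate:
  fixes e :: "real \<Rightarrow> 'a::real_normed_vector"
  assumes e: "\<And>t. t \<in> {a..b} \<Longrightarrow> (e has_vector_derivative e' t) (at t within {a..b})"
    and bd: "\<And>t. t \<in> {a..b} \<Longrightarrow> norm (e' t) \<le> L * norm (e t) + \<beta>"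
    and "0 \<le> L" "0 \<le> \<beta>" "(b - a) * L \<le> 1/2" "b - a \<le> 1" and t: "t0 \<in> {a..b}" "t \<in> {a..b}"
  shows "norm (e t) \<le> 2 * (norm (e t0) + \<beta>)"
proof -
  have "continuous_on {a..b} (\<lambda>t. norm (e t))"
    by (intro continuous_on_norm continuous_on_vector_derivative[OF e])
  then obtain s where s: "s \<in> {a..b}" and m: "\<And>u. u \<in> {a..b} \<Longrightarrow> norm (e u) \<le> norm (e s)"
    using continuous_attains_sup[of "{a..b}" "\<lambda>t. norm (e t)"] t by auto
  let ?m = "norm (e s)"
  have "norm (e s - e t0) \<le> (L * ?m + \<beta>) * \<bar>s - t0\<bar>"
  proof (rule vector_derivative_norm_bound[OF e _ s t(1)])
    fix u assume u: "u \<in> {a..b}"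
    have "L * norm (e u) \<le> L * ?m" using m[OF u] \<open>0 \<le> L\<close> by (rule mult_left_mono)
    with bd[OF u] show "norm (e' u) \<le> L * ?m + \<beta>" by linarith
  qed
  also have "\<dots> \<le> (L * ?m + \<beta>) * (b - a)"
    using s t \<open>0 \<le> L\<close> \<open>0 \<le> \<beta>\<close> by (intro mult_left_mono) auto
  also have "\<dots> = ((b - a) * L) * ?m + \<beta> * (b - a)" by (simp add: algebra_simps)
  also have "\<dots> \<le> 1/2 * ?m + \<beta> * 1"
    using assms by (intro add_mono mult_right_mono mult_left_mono) auto
  finally have "norm (e s - e t0) \<le> 1/2 * ?m + \<beta>" by simp
  moreover have "?m \<le> norm (e s - e t0) + norm (e t0)" by (metis diff_add_cancel norm_triangle_ineq)
  ultimately have "?m \<le> 2 * (norm (e t0) + \<beta>)" by simp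
  with m[OF t(2)] show ?thesis by simp
qed

text \<open>A value of \<open>T * L\<close> of at most 1/2 makes the Picard operator a contraction
  with factor 1/2 on bounded continuous functions, a complete space. The Lipschitz bound is global
  in the state variable, so iterates cannot leave the domain; nonlinear equations on an open set are
  brought to this form by truncation.\<close>

lemma picard_existence:
  fixes f :: "real \<Rightarrow> 'a::banach \<Rightarrow> 'a"
  assumes "0 \<le> T" "0 \<le> L" "T * L \<le> 1/2"
    and cont: "continuous_on ({-T..T} \<times> UNIV) (\<lambda>(t, y). f t y)"
    and lip: "\<And>t y z. t \<in> {-T..T} \<Longrightarrow> norm (f t y - f t z) \<le> L * norm (y - z)"
  shows "\<exists>y. y 0 = y0 \<and> (\<forall>t\<in>{-T..T}. (y has_vector_derivative f t (y t)) (at t within {-T..T}))"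
proof -
  \<comment> \<open>The difference of two integrals from \<open>-T\<close> is the integral from 0 to
    \<open>t\<close> for either sign of \<open>t\<close>.\<close>
  define P where "P u t = y0 + integral {-T..t} (\<lambda>s. f s (apply_bcontfun u s))
      - integral {-T..0} (\<lambda>s. f s (apply_bcontfun u s))" for u :: "real \<Rightarrow>\<^sub>C 'a" and t
  have c: "continuous_on {-T..T} (\<lambda>s. f s (apply_bcontfun u s))" for u :: "real \<Rightarrow>\<^sub>C 'a"
    by (rule continuous_on_compose2[OF cont, of _ "\<lambda>s. (s, apply_bcontfun u s)", simplified])
      (auto intro!: continuous_intros)
  have d: "(P u has_vector_derivative f t (u t)) (at t within {-T..T})" if "t \<in> {-T..T}" for u t
    unfolding P_def using integral_has_vector_derivative[OF c that]
    by (auto intro!: derivative_eq_intros)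
  have "continuous_on (cbox (-T) T) (P u)" for u
    unfolding cbox_interval by (rule continuous_on_vector_derivative[OF d])
  \<comment> \<open>\<open>clamp\<close> freezes \<open>P u\<close> outside the interval, which
    turns it into a bounded continuous function on the whole line.\<close>
  then have "\<exists>g. \<forall>x. apply_bcontfun g x = P u (clamp (-T) T x)" for u
    using continuous_on_cbox_bcontfunE[of "-T" T "P u"] by metis
  then obtain Q where Q: "\<And>u x. apply_bcontfun (Q u) x = P u (clamp (-T) T x)" by metis
  have "dist (Q u) (Q w) \<le> 1/2 * dist u w" for u w
  proof (rule dist_bound)
    fix x
    define t where "t = clamp (-T) T x"
    have t: "t \<in> {-T..T}" unfolding t_def using assms(1) clamp_in_interval[of "-T" T x] by (simp add: cbox_interval)
    have 0: "P u 0 = P w 0" by (simp add: P_def)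
    have z: "0 \<in> {-T..T}" using assms(1) by simp
    have "norm ((P u t - P w t) - (P u 0 - P w 0)) \<le> (L * dist u w) * \<bar>t - 0\<bar>"
    proof (rule vector_derivative_norm_bound[OF _ _ t z])
      fix s assume s: "s \<in> {-T..T}"
      show "((\<lambda>t. P u t - P w t) has_vector_derivative f s (u s) - f s (w s)) (at s within {-T..T})"
        using d[OF s] by (intro has_vector_derivative_diff)
      have "norm (f s (u s) - f s (w s)) \<le> L * norm (u s - w s)" by (rule lip[OF s])
      also have "\<dots> \<le> L * dist u w"
        using dist_bounded[of u s w] assms(2) by (intro mult_left_mono) (auto simp: dist_norm)
      finally show "norm (f s (u s) - f s (w s)) \<le> L * dist u w" .
    qed
    also have "\<dots> \<le> (L * dist u w) * T" using t assms by (intro mult_left_mono) auto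
    also have "\<dots> = (T * L) * dist u w" by simp
    also have "\<dots> \<le> 1/2 * dist u w" using assms by (intro mult_right_mono) auto
    finally show "dist (apply_bcontfun (Q u) x) (apply_bcontfun (Q w) x) \<le> 1/2 * dist u w"
      by (simp add: Q 0 dist_norm t_def)
  qed
  then obtain u where u: "Q u = u" using banach_fix_type[of "1/2" Q] by auto
  have eq: "u t = P u t" if "t \<in> {-T..T}" for t
    using Q[of u t] that by (simp add: u clamp_cancel_cbox cbox_interval)
  have "(apply_bcontfun u has_vector_derivative f t (u t)) (at t within {-T..T})" if "t \<in> {-T..T}" for t
    using has_vector_derivative_transform[OF that _ d[OF that, of u]] eq by simp
  moreover have "u 0 = y0" using eq[of 0] assms(1) by (simp add: P_def)
  ultimately show ?thesis by blast
qed

text \<open>A linear map is determined on a finite basis, so continuity for each fixed vector yields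
  the joint continuity that \<open>picard_existence\<close> asks for.\<close>

lemma continuous_on_linear_family:
  fixes A :: "'c::topological_space \<Rightarrow> 'a::euclidean_space \<Rightarrow> 'b::real_normed_vector"
  assumes "\<And>t. t \<in> I \<Longrightarrow> linear (A t)" "\<And>v. continuous_on I (\<lambda>t. A t v)"
  shows "continuous_on (I \<times> UNIV) (\<lambda>(t, y). A t y)"
proof -
  have "continuous_on (I \<times> UNIV) (\<lambda>p. \<Sum>b\<in>Basis. (snd p \<bullet> b) *\<^sub>R A (fst p) b)"
    by (intro continuous_intros continuous_on_compose2[OF assms(2)]) auto
  then show ?thesis
  proof (rule continuous_on_eq)
    fix p assume "p \<in> I \<times> (UNIV :: 'a set)"
    then have l: "linear (A (fst p))" using assms(1) by auto
    have "A (fst p) (\<Sum>b\<in>Basis. (snd p \<bullet> b) *\<^sub>R b) = (\<Sum>b\<in>Basis. (snd p \<bullet> b) *\<^sub>R A (fst p) b)"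
      by (simp add: linear_sum[OF l] linear_scale[OF l])
    then show "(\<Sum>b\<in>Basis. (snd p \<bullet> b) *\<^sub>R A (fst p) b) = (\<lambda>(t, y). A t y) p"
      by (simp add: euclidean_representation split_beta)
  qed
qed

lemma linear_norm_bound_basis:
  assumes "linear A" "\<And>b. b \<in> Basis \<Longrightarrow> norm (A b) \<le> B b"
  shows "norm (A (v::'a::euclidean_space)) \<le> (\<Sum>b\<in>Basis. B b) * norm v"
proof -
  have "A v = A (\<Sum>b\<in>Basis. (v \<bullet> b) *\<^sub>R b)" by (simp add: euclidean_representation)
  also have "\<dots> = (\<Sum>b\<in>Basis. (v \<bullet> b) *\<^sub>R A b)"
    by (simp add: linear_sum[OF assms(1)] linear_scale[OF assms(1)])
  also have "norm \<dots> \<le> (\<Sum>b\<in>Basis. norm v * B b)"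
    by (rule sum_norm_le) (auto intro!: mult_mono simp: Basis_le_norm assms(2))
  also have "\<dots> = (\<Sum>b\<in>Basis. B b) * norm v" by (simp add: sum_distrib_left mult.commute)
  finally show ?thesis .
qed

lemma linear_family_bounded_on_compact:
  fixes A :: "'c::topological_space \<Rightarrow> 'a::euclidean_space \<Rightarrow> 'b::real_normed_vector"
  assumes "compact I" "\<And>t. t \<in> I \<Longrightarrow> linear (A t)" "\<And>v. continuous_on I (\<lambda>t. A t v)"
  obtains L where "L \<ge> 0" "\<And>t v. t \<in> I \<Longrightarrow> norm (A t v) \<le> L * norm v"
proof -
  have "\<exists>B. \<forall>t\<in>I. norm (A t b) \<le> B" for b
    using compact_imp_bounded[OF compact_continuous_image[OF assms(3) assms(1), of b]]
    by (auto simp: bounded_iff)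
  then obtain B where B: "\<And>b t. t \<in> I \<Longrightarrow> norm (A t b) \<le> B b" by metis
  have "norm (A t v) \<le> \<bar>\<Sum>b\<in>Basis. B b\<bar> * norm v" if "t \<in> I" for t v
    using order_trans[OF linear_norm_bound_basis[OF assms(2)[OF that] B[OF that]]]
    by (meson abs_ge_self mult_right_mono norm_ge_zero)
  then show ?thesis using that[of "\<bar>\<Sum>b\<in>Basis. B b\<bar>"] by simp
qed

text \<open>The Lipschitz constant of a linear right-hand side is independent of the initial value,
  so one \<open>T\<close> serves all of them. This is used to transport a whole frame on a common
  interval.\<close>

lemma linear_ode_solution:
  fixes A :: "real \<Rightarrow> 'a::euclidean_space \<Rightarrow> 'a"
  assumes "0 < \<tau>" "\<And>t. \<bar>t\<bar> < \<tau> \<Longrightarrow> linear (A t)" "\<And>v. continuous_on {-\<tau><..<\<tau>} (\<lambda>t. A t v)"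
  obtains T where "0 < T" "T \<le> \<tau>"
    "\<And>y0. \<exists>y. y 0 = y0 \<and> (\<forall>t. \<bar>t\<bar> < T \<longrightarrow> (y has_vector_derivative A t (y t)) (at t))"
proof -
  have sub: "{-\<tau>/2..\<tau>/2} \<subseteq> {-\<tau><..<\<tau>}" using assms(1) by auto
  have lin: "linear (A t)" if "t \<in> {-\<tau>/2..\<tau>/2}" for t using that sub assms(2)[of t] by force
  have co: "continuous_on {-\<tau>/2..\<tau>/2} (\<lambda>t. A t v)" for v
    using continuous_on_subset[OF assms(3) sub] .
  obtain L where L: "L \<ge> 0" "\<And>t v. t \<in> {-\<tau>/2..\<tau>/2} \<Longrightarrow> norm (A t v) \<le> L * norm v"
    using linear_family_bounded_on_compact[of "{-\<tau>/2..\<tau>/2}" A] lin co by blast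
  \<comment> \<open>The \<open>L + 1\<close> avoids division by zero and makes \<open>T * L\<close>
    at most 1/2.\<close>
  define T where "T = min (\<tau>/2) (1 / (2 * (L + 1)))"
  have T: "0 < T" "T \<le> \<tau>/2" using assms(1) L(1) by (auto simp: T_def)
  have "T * L \<le> 1 / (2 * (L + 1)) * (L + 1)" unfolding T_def using L(1) assms(1) by (intro mult_mono) auto
  also have "\<dots> = 1/2" using L(1) by simp
  finally have TL: "T * L \<le> 1/2" .
  have sub': "{-T..T} \<subseteq> {-\<tau>/2..\<tau>/2}" using T by auto
  show ?thesis
  proof (rule that[of T])
    fix y0
    have "\<exists>y. y 0 = y0 \<and> (\<forall>t\<in>{-T..T}. (y has_vector_derivative A t (y t)) (at t within {-T..T}))"
    proof (rule picard_existence[OF _ L(1) TL])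
      show "continuous_on ({- T..T} \<times> UNIV) (\<lambda>(t, y). A t y)"
        using sub' lin co by (intro continuous_on_linear_family continuous_on_subset[OF co]) auto
      show "norm (A t y - A t z) \<le> L * norm (y - z)" if "t \<in> {-T..T}" for t y z
        using L(2)[of t "y - z"] lin[of t] that sub' by (metis linear_diff subsetD)
    qed (use T in auto)
    then obtain y where y: "y 0 = y0" "\<And>t. t \<in> {-T..T} \<Longrightarrow> (y has_vector_derivative A t (y t)) (at t within {-T..T})"
      by blast
    have "(y has_vector_derivative A t (y t)) (at t)" if "\<bar>t\<bar> < T" for t
      using y(2)[of t] that by (simp add: at_within_Icc_at abs_less_iff)
    with y(1) show "\<exists>y. y 0 = y0 \<and> (\<forall>t. \<bar>t\<bar> < T \<longrightarrow> (y has_vector_derivative A t (y t)) (at t))" by blast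
  qed (use T assms(1) in auto)
qed

section \<open>Differentiable dependence on the initial value\<close>

lemma linear_frechet_on: "hd_on U f 1 \<Longrightarrow> x \<in> U \<Longrightarrow> linear (frechet_derivative f (at x))"
  by (simp add: linear_frechet_derivative)

lemma C1_lipschitz_on_compact_convex:
  fixes f :: "'a::euclidean_space \<Rightarrow> 'b::real_normed_vector"
  assumes "hd_on U f 1" "compact K" "convex K" "K \<subseteq> U"
  obtains L where "L \<ge> 0" "\<And>x h. x \<in> K \<Longrightarrow> norm (frechet_derivative f (at x) h) \<le> L * norm h"
    "\<And>x y. x \<in> K \<Longrightarrow> y \<in> K \<Longrightarrow> norm (f x - f y) \<le> L * norm (x - y)"
proof -
  have hd: "hd_on K f 1" using hd_on_subset[OF assms(1,4)] .
  obtain L where L: "L \<ge> 0" "\<And>x h. x \<in> K \<Longrightarrow> norm (frechet_derivative f (at x) h) \<le> L * norm h"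
    using linear_family_bounded_on_compact[OF assms(2), of "\<lambda>x. frechet_derivative f (at x)"]
      linear_frechet_on[OF hd] hd by auto
  have "norm (f x - f y) \<le> L * norm (x - y)" if "x \<in> K" "y \<in> K" for x y
  proof (rule differentiable_bound[OF assms(3) _ _ that])
    fix u assume u: "u \<in> K"
    show "(f has_derivative frechet_derivative f (at u)) (at u within K)"
      using u hd by (intro has_derivative_at_withinI[OF has_derivative_frechet]) simp
    show "onorm (frechet_derivative f (at u)) \<le> L" using L u by (intro onorm_le) auto
  qed
  with L that show ?thesis by blast
qed

text \<open>The derivative is uniformly continuous on the compact set, so the first-order remainder
  is small uniformly in the base point. One \<eta> then serves all points of a trajectory when the
  flow is differentiated.\<close>

lemma C1_uniform_remainder:
  fixes f :: "'a::euclidean_space \<Rightarrow> 'b::real_normed_vector"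
  assumes "hd_on U f 1" "compact K" "convex K" "K \<subseteq> U" "0 < \<epsilon>"
  obtains \<eta> where "\<eta> > 0" "\<And>x y. x \<in> K \<Longrightarrow> y \<in> K \<Longrightarrow> norm (y - x) < \<eta> \<Longrightarrow>
    norm (f y - f x - frechet_derivative f (at x) (y - x)) \<le> \<epsilon> * norm (y - x)"
proof -
  let ?f' = "\<lambda>x. frechet_derivative f (at x)"
  have hd: "hd_on K f 1" using hd_on_subset[OF assms(1,4)] .
  \<comment> \<open>The estimate is made for each basis vector and summed, hence the division by the
    dimension.\<close>
  define \<epsilon>' where "\<epsilon>' = \<epsilon> / DIM('a)"
  have e': "\<epsilon>' > 0" using assms(5) by (simp add: \<epsilon>'_def)
  have "\<exists>\<eta>>0. \<forall>x\<in>K. \<forall>y\<in>K. dist y x < \<eta> \<longrightarrow> dist (?f' y b) (?f' x b) < \<epsilon>'" for b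
    using compact_uniformly_continuous[of K "\<lambda>x. ?f' x b"] hd assms(2) e'
    unfolding uniformly_continuous_on_def by simp
  then obtain \<eta>' where \<eta>': "\<And>b. \<eta>' b > 0"
    "\<And>b x y. x \<in> K \<Longrightarrow> y \<in> K \<Longrightarrow> dist y x < \<eta>' b \<Longrightarrow> dist (?f' y b) (?f' x b) < \<epsilon>'" by metis
  define \<eta> where "\<eta> = Min (\<eta>' ` Basis)"
  have \<eta>: "\<eta> > 0" unfolding \<eta>_def using \<eta>'(1) by (subst Min_gr_iff) auto
  have bd: "norm (?f' y h - ?f' x h) \<le> \<epsilon> * norm h" if "x \<in> K" "y \<in> K" "dist y x < \<eta>" for x y h
  proof -
    have "norm ((\<lambda>h. ?f' y h - ?f' x h) h) \<le> (\<Sum>b\<in>(Basis::'a set). \<epsilon>') * norm h"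
    proof (rule linear_norm_bound_basis)
      show "linear (\<lambda>h. ?f' y h - ?f' x h)"
        using linear_frechet_on[OF hd] that by (intro linear_compose_sub) auto
      fix b :: 'a assume "b \<in> Basis"
      then have "\<eta> \<le> \<eta>' b" unfolding \<eta>_def by (intro Min_le) auto
      then show "norm (?f' y b - ?f' x b) \<le> \<epsilon>'"
        using \<eta>'(2)[OF that(1,2), of b] that(3) by (simp add: dist_norm)
    qed
    then show ?thesis by (simp add: \<epsilon>'_def)
  qed
  show ?thesis
  proof (rule that[OF \<eta>])
    fix x y assume xy: "x \<in> K" "y \<in> K" "norm (y - x) < \<eta>"
    have "norm ((f y - ?f' x y) - (f x - ?f' x x)) \<le> \<epsilon> * norm (y - x)"
    proof (rule differentiable_bound[of "closed_segment x y" "\<lambda>z. f z - ?f' x z" "\<lambda>z h. ?f' z h - ?f' x h"])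
      fix u assume u: "u \<in> closed_segment x y"
      then have uK: "u \<in> K" using xy assms(3) by (meson closed_segment_subset subsetD)
      show "((\<lambda>z. f z - ?f' x z) has_derivative (\<lambda>h. ?f' u h - ?f' x h)) (at u within closed_segment x y)"
        using uK xy hd linear_frechet_on[OF hd xy(1)]
        by (intro has_derivative_diff has_derivative_at_withinI[OF has_derivative_frechet]
            linear_imp_has_derivative) auto
      have "dist u x < \<eta>" using segment_bound(1)[OF u] xy(3) by (simp add: dist_norm)
      then show "onorm (\<lambda>h. ?f' u h - ?f' x h) \<le> \<epsilon>"
        using bd[OF xy(1) uK] by (intro onorm_le) auto
    qed auto
    then show "norm (f y - f x - ?f' x (y - x)) \<le> \<epsilon> * norm (y - x)"
      by (simp add: linear_diff[OF linear_frechet_on[OF hd xy(1)]] algebra_simps)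
  qed
qed

text \<open>The field is composed with the nearest-point projection onto a closed ball, which is
  nonexpansive, so the truncated field is globally Lipschitz. A speed bound keeps trajectories from
  a smaller ball inside the large one, where truncation changes nothing. \<open>Z\<close> solves the
  equation linearized along the trajectory; it is the derivative because the error
  \<open>\<psi> y' t - \<psi> y t - \<zeta> y (y' - y) t\<close> vanishes at time 0 and obeys a
  linear differential inequality whose forcing term is o(|y' - y|).\<close>

theorem local_flow:
  fixes f :: "'a::euclidean_space \<Rightarrow> 'a"
  assumes "open U" "hd_on U f 1" "y0 \<in> U"
  obtains T r \<phi> Z where "0 < T" "0 < r"
    "\<And>y. y \<in> ball y0 r \<Longrightarrow> \<phi> 0 y = y"
    "\<And>y t. y \<in> ball y0 r \<Longrightarrow> \<bar>t\<bar> < T \<Longrightarrow> \<phi> t y \<in> U"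
    "\<And>y t. y \<in> ball y0 r \<Longrightarrow> \<bar>t\<bar> < T \<Longrightarrow>
       ((\<lambda>t. \<phi> t y) has_vector_derivative f (\<phi> t y)) (at t)"
    "\<And>y t. y \<in> ball y0 r \<Longrightarrow> \<bar>t\<bar> < T \<Longrightarrow> (\<phi> t has_derivative Z t y) (at y)"
    "\<And>y h. y \<in> ball y0 r \<Longrightarrow> Z 0 y h = h"
    "\<And>y t h. y \<in> ball y0 r \<Longrightarrow> \<bar>t\<bar> < T \<Longrightarrow>
       ((\<lambda>t. Z t y h) has_vector_derivative frechet_derivative f (at (\<phi> t y)) (Z t y h)) (at t)"
proof -
  let ?f' = "\<lambda>x. frechet_derivative f (at x)"
  obtain R where R: "R > 0" "cball y0 R \<subseteq> U" using assms(1,3) open_contains_cball by blast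
  define K where "K = cball y0 R"
  have K: "compact K" "convex K" "K \<subseteq> U" "K \<noteq> {}" "closed K" using R by (auto simp: K_def)
  obtain L where L: "L \<ge> 0" "\<And>x h. x \<in> K \<Longrightarrow> norm (?f' x h) \<le> L * norm h"
    "\<And>x y. x \<in> K \<Longrightarrow> y \<in> K \<Longrightarrow> norm (f x - f y) \<le> L * norm (x - y)"
    using C1_lipschitz_on_compact_convex[OF assms(2) K(1-3)] by metis
  have cf: "continuous_on K f" using hd_on_imp_continuous_on[OF assms(2)] K(3) continuous_on_subset by blast
  obtain M where M: "M > 0" "\<And>x. x \<in> K \<Longrightarrow> norm (f x) \<le> M"
    using compact_imp_bounded[OF compact_continuous_image[OF cf K(1)]] by (auto simp: bounded_pos)
  \<comment> \<open>On an interval of length \<open>2 * T\<close> this gives what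
    \<open>ode_estimate\<close> demands: length at most 1, and length times \<open>L\<close> at most
    1/2. A path of speed at most \<open>M\<close> covers at most \<open>R/4\<close>, so one that
    starts within \<open>R/2\<close> of the centre stays in \<open>K\<close>.\<close>
  define T where "T = min (1/2) (min (1 / (4 * (L + 1))) (R / (4 * M)))"
  have T: "0 < T" "T \<le> 1/2" "T \<le> 1 / (4 * (L + 1))" "T \<le> R / (4 * M)"
    using L(1) M(1) R(1) by (auto simp: T_def)
  have "T * L \<le> 1 / (4 * (L + 1)) * (L + 1)" using T L(1) by (intro mult_mono) auto
  also have "\<dots> = 1/4" using L(1) by simp
  finally have TL: "T * L \<le> 1/4" .
  have "M * T \<le> M * (R / (4 * M))" using T M(1) by (intro mult_left_mono) auto
  then have TM: "M * T \<le> R/4" using M(1) by simp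
  define r where "r = R/2"
  have r: "r > 0" using R by (simp add: r_def)
  define F where "F y = f (closest_point K y)" for y
  have cp: "closest_point K y \<in> K" for y using closest_point_in_set[OF K(5,4)] .
  have F_lip: "norm (F y - F z) \<le> L * norm (y - z)" for y z
  proof -
    have "norm (F y - F z) \<le> L * norm (closest_point K y - closest_point K z)"
      unfolding F_def by (rule L(3)[OF cp cp])
    also have "\<dots> \<le> L * norm (y - z)"
      using closest_point_lipschitz[OF K(2,5,4), of y z] L(1) by (intro mult_left_mono) (auto simp: dist_norm)
    finally show ?thesis .
  qed
  have "continuous_on UNIV F" unfolding F_def
    by (rule continuous_on_compose2[OF cf continuous_on_closest_point[OF K(2,5,4)]]) (auto intro: cp)
  then have F_cont: "continuous_on ({-T..T} \<times> UNIV) (\<lambda>(t, y). F y)"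
    by (auto simp: split_beta intro!: continuous_on_compose2[of UNIV F] continuous_intros)
  have "\<exists>u. u 0 = y \<and> (\<forall>t\<in>{-T..T}. (u has_vector_derivative F (u t)) (at t within {-T..T}))" for y
    by (rule picard_existence[OF _ L(1) _ F_cont F_lip]) (use T TL in auto)
  then obtain \<psi> where \<psi>: "\<And>y. \<psi> y 0 = y"
    "\<And>y t. t \<in> {-T..T} \<Longrightarrow> (\<psi> y has_vector_derivative F (\<psi> y t)) (at t within {-T..T})" by metis
  have inK: "\<psi> y t \<in> K" if "y \<in> ball y0 r" "t \<in> {-T..T}" for y t
  proof -
    have "norm (\<psi> y t - \<psi> y 0) \<le> M * \<bar>t - 0\<bar>"
      by (rule vector_derivative_norm_bound[OF \<psi>(2)]) (use that T cp M in \<open>auto simp: F_def\<close>)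
    also have "\<dots> \<le> M * T" using that M(1) by (intro mult_left_mono) auto
    finally have "dist y (\<psi> y t) \<le> R/4" using TM \<psi>(1) by (simp add: dist_norm norm_minus_commute)
    moreover have "dist y0 y < R/2" using that by (simp add: r_def)
    ultimately show ?thesis using dist_triangle[of y0 "\<psi> y t" y] R(1) by (simp add: K_def)
  qed
  have \<psi>': "(\<psi> y has_vector_derivative f (\<psi> y t)) (at t within {-T..T})"
    if "y \<in> ball y0 r" "t \<in> {-T..T}" for y t
    using \<psi>(2)[OF that(2), of y] closest_point_self[OF inK[OF that]] by (simp add: F_def)
  have lin: "linear (?f' x)" if "x \<in> K" for x using linear_frechet_on[OF assms(2)] that K(3) by blast
  have "\<exists>z. z 0 = h \<and> (\<forall>t\<in>{-T..T}. (z has_vector_derivative ?f' (\<psi> y t) (z t)) (at t within {-T..T}))"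
    if y: "y \<in> ball y0 r" for y h
  proof (rule picard_existence[OF _ L(1)])
    show "continuous_on ({- T..T} \<times> UNIV) (\<lambda>(t, z). ?f' (\<psi> y t) z)"
    proof (rule continuous_on_linear_family)
      show "linear (?f' (\<psi> y t))" if "t \<in> {-T..T}" for t using lin inK[OF y that] .
      have "continuous_on K (\<lambda>x. ?f' x v)" for v
        using assms(2) K(3) by (auto intro: continuous_on_subset)
      then show "continuous_on {-T..T} (\<lambda>t. ?f' (\<psi> y t) v)" for v
        by (rule continuous_on_compose2[OF _ continuous_on_vector_derivative[OF \<psi>'[OF y]]])
          (use inK[OF y] in auto)
    qed
    show "norm (?f' (\<psi> y t) u - ?f' (\<psi> y t) v) \<le> L * norm (u - v)" if "t \<in> {-T..T}" for t u v
      using L(2)[OF inK[OF y that], of "u - v"] lin[OF inK[OF y that]] by (simp add: linear_diff)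
  qed (use T TL in auto)
  then obtain \<zeta> where \<zeta>: "\<And>y h. y \<in> ball y0 r \<Longrightarrow> \<zeta> y h 0 = h"
    "\<And>y h t. y \<in> ball y0 r \<Longrightarrow> t \<in> {-T..T} \<Longrightarrow>
        (\<zeta> y h has_vector_derivative ?f' (\<psi> y t) (\<zeta> y h t)) (at t within {-T..T})" by metis
  have T0: "0 \<in> {-T..T}" using T by auto
  have est: "norm (e t) \<le> 2 * (norm (e 0) + \<beta>)"
    if "\<And>t. t \<in> {-T..T} \<Longrightarrow> (e has_vector_derivative e' t) (at t within {-T..T})"
      "\<And>t. t \<in> {-T..T} \<Longrightarrow> norm (e' t) \<le> L * norm (e t) + \<beta>" "0 \<le> \<beta>" "t \<in> {-T..T}"
    for e :: "real \<Rightarrow> 'a" and e' \<beta> t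
    by (rule ode_estimate[OF that(1,2) L(1) that(3) _ _ T0 that(4)]) (use T TL in auto)
  \<comment> \<open>Linearity in the initial value is uniqueness for the linearized equation: the
    defect solves the same equation and is 0 at time 0.\<close>
  have \<zeta>_lin: "linear (\<lambda>h. \<zeta> y h t)" if y: "y \<in> ball y0 r" and t: "t \<in> {-T..T}" for y t
  proof (rule linearI)
    note l = lin[OF inK[OF y]]
    fix h k
    have "norm ((\<lambda>t. \<zeta> y (h + k) t - (\<zeta> y h t + \<zeta> y k t)) t) \<le>
        2 * (norm (\<zeta> y (h + k) 0 - (\<zeta> y h 0 + \<zeta> y k 0)) + 0)"
    proof (rule est[OF _ _ _ t])
      fix s assume s: "s \<in> {-T..T}"
      show "((\<lambda>t. \<zeta> y (h + k) t - (\<zeta> y h t + \<zeta> y k t)) has_vector_derivative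
          ?f' (\<psi> y s) (\<zeta> y (h + k) s - (\<zeta> y h s + \<zeta> y k s))) (at s within {-T..T})"
        unfolding linear_diff[OF l[OF s]] linear_add[OF l[OF s]]
        by (intro has_vector_derivative_diff has_vector_derivative_add \<zeta>(2) y s)
    qed (use L(2) inK[OF y] in auto)
    then show "\<zeta> y (h + k) t = \<zeta> y h t + \<zeta> y k t" using \<zeta>(1)[OF y] by simp
  next
    note l = lin[OF inK[OF y]]
    fix a :: real and h
    have "norm ((\<lambda>t. \<zeta> y (a *\<^sub>R h) t - a *\<^sub>R \<zeta> y h t) t) \<le>
        2 * (norm (\<zeta> y (a *\<^sub>R h) 0 - a *\<^sub>R \<zeta> y h 0) + 0)"
    proof (rule est[OF _ _ _ t])
      fix s assume s: "s \<in> {-T..T}"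
      have "((\<lambda>t. a *\<^sub>R \<zeta> y h t) has_vector_derivative a *\<^sub>R ?f' (\<psi> y s) (\<zeta> y h s)) (at s within {-T..T})"
        using bounded_linear.has_vector_derivative[OF bounded_linear_scaleR_right \<zeta>(2)[OF y s]] .
      then show "((\<lambda>t. \<zeta> y (a *\<^sub>R h) t - a *\<^sub>R \<zeta> y h t) has_vector_derivative
          ?f' (\<psi> y s) (\<zeta> y (a *\<^sub>R h) s - a *\<^sub>R \<zeta> y h s)) (at s within {-T..T})"
        unfolding linear_diff[OF l[OF s]] linear_scale[OF l[OF s]]
        by (intro has_vector_derivative_diff \<zeta>(2) y s)
    qed (use L(2) inK[OF y] in auto)
    then show "\<zeta> y (a *\<^sub>R h) t = a *\<^sub>R \<zeta> y h t" using \<zeta>(1)[OF y] by simp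
  qed
  have D: "((\<lambda>y. \<psi> y t) has_derivative (\<lambda>h. \<zeta> y h t)) (at y)"
    if y: "y \<in> ball y0 r" and t: "t \<in> {-T..T}" for y t
    unfolding has_derivative_at_alt
  proof (intro conjI allI impI)
    show "bounded_linear (\<lambda>h. \<zeta> y h t)" using \<zeta>_lin[OF y t] by (simp add: linear_conv_bounded_linear)
    fix e :: real assume e: "0 < e"
    \<comment> \<open>The tolerance \<open>e/4\<close> is dictated by the end of the estimate:
      trajectories separate by at most \<open>2 * ?k\<close>, and \<open>ode_estimate\<close>
      doubles the forcing term, which makes \<open>e * ?k\<close>.\<close>
    obtain \<eta> where \<eta>: "\<eta> > 0" "\<And>x y. x \<in> K \<Longrightarrow> y \<in> K \<Longrightarrow> norm (y - x) < \<eta> \<Longrightarrow>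
        norm (f y - f x - ?f' x (y - x)) \<le> e/4 * norm (y - x)"
      using C1_uniform_remainder[OF assms(2) K(1-3), of "e/4"] e by auto
    obtain d0 where d0: "d0 > 0" "ball y d0 \<subseteq> ball y0 r" using y open_ball open_contains_ball by blast
    show "\<exists>d>0. \<forall>y'. norm (y' - y) < d \<longrightarrow>
        norm (\<psi> y' t - \<psi> y t - \<zeta> y (y' - y) t) \<le> e * norm (y' - y)"
    \<comment> \<open>With \<open>?k\<close> below \<open>\<eta>/2\<close> the trajectories stay
      less than \<eta> apart, and \<open>d0\<close> keeps \<open>y'\<close> in the ball of
      admissible initial values.\<close>
    proof (intro exI[of _ "min d0 (\<eta>/2)"] conjI allI impI)
      show "0 < min d0 (\<eta>/2)" using d0 \<eta> by simp
      fix y' assume n: "norm (y' - y) < min d0 (\<eta>/2)"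
      let ?k = "norm (y' - y)"
      have y': "y' \<in> ball y0 r" using n d0(2) by (auto simp: dist_norm norm_minus_commute subset_iff)
      have 1: "norm (\<psi> y' s - \<psi> y s) \<le> 2 * ?k" if s: "s \<in> {-T..T}" for s
      proof -
        have "norm ((\<lambda>s. \<psi> y' s - \<psi> y s) s) \<le> 2 * (norm (\<psi> y' 0 - \<psi> y 0) + 0)"
          by (rule est[OF has_vector_derivative_diff[OF \<psi>'[OF y'] \<psi>'[OF y]] _ _ s])
            (use L(3) inK y y' in auto)
        then show ?thesis by (simp add: \<psi>(1))
      qed
      have "norm ((\<lambda>s. \<psi> y' s - \<psi> y s - \<zeta> y (y' - y) s) t) \<le>
          2 * (norm (\<psi> y' 0 - \<psi> y 0 - \<zeta> y (y' - y) 0) + e/4 * (2 * ?k))"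
      proof (rule est[OF has_vector_derivative_diff[OF has_vector_derivative_diff[OF \<psi>'[OF y'] \<psi>'[OF y]] \<zeta>(2)[OF y]] _ _ t])
        fix s assume s: "s \<in> {-T..T}"
        let ?x = "\<psi> y s" and ?x' = "\<psi> y' s" and ?z = "\<zeta> y (y' - y) s"
        have "f ?x' - f ?x - ?f' ?x ?z = ?f' ?x (?x' - ?x - ?z) + (f ?x' - f ?x - ?f' ?x (?x' - ?x))"
          using lin[OF inK[OF y s]] by (simp add: linear_diff)
        also have "norm \<dots> \<le> norm (?f' ?x (?x' - ?x - ?z)) + norm (f ?x' - f ?x - ?f' ?x (?x' - ?x))"
          by (rule norm_triangle_ineq)
        also have "\<dots> \<le> L * norm (?x' - ?x - ?z) + e/4 * norm (?x' - ?x)"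
          using 1[OF s] n by (intro add_mono L(2) \<eta>(2) inK y y' s) auto
        also have "\<dots> \<le> L * norm (?x' - ?x - ?z) + e/4 * (2 * ?k)"
          using 1[OF s] e by (intro add_left_mono mult_left_mono) auto
        finally show "norm (f ?x' - f ?x - ?f' ?x ?z) \<le> L * norm (?x' - ?x - ?z) + e/4 * (2 * ?k)" .
      qed (use e in auto)
      then show "norm (\<psi> y' t - \<psi> y t - \<zeta> y (y' - y) t) \<le> e * norm (y' - y)"
        by (simp add: \<psi>(1) \<zeta>(1)[OF y])
    qed
  qed
  have at: "at t within {-T..T} = at t" "t \<in> {-T..T}" if "\<bar>t\<bar> < T" for t
    using that by (auto simp: at_within_Icc_at)
  show ?thesis
  proof (rule that[of T r "\<lambda>t y. \<psi> y t" "\<lambda>t y h. \<zeta> y h t"])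
    fix y t h assume y: "y \<in> ball y0 r" and t: "\<bar>t\<bar> < T"
    show "\<psi> y t \<in> U" using inK[OF y at(2)[OF t]] K(3) by blast
    show "((\<lambda>t. \<psi> y t) has_vector_derivative f (\<psi> y t)) (at t)" using \<psi>'[OF y at(2)[OF t]] at(1)[OF t] by simp
    show "((\<lambda>y. \<psi> y t) has_derivative (\<lambda>h. \<zeta> y h t)) (at y)" by (rule D[OF y at(2)[OF t]])
    show "((\<lambda>t. \<zeta> y h t) has_vector_derivative ?f' (\<psi> y t) (\<zeta> y h t)) (at t)"
      using \<zeta>(2)[OF y at(2)[OF t], of h] at(1)[OF t] by simp
  qed (use T r \<psi>(1) \<zeta>(1) in auto)
qed

text \<open>Derivatives are taken within \<open>{a..b}\<close>, so endpoints are included. Agreement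
  on a relative neighbourhood of \<open>s\<close> is what later makes the coincidence set of two
  geodesics relatively open.\<close>

lemma ode_local_uniqueness:
  fixes f :: "'a::euclidean_space \<Rightarrow> 'a"
  assumes U: "open U" "hd_on U f 1" and I: "s \<in> {a..b}"
    and y: "\<And>t. t \<in> {a..b} \<Longrightarrow> \<bar>t - s\<bar> < \<delta> \<Longrightarrow> y t \<in> U \<and> (y has_vector_derivative f (y t)) (at t within {a..b})"
    and z: "\<And>t. t \<in> {a..b} \<Longrightarrow> \<bar>t - s\<bar> < \<delta> \<Longrightarrow> z t \<in> U \<and> (z has_vector_derivative f (z t)) (at t within {a..b})"
    and eq: "y s = z s" and \<delta>: "0 < \<delta>"
  obtains \<delta>' where "0 < \<delta>'" "\<And>t. t \<in> {a..b} \<Longrightarrow> \<bar>t - s\<bar> < \<delta>' \<Longrightarrow> y t = z t"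
proof -
  have ys: "y s \<in> U" using y[OF I] \<delta> by simp
  obtain R where R: "R > 0" "cball (y s) R \<subseteq> U" using U(1) ys open_contains_cball by blast
  define K where "K = cball (y s) R"
  have K: "compact K" "convex K" "K \<subseteq> U" using R by (auto simp: K_def)
  obtain L where L: "L \<ge> 0" "\<And>x y. x \<in> K \<Longrightarrow> y \<in> K \<Longrightarrow> norm (f x - f y) \<le> L * norm (x - y)"
    using C1_lipschitz_on_compact_convex[OF U(2) K] by metis
  have "continuous (at s within {a..b}) y" "continuous (at s within {a..b}) z"
    using y[OF I] z[OF I] \<delta> by (auto intro: has_vector_derivative_continuous)
  then obtain d1 d2 where d: "d1 > 0" "d2 > 0" "\<And>t. t \<in> {a..b} \<Longrightarrow> dist t s < d1 \<Longrightarrow> dist (y t) (y s) < R"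
    "\<And>t. t \<in> {a..b} \<Longrightarrow> dist t s < d2 \<Longrightarrow> dist (z t) (z s) < R"
    using R(1) unfolding continuous_within_eps_delta by (metis (no_types))
  \<comment> \<open>\<open>m\<close> is at most every admissible radius. Its half
    \<open>\<delta>'\<close> lies strictly below the open ones, and the window around
    \<open>s\<close> has length at most \<open>2 * \<delta>'\<close>.\<close>
  define m where "m = min (min d1 d2) (min \<delta> (min (1/2) (1 / (4 * (L + 1)))))"
  have m: "0 < m" "m \<le> d1" "m \<le> d2" "m \<le> \<delta>" "m \<le> 1/2" "m \<le> 1 / (4 * (L + 1))"
    using d(1,2) \<delta> L(1) unfolding m_def min_le_iff_disj by auto
  define \<delta>' where "\<delta>' = m / 2"
  have \<delta>': "0 < \<delta>'" "\<delta>' < d1" "\<delta>' < d2" "\<delta>' < \<delta>" "\<delta>' \<le> 1/2" "\<delta>' \<le> 1 / (4 * (L + 1))"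
    using m unfolding \<delta>'_def by linarith+
  let ?J = "{max a (s - \<delta>')..min b (s + \<delta>')}"
  have J: "?J \<subseteq> {a..b}" "s \<in> ?J" using I \<delta>'(1) by auto
  have Jd: "\<bar>t - s\<bar> \<le> \<delta>'" if "t \<in> ?J" for t using that by auto
  have yzK: "y t \<in> K" "z t \<in> K" if "t \<in> ?J" for t
    using d(3)[of t] d(4)[of t] Jd[OF that] that J(1) \<delta>' eq by (auto simp: K_def dist_real_def dist_commute)
  have "y t = z t" if t: "t \<in> {a..b}" "\<bar>t - s\<bar> < \<delta>'" for t
  proof -
    have tJ: "t \<in> ?J" using t by auto
    have "norm ((\<lambda>t. y t - z t) t) \<le> 2 * (norm (y s - z s) + 0)"
    proof (rule ode_estimate[OF _ _ L(1) _ _ _ J(2) tJ])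
      fix u assume u: "u \<in> ?J"
      then have u': "u \<in> {a..b}" "\<bar>u - s\<bar> < \<delta>" using J(1) Jd[OF u] \<delta>' by auto
      show "((\<lambda>t. y t - z t) has_vector_derivative f (y u) - f (z u)) (at u within ?J)"
        using y[OF u'] z[OF u'] by (intro has_vector_derivative_diff) (auto intro: has_vector_derivative_within_subset[OF _ J(1)])
      show "norm (f (y u) - f (z u)) \<le> L * norm (y u - z u) + 0"
        using L(2)[OF yzK[OF u]] by simp
    next
      have len: "min b (s + \<delta>') - max a (s - \<delta>') \<le> 2 * \<delta>'" by auto
      have "(min b (s + \<delta>') - max a (s - \<delta>')) * L \<le> (2 * (1 / (4 * (L + 1)))) * (L + 1)"
        using len \<delta>' L(1) by (intro mult_mono) auto
      also have "\<dots> = 1/2" using L(1) by simp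
      finally show "(min b (s + \<delta>') - max a (s - \<delta>')) * L \<le> 1/2" .
      show "min b (s + \<delta>') - max a (s - \<delta>') \<le> 1" using len \<delta>'(5) by simp
    qed simp
    then show ?thesis using eq by simp
  qed
  with \<delta>'(1) that show ?thesis by blast
qed

section \<open>The Levi-Civita connection in a chart\<close>

text \<open>One chart in isolation: local computations refer to the matrix field \<open>G\<close>
  alone, so that two metrics can be instantiated side by side in the transformation law.\<close>

locale metric_chart =
  fixes G :: "real ^ 'm::finite \<Rightarrow> real ^ 'm ^ 'm" and S :: "(real ^ 'm) set"
  assumes open_S: "open S" and smooth_G: "smooth_on S G"
    and sym_G: "x \<in> S \<Longrightarrow> transpose (G x) = G x"
    and pos_G: "x \<in> S \<Longrightarrow> v \<noteq> 0 \<Longrightarrow> 0 < v \<bullet> (G x *v v)"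

lemma matrix_inner_transpose:
  fixes A :: "real ^ 'n::finite ^ 'm::finite"
  shows "x \<bullet> (A *v y) = (transpose A *v x) \<bullet> y"
  by (simp add: dot_lmul_matrix transpose_matrix_vector)

lemma linear_sum_basis:
  assumes "linear F"
  shows "F v = (\<Sum>b\<in>Basis. (v \<bullet> b) *\<^sub>R F (b::'a::euclidean_space))"
proof -
  have "F v = F (\<Sum>b\<in>Basis. (v \<bullet> b) *\<^sub>R b)" by (simp add: euclidean_representation)
  then show ?thesis by (simp add: linear_sum[OF assms] linear_scale[OF assms])
qed

lemma linear_sum_axis:
  assumes "linear F"
  shows "F v = (\<Sum>i\<in>UNIV. v $ i *\<^sub>R F (axis i 1 :: real ^ 'm::finite))"
proof -
  have "(\<Sum>i\<in>UNIV. v $ i *\<^sub>R axis i 1) = v"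
    by (simp add: basis_expansion flip: scalar_mult_eq_scaleR)
  then have "F v = F (\<Sum>i\<in>UNIV. v $ i *\<^sub>R axis i 1)" by simp
  then show ?thesis by (simp add: linear_sum[OF assms] linear_scale[OF assms])
qed

lemma linear_metric_at_right: "linear (metric_at G x u)"
  by (rule linearI) (auto simp: metric_at_def matrix_vector_right_distrib inner_add_right
      inner_scaleR_right matrix_vector_mult_scaleR)

lemma linear_metric_at_left: "linear (\<lambda>u. metric_at G x u v)"
  by (rule linearI) (auto simp: metric_at_def inner_add_left)

lemma linear_christoffel_form_right: "linear (christoffel_form G x u)"
  by (rule linearI) (auto simp: christoffel_form_def vec_eq_iff algebra_simps sum.distrib sum_distrib_left)

lemma linear_christoffel_form_left: "linear (\<lambda>u. christoffel_form G x u v)"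
  by (rule linearI) (auto simp: christoffel_form_def vec_eq_iff algebra_simps sum.distrib sum_distrib_left)

lemma levi_civita_const: "levi_civita G (\<lambda>_. u) (\<lambda>_. v) = (\<lambda>x. christoffel_form G x u v)"
  by (auto simp: levi_civita_def)

lemma curvature_const:
  "curvature G (\<lambda>_. u) (\<lambda>_. v) (\<lambda>_. w) x =
    frechet_derivative (\<lambda>y. christoffel_form G y v w) (at x) u
      + christoffel_form G x u (christoffel_form G x v w)
    - (frechet_derivative (\<lambda>y. christoffel_form G y u w) (at x) v
      + christoffel_form G x v (christoffel_form G x u w))"
proof -
  have "lie_bracket (\<lambda>_. u) (\<lambda>_. v) = (\<lambda>_. 0)" by (auto simp: lie_bracket_def)
  then show ?thesis
    using linear_0[OF linear_christoffel_form_left[of G x w]]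
    by (simp add: curvature_def levi_civita_const) (simp add: levi_civita_def)
qed

text \<open>Differentiation at \<open>x\<close> in a fixed direction commutes with sums and
  multiples in the parameter \<open>v\<close>. This is the source of multilinearity for the
  curvature and for covariant derivatives.\<close>

lemma linear_frechet_derivative_param:
  fixes F :: "'a::real_normed_vector \<Rightarrow> 'c::real_normed_vector \<Rightarrow> 'b::real_normed_vector"
  assumes "open S" "x \<in> S" "\<And>y. y \<in> S \<Longrightarrow> linear (F y)" "\<And>v. (\<lambda>y. F y v) differentiable (at x)"
  shows "linear (\<lambda>v. frechet_derivative (\<lambda>y. F y v) (at x) w)"
proof (rule linearI)
  note d = has_derivative_frechet[OF assms(4)]
  fix u v
  have "((\<lambda>y. F y (u + v)) has_derivative
      (\<lambda>w. frechet_derivative (\<lambda>y. F y u) (at x) w + frechet_derivative (\<lambda>y. F y v) (at x) w)) (at x)"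
    by (rule has_derivative_transform_within_open[OF has_derivative_add[OF d d] assms(1,2)])
      (simp add: linear_add[OF assms(3)])
  from frechet_derivativeI[OF this]
  show "frechet_derivative (\<lambda>y. F y (u + v)) (at x) w =
      frechet_derivative (\<lambda>y. F y u) (at x) w + frechet_derivative (\<lambda>y. F y v) (at x) w" by simp
next
  note d = has_derivative_frechet[OF assms(4)]
  fix a :: real and v
  have "((\<lambda>y. F y (a *\<^sub>R v)) has_derivative (\<lambda>w. a *\<^sub>R frechet_derivative (\<lambda>y. F y v) (at x) w)) (at x)"
    by (rule has_derivative_transform_within_open[OF has_derivative_scaleR_right[OF d] assms(1,2)])
      (simp add: linear_scale[OF assms(3)])
  from frechet_derivativeI[OF this]
  show "frechet_derivative (\<lambda>y. F y (a *\<^sub>R v)) (at x) w = a *\<^sub>R frechet_derivative (\<lambda>y. F y v) (at x) w"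
    by simp
qed

context metric_chart
begin

abbreviation \<Gamma> where "\<Gamma> \<equiv> christoffel_form G"
abbreviation gm where "gm \<equiv> metric_at G"

lemma invertible_G: "x \<in> S \<Longrightarrow> invertible (G x)"
  unfolding invertible_left_inverse matrix_left_invertible_ker
  using pos_G[of x] by (metis inner_zero_right less_irrefl)

lemma gm_sym: "x \<in> S \<Longrightarrow> gm x u v = gm x v u"
  by (metis metric_at_def matrix_inner_transpose sym_G inner_commute)

lemma gm_eqI:
  assumes "x \<in> S" "\<And>v. gm x u v = gm x w v"
  shows "u = w"
proof (rule ccontr)
  assume "u \<noteq> w"
  then have "0 < (u - w) \<bullet> (G x *v (u - w))" using pos_G[OF assms(1)] by simp
  also have "\<dots> = gm x u (u - w) - gm x w (u - w)" by (simp add: metric_at_def inner_diff_left)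
  finally show False using assms(2) by simp
qed

lemma hd_on_G: "hd_on S G n" using smooth_G by (simp add: smooth_on_def)

lemma hd_on_christoffel: "hd_on S (\<lambda>x. christoffel G x k i j) n"
proof -
  have *: "hd_on S (\<lambda>x. partial_deriv i (\<lambda>y. G y $ j $ l) x) n" for i j l
  proof -
    have "hd_on S (\<lambda>y. G y $ j $ l) (Suc n)" by (intro hd_on_vec_nth open_S hd_on_G)
    then show ?thesis by (simp add: partial_deriv_def)
  qed
  show ?thesis unfolding christoffel_def
    by (intro hd_on_mult hd_on_const hd_on_sum hd_on_add hd_on_diff hd_on_vec_nth open_S hd_on_matrix_inv
        hd_on_G invertible_G *)
qed

lemma hd_on_christoffel_form_compose:
  assumes "open A" "hd_on A h n" "hd_on A u n" "hd_on A v n" "h ` A \<subseteq> S"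
  shows "hd_on A (\<lambda>x. \<Gamma> (h x) (u x) (v x)) n"
  unfolding christoffel_form_def
  by (intro hd_on_vec_lambda hd_on_sum hd_on_mult hd_on_vec_nth assms
      hd_on_compose[OF open_S _ hd_on_christoffel])

lemma smooth_on_christoffel_form: "smooth_on S (\<lambda>x. \<Gamma> x u v)"
  unfolding smooth_on_def
  by (intro allI hd_on_christoffel_form_compose open_S hd_on_ident hd_on_const) auto

lemma christoffel_form_differentiable: "x \<in> S \<Longrightarrow> (\<lambda>x. \<Gamma> x u v) differentiable (at x)"
  using smooth_on_has_derivative[OF smooth_on_christoffel_form] by (auto simp: differentiable_def)

lemma frechet_christoffel_linear:
  assumes "x \<in> S"
  shows "linear (\<lambda>v. frechet_derivative (\<lambda>y. \<Gamma> y u v) (at x) w)"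
    "linear (\<lambda>u. frechet_derivative (\<lambda>y. \<Gamma> y u v) (at x) w)"
    "linear (\<lambda>w. frechet_derivative (\<lambda>y. \<Gamma> y u v) (at x) w)"
    apply (rule linear_frechet_derivative_param[OF open_S assms, where F="\<lambda>y. \<Gamma> y u"])
     apply (auto intro: linear_christoffel_form_right christoffel_form_differentiable[OF assms])[2]
   apply (rule linear_frechet_derivative_param[OF open_S assms, where F="\<lambda>y u. \<Gamma> y u v"])
    apply (auto intro: linear_christoffel_form_left christoffel_form_differentiable[OF assms])[2]
  apply (rule linear_frechet_derivative[OF christoffel_form_differentiable[OF assms], unfolded eta_contract_eq])
  done

definition dG where "dG x = frechet_derivative G (at x)"

lemma G_has_derivative: "x \<in> S \<Longrightarrow> (G has_derivative dG x) (at x)"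
  unfolding dG_def by (rule smooth_on_has_derivative[OF smooth_G])

lemma linear_dG: "x \<in> S \<Longrightarrow> linear (dG x)"
  using G_has_derivative has_derivative_linear by blast

lemma transpose_dG:
  assumes "x \<in> S"
  shows "transpose (dG x w) = dG x w"
proof -
  have bl: "bounded_linear (transpose :: real^'m^'m \<Rightarrow> real^'m^'m)"
    unfolding linear_conv_bounded_linear[symmetric] by (rule linearI) (auto simp: transpose_def vec_eq_iff)
  have "(G has_derivative (\<lambda>w. transpose (dG x w))) (at x)"
    by (rule has_derivative_transform_within_open[OF
          bounded_linear.has_derivative[OF bl G_has_derivative[OF assms]] open_S assms])
      (rule sym_G)
  then show ?thesis using has_derivative_unique[OF G_has_derivative[OF assms]] by metis
qed

lemma partial_deriv_G:
  assumes "x \<in> S"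
  shows "partial_deriv i (\<lambda>y. G y $ j $ l) x = dG x (axis i 1) $ j $ l"
  unfolding partial_deriv_def
  using frechet_derivativeI[OF bounded_linear.has_derivative[OF bounded_linear_vec_nth
        bounded_linear.has_derivative[OF bounded_linear_vec_nth G_has_derivative[OF assms]]]] by metis

lemma christoffel_sym: "x \<in> S \<Longrightarrow> christoffel G x k i j = christoffel G x k j i"
  unfolding christoffel_def partial_deriv_G
  using transpose_dG[of x] by (simp add: transpose_def vec_eq_iff add.commute cong: sum.cong)

lemma christoffel_form_sym: "x \<in> S \<Longrightarrow> \<Gamma> x u v = \<Gamma> x v u"
  unfolding christoffel_form_def vec_eq_iff
  by (simp, subst sum.swap) (simp add: christoffel_sym[of x] mult_ac cong: sum.cong)

lemma dG_inner_sum: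
  assumes "x \<in> S"
  shows "u \<bullet> (dG x w *v v) = (\<Sum>i\<in>UNIV. \<Sum>j\<in>UNIV. \<Sum>l\<in>UNIV. w $ i * u $ j * v $ l * dG x (axis i 1) $ j $ l)"
proof -
  have "dG x w $ j $ l = (\<Sum>i\<in>UNIV. w $ i * dG x (axis i 1) $ j $ l)" for j l
    by (subst linear_sum_axis[OF linear_dG[OF assms]]) simp
  then have "u \<bullet> (dG x w *v v) = (\<Sum>j\<in>UNIV. \<Sum>l\<in>UNIV. \<Sum>i\<in>UNIV. w $ i * u $ j * v $ l * dG x (axis i 1) $ j $ l)"
    by (simp add: inner_vec_def matrix_vector_mult_def sum_distrib_left sum_distrib_right mult_ac)
  also have "\<dots> = (\<Sum>j\<in>UNIV. \<Sum>i\<in>UNIV. \<Sum>l\<in>UNIV. w $ i * u $ j * v $ l * dG x (axis i 1) $ j $ l)"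
    by (intro sum.cong refl sum.swap)
  also have "\<dots> = (\<Sum>i\<in>UNIV. \<Sum>j\<in>UNIV. \<Sum>l\<in>UNIV. w $ i * u $ j * v $ l * dG x (axis i 1) $ j $ l)"
    by (rule sum.swap)
  finally show ?thesis .
qed

text \<open>Pairing with the metric cancels the inverse matrix in the Christoffel symbols and leaves
  those of the first kind. For constant fields the Lie brackets vanish, so that the Koszul formula
  has three terms only.\<close>

lemma koszul:
  assumes x: "x \<in> S"
  shows "gm x v (\<Gamma> x w u) = (u \<bullet> (dG x w *v v) + w \<bullet> (dG x u *v v) - w \<bullet> (dG x v *v u)) / 2"
proof -
  define g where "g i j l = dG x (axis i 1) $ j $ l" for i j l
  have rot: "(\<Sum>l\<in>UNIV. \<Sum>i\<in>UNIV. \<Sum>j\<in>UNIV. f l i j) = (\<Sum>i\<in>UNIV. \<Sum>j\<in>UNIV. \<Sum>l\<in>UNIV. f l i j)"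
    for f :: "'m \<Rightarrow> 'm \<Rightarrow> 'm \<Rightarrow> real"
    by (subst sum.swap, rule sum.cong[OF refl], rule sum.swap)
  \<comment> \<open>The Christoffel symbols of the first kind, contracted with \<open>w\<close> and
    \<open>u\<close>; raising the free index gives \<open>\<Gamma> x w u\<close>.\<close>
  define h where "h = (\<chi> l. (\<Sum>i\<in>UNIV. \<Sum>j\<in>UNIV. w $ i * u $ j * (g i j l + g j i l - g l i j)) / 2)"
  have "\<Gamma> x w u = matrix_inv (G x) *v h"
  proof (rule vec_eq_iff[THEN iffD2], rule allI)
    fix k
    have "\<Gamma> x w u $ k = (\<Sum>i\<in>UNIV. \<Sum>j\<in>UNIV. \<Sum>l\<in>UNIV. matrix_inv (G x) $ k $ l *
        (w $ i * u $ j * (g i j l + g j i l - g l i j)) / 2)"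
      by (simp add: christoffel_form_def christoffel_def partial_deriv_G[OF x] g_def
          sum_distrib_left sum_distrib_right sum_divide_distrib mult_ac)
    also have "\<dots> = (\<Sum>i\<in>UNIV. \<Sum>l\<in>UNIV. \<Sum>j\<in>UNIV. matrix_inv (G x) $ k $ l *
        (w $ i * u $ j * (g i j l + g j i l - g l i j)) / 2)"
      by (intro sum.cong refl sum.swap)
    also have "\<dots> = (\<Sum>l\<in>UNIV. \<Sum>i\<in>UNIV. \<Sum>j\<in>UNIV. matrix_inv (G x) $ k $ l *
        (w $ i * u $ j * (g i j l + g j i l - g l i j)) / 2)"
      by (rule sum.swap)
    also have "\<dots> = (matrix_inv (G x) *v h) $ k"
      by (simp add: matrix_vector_mult_def h_def sum_distrib_left sum_divide_distrib)
    finally show "\<Gamma> x w u $ k = (matrix_inv (G x) *v h) $ k" .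
  qed
  then have "G x *v \<Gamma> x w u = h"
    using matrix_inv_mult(1)[OF invertible_G[OF x]] by (simp add: matrix_vector_mul_assoc)
  then have "gm x v (\<Gamma> x w u) =
      (\<Sum>l\<in>UNIV. \<Sum>i\<in>UNIV. \<Sum>j\<in>UNIV. w $ i * u $ j * v $ l * (g i j l + g j i l - g l i j)) / 2"
    by (simp add: metric_at_def inner_vec_def h_def sum_distrib_left sum_divide_distrib mult_ac)
  also have "\<dots> = ((\<Sum>l\<in>UNIV. \<Sum>i\<in>UNIV. \<Sum>j\<in>UNIV. w $ i * u $ j * v $ l * g i j l)
      + (\<Sum>l\<in>UNIV. \<Sum>i\<in>UNIV. \<Sum>j\<in>UNIV. w $ i * u $ j * v $ l * g j i l)
      - (\<Sum>l\<in>UNIV. \<Sum>i\<in>UNIV. \<Sum>j\<in>UNIV. w $ i * u $ j * v $ l * g l i j)) / 2"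
    by (simp add: sum.distrib sum_subtractf algebra_simps)
  also have "(\<Sum>l\<in>UNIV. \<Sum>i\<in>UNIV. \<Sum>j\<in>UNIV. w $ i * u $ j * v $ l * g i j l) = u \<bullet> (dG x w *v v)"
    by (subst rot) (simp add: dG_inner_sum[OF x] g_def)
  also have "(\<Sum>l\<in>UNIV. \<Sum>i\<in>UNIV. \<Sum>j\<in>UNIV. w $ i * u $ j * v $ l * g j i l) = w \<bullet> (dG x u *v v)"
    by (subst rot, subst sum.swap) (simp add: dG_inner_sum[OF x] g_def mult_ac)
  also have "(\<Sum>l\<in>UNIV. \<Sum>i\<in>UNIV. \<Sum>j\<in>UNIV. w $ i * u $ j * v $ l * g l i j) = w \<bullet> (dG x v *v u)"
    by (simp add: dG_inner_sum[OF x] g_def mult_ac)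
  finally show ?thesis .
qed

lemma dG_inner_sym: "x \<in> S \<Longrightarrow> u \<bullet> (dG x w *v v) = v \<bullet> (dG x w *v u)"
  by (metis matrix_inner_transpose transpose_dG inner_commute)

text \<open>In the sum of the two Koszul formulas the derivatives in the directions \<open>u\<close>
  and \<open>v\<close> cancel.\<close>

lemma metric_compatible:
  assumes "x \<in> S"
  shows "u \<bullet> (dG x w *v v) = gm x (\<Gamma> x w u) v + gm x u (\<Gamma> x w v)"
  using koszul[OF assms, of v w u] koszul[OF assms, of u w v] gm_sym[OF assms, of "\<Gamma> x w u" v]
    dG_inner_sym[OF assms, of u w v] dG_inner_sym[OF assms, of w u v] dG_inner_sym[OF assms, of w v u] by simp

text \<open>The expressions \<open>u' + \<Gamma> (x t) x' (u t)\<close> are covariant derivatives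
  along the curve, so this is the product rule for the metric. They vanish for parallel
  fields.\<close>

lemma gm_along_curve:
  assumes "x t \<in> S" "(x has_vector_derivative x') (at t)"
    "(u has_vector_derivative u') (at t)" "(v has_vector_derivative v') (at t)"
  shows "((\<lambda>t. gm (x t) (u t) (v t)) has_vector_derivative
    gm (x t) (u' + \<Gamma> (x t) x' (u t)) (v t) + gm (x t) (u t) (v' + \<Gamma> (x t) x' (v t))) (at t)"
proof -
  have "((\<lambda>t. G (x t)) has_vector_derivative dG (x t) x') (at t)"
    using diff_chain_at[OF assms(2)[unfolded has_vector_derivative_def] G_has_derivative[OF assms(1)]]
    by (simp add: o_def has_vector_derivative_def linear_scale[OF linear_dG[OF assms(1)]])
  from bounded_bilinear.has_vector_derivative[OF bounded_bilinear_inner assms(3)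
      bounded_bilinear.has_vector_derivative[OF bounded_bilinear_matrix_vector_mult this assms(4)]]
  have "((\<lambda>t. gm (x t) (u t) (v t)) has_vector_derivative
      u t \<bullet> (G (x t) *v v' + dG (x t) x' *v v t) + u' \<bullet> (G (x t) *v v t)) (at t)"
    by (simp add: metric_at_def)
  moreover have "u t \<bullet> (G (x t) *v v' + dG (x t) x' *v v t) + u' \<bullet> (G (x t) *v v t) =
      gm (x t) (u' + \<Gamma> (x t) x' (u t)) (v t) + gm (x t) (u t) (v' + \<Gamma> (x t) x' (v t))"
    unfolding linear_add[OF linear_metric_at_left] linear_add[OF linear_metric_at_right] inner_add_right
      metric_compatible[OF assms(1)] by (simp add: metric_at_def)
  ultimately show ?thesis by simp
qed

end

section \<open>Covariant derivatives of tensor fields\<close>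

text \<open>Smoothness is demanded with constant argument vectors, that is, of the components;
  linearity in each slot carries it over to moving arguments.\<close>

definition tensor_field_on :: "(real ^ 'm::finite) set \<Rightarrow> nat \<Rightarrow> 'm tensor_field \<Rightarrow> bool" where
  "tensor_field_on S r T \<longleftrightarrow>
    (\<forall>vs. length vs = r \<longrightarrow> smooth_on S (\<lambda>y. T y vs)) \<and>
    (\<forall>x\<in>S. \<forall>vs i. length vs = r \<longrightarrow> i < r \<longrightarrow> linear (\<lambda>v. T x (vs[i := v])))"

lemma tensor_field_smooth: "tensor_field_on S r T \<Longrightarrow> length vs = r \<Longrightarrow> smooth_on S (\<lambda>y. T y vs)"
  by (simp add: tensor_field_on_def)

lemma tensor_field_linear:
  "tensor_field_on S r T \<Longrightarrow> x \<in> S \<Longrightarrow> length vs = r \<Longrightarrow> i < r \<Longrightarrow> linear (\<lambda>v. T x (vs[i := v]))"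
  by (simp add: tensor_field_on_def)

lemma tensor_field_linear_append:
  assumes "tensor_field_on S r T" "x \<in> S" "length us + Suc (length ws) = r"
  shows "linear (\<lambda>v. T x (us @ v # ws))"
  using tensor_field_linear[OF assms(1,2), of "us @ 0 # ws" "length us"] assms(3) by simp

lemma tensor_field_frechet_linear:
  assumes "open S" "tensor_field_on S r T" "x \<in> S" "length vs = r" "i < r"
  shows "linear (\<lambda>v. frechet_derivative (\<lambda>y. T y (vs[i := v])) (at x) w)"
proof (rule linear_frechet_derivative_param[OF assms(1,3)])
  show "linear (\<lambda>v. T y (vs[i := v]))" if "y \<in> S" for y
    using tensor_field_linear[OF assms(2) that assms(4,5)] .
  show "(\<lambda>y. T y (vs[i := v])) differentiable (at x)" for v
    using smooth_on_has_derivative[OF tensor_field_smooth[OF assms(2), of "vs[i := v]"] assms(3)] assms(4)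
    by (auto simp: differentiable_def)
qed

lemma tensor_along_curve:
  assumes I: "open I" "t \<in> I" "x ` I \<subseteq> S" and S: "open S" and T: "tensor_field_on S r T"
    and x: "(x has_vector_derivative x') (at t)"
    and us: "list_all2 (\<lambda>u u'. (u has_vector_derivative u') (at t)) us us'"
    and len: "length us + length ws = r"
  shows "((\<lambda>t. T (x t) (map (\<lambda>u. u t) us @ ws)) has_vector_derivative
    frechet_derivative (\<lambda>y. T y (map (\<lambda>u. u t) us @ ws)) (at (x t)) x'
    + (\<Sum>i<length us. T (x t) ((map (\<lambda>u. u t) us @ ws)[i := us' ! i]))) (at t)"
  using us len
proof (induction us arbitrary: us' ws rule: rev_induct)
  case Nil
  have xS: "x t \<in> S" using I by auto
  have s: "smooth_on S (\<lambda>y. T y ws)" using tensor_field_smooth[OF T] Nil by simp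
  have "((\<lambda>t. T (x t) ws) has_derivative (\<lambda>h. frechet_derivative (\<lambda>y. T y ws) (at (x t)) (h *\<^sub>R x'))) (at t)"
    using diff_chain_at[OF x[unfolded has_vector_derivative_def] smooth_on_has_derivative[OF s xS]]
    by (simp add: o_def)
  then show ?case
    using linear_scale[OF has_derivative_linear[OF smooth_on_has_derivative[OF s xS]]]
    by (simp add: has_vector_derivative_def)
next
  case (snoc u us)
  have xS: "x s \<in> S" if "s \<in> I" for s using I(3) that by auto
  obtain u' vs' where us': "us' = vs' @ [u']" and l': "list_all2 (\<lambda>u u'. (u has_vector_derivative u') (at t)) us vs'"
    and u: "(u has_vector_derivative u') (at t)"
    using snoc.prems(1) by (auto simp: list_all2_append1 list_all2_Cons1)
  have lvs': "length vs' = length us" using l' by (simp add: list_all2_lengthD)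
  have len: "length us + Suc (length ws) = r" using snoc.prems(2) by simp
  let ?U = "\<lambda>s. map (\<lambda>u. u s) us"
  let ?n = "length us"
  have expand: "T (x s) (?U s @ u s # ws) = (\<Sum>b\<in>Basis. (u s \<bullet> b) * T (x s) (?U s @ b # ws))" if "s \<in> I" for s
    using linear_sum_basis[OF tensor_field_linear_append[OF T xS[OF that], of "?U s" ws], of "u s"] len by simp
  have IH: "((\<lambda>t. T (x t) (?U t @ b # ws)) has_vector_derivative
      frechet_derivative (\<lambda>y. T y (?U t @ b # ws)) (at (x t)) x'
      + (\<Sum>i<?n. T (x t) ((?U t @ b # ws)[i := vs' ! i]))) (at t)" for b
    using snoc.IH[OF l', of "b # ws"] len by simp
  let ?F0 = "\<lambda>b. frechet_derivative (\<lambda>y. T y (?U t @ b # ws)) (at (x t)) x'"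
  let ?F1 = "\<lambda>i b. T (x t) ((?U t @ b # ws)[i := vs' ! i])"
  let ?F2 = "\<lambda>b. T (x t) (?U t @ b # ws)"
  have "((\<lambda>s. \<Sum>b\<in>Basis. (u s \<bullet> b) * T (x s) (?U s @ b # ws)) has_vector_derivative
      (\<Sum>b\<in>Basis. (u t \<bullet> b) * (?F0 b + (\<Sum>i<?n. ?F1 i b)) + (u' \<bullet> b) * ?F2 b)) (at t)"
    by (intro has_vector_derivative_sum
        bounded_bilinear.has_vector_derivative[OF bounded_bilinear_mult] IH
        bounded_linear.has_vector_derivative[OF bounded_linear_inner_left u])
  then have D: "((\<lambda>s. T (x s) (?U s @ u s # ws)) has_vector_derivative
      (\<Sum>b\<in>Basis. (u t \<bullet> b) * (?F0 b + (\<Sum>i<?n. ?F1 i b)) + (u' \<bullet> b) * ?F2 b)) (at t)"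
    by (rule has_vector_derivative_transform_within_open[OF _ I(1,2)]) (simp add: expand)
  have l0: "linear ?F0"
    using tensor_field_frechet_linear[OF S T xS[OF I(2)], of "?U t @ 0 # ws" ?n x'] len by (simp add: list_update_append)
  have l1: "linear (?F1 i)" if "i < ?n" for i
    using tensor_field_linear[OF T xS[OF I(2)], of "(?U t @ 0 # ws)[i := vs' ! i]" ?n] len that
    by (simp add: list_update_swap[of i ?n] list_update_append)
  have l2: "linear ?F2"
    using tensor_field_linear_append[OF T xS[OF I(2)], of "?U t" ws] len by simp
  have e1: "?F1 i (u t) = (\<Sum>b\<in>Basis. (u t \<bullet> b) * ?F1 i b)" if "i < ?n" for i
    using linear_sum_basis[OF l1[OF that], of "u t"] by simp
  \<comment> \<open>The sum over the basis is folded back term by term, each term being linear in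
    slot \<open>?n\<close>.\<close>
  have "?F0 (u t) + (\<Sum>i<?n. ?F1 i (u t)) + ?F2 u' =
      (\<Sum>b\<in>Basis. (u t \<bullet> b) * ?F0 b) + (\<Sum>i<?n. \<Sum>b\<in>Basis. (u t \<bullet> b) * ?F1 i b) + (\<Sum>b\<in>Basis. (u' \<bullet> b) * ?F2 b)"
    using linear_sum_basis[OF l0, of "u t"] linear_sum_basis[OF l2, of u'] e1 by simp
  also have "(\<Sum>i<?n. \<Sum>b\<in>Basis. (u t \<bullet> b) * ?F1 i b) = (\<Sum>b\<in>Basis. (u t \<bullet> b) * (\<Sum>i<?n. ?F1 i b))"
    by (subst sum.swap) (simp add: sum_distrib_left)
  finally have "(\<Sum>b\<in>Basis. (u t \<bullet> b) * (?F0 b + (\<Sum>i<?n. ?F1 i b)) + (u' \<bullet> b) * ?F2 b) =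
      ?F0 (u t) + (\<Sum>i<?n. ?F1 i (u t)) + ?F2 u'"
    by (simp add: sum.distrib algebra_simps)
  with D have "((\<lambda>s. T (x s) (?U s @ u s # ws)) has_vector_derivative
      ?F0 (u t) + (\<Sum>i<?n. ?F1 i (u t)) + ?F2 u') (at t)" by metis
  moreover have "(\<Sum>i<?n. T (x t) ((?U t @ u t # ws)[i := us' ! i])) = (\<Sum>i<?n. ?F1 i (u t))"
    by (rule sum.cong) (auto simp: us' nth_append lvs')
  moreover have "T (x t) ((?U t @ u t # ws)[?n := us' ! ?n]) = ?F2 u'"
    by (simp add: us' nth_append lvs' list_update_append)
  ultimately show ?case by (simp add: add.assoc)
qed

context metric_chart
begin

lemma tensor_cov_deriv_snoc:
  "tensor_cov_deriv G T x (vs @ [w]) = frechet_derivative (\<lambda>y. T y vs) (at x) w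
    - (\<Sum>i<length vs. T x (vs[i := \<Gamma> x w (vs ! i)]))"
  by (simp add: tensor_cov_deriv_def levi_civita_const Let_def)

lemma smooth_on_tensor_christoffel:
  assumes T: "tensor_field_on S r T" and l: "length vs = r" "i < r"
  shows "smooth_on S (\<lambda>y. T y (vs[i := \<Gamma> y w u]))"
  unfolding smooth_on_def
proof
  fix n
  have "hd_on S (\<lambda>y. \<Sum>b\<in>Basis. (\<Gamma> y w u \<bullet> b) *\<^sub>R T y (vs[i := b])) n"
    using l by (intro hd_on_sum hd_on_scaleR hd_on_inner hd_on_const open_S
        smooth_on_imp_hd_on[OF smooth_on_christoffel_form] smooth_on_imp_hd_on[OF tensor_field_smooth[OF T]]) auto
  then show "hd_on S (\<lambda>y. T y (vs[i := \<Gamma> y w u])) n"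
    by (rule hd_on_cong[OF open_S])
      (use linear_sum_basis[OF tensor_field_linear[OF T _ l]] in simp)
qed

text \<open>Closure under covariant differentiation permits iteration; the rank grows by one because
  the direction of differentiation becomes the last slot.\<close>

lemma tensor_field_cov_deriv:
  assumes T: "tensor_field_on S r T"
  shows "tensor_field_on S (Suc r) (tensor_cov_deriv G T)"
  unfolding tensor_field_on_def
proof (intro conjI allI impI ballI)
  fix ws :: "(real ^ 'm) list" assume "length ws = Suc r"
  then obtain vs w where ws: "ws = vs @ [w]" "length vs = r" by (metis length_Suc_conv_rev)
  show "smooth_on S (\<lambda>y. tensor_cov_deriv G T y ws)"
    unfolding ws(1) tensor_cov_deriv_snoc smooth_on_def
    using ws(2)
    by (intro allI hd_on_diff hd_on_sum open_S smooth_on_imp_hd_on[OF smooth_on_tensor_christoffel[OF T]]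
        smooth_on_imp_hd_on[OF smooth_on_frechet_derivative[OF tensor_field_smooth[OF T]]]) auto
next
  fix x :: "real ^ 'm" and ws :: "(real ^ 'm) list" and i
  assume x: "x \<in> S" and l: "length ws = Suc r" and i: "i < Suc r"
  then obtain vs w where ws: "ws = vs @ [w]" "length vs = r" by (metis length_Suc_conv_rev)
  show "linear (\<lambda>v. tensor_cov_deriv G T x (ws[i := v]))"
  proof (cases "i = r")
    \<comment> \<open>The slot being varied is the direction of differentiation, which enters the
      derivative and every Christoffel correction.\<close>
    case True
    have "linear (\<lambda>v. frechet_derivative (\<lambda>y. T y vs) (at x) v - (\<Sum>j<r. T x (vs[j := \<Gamma> x v (vs ! j)])))"
    proof (intro linear_compose_sub linear_compose_sum ballI)
      show "linear (frechet_derivative (\<lambda>y. T y vs) (at x))"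
        using has_derivative_linear[OF smooth_on_has_derivative[OF tensor_field_smooth[OF T ws(2)] x]] .
      fix j assume "j \<in> {..<r}"
      then show "linear (\<lambda>v. T x (vs[j := \<Gamma> x v (vs ! j)]))"
        using linear_compose[OF linear_christoffel_form_left[of G x "vs ! j"] tensor_field_linear[OF T x ws(2), of j]]
        by (simp add: o_def)
    qed
    then show ?thesis using True ws by (simp add: list_update_append tensor_cov_deriv_snoc)
  next
    case False
    then have i: "i < r" using i by simp
    have "linear (\<lambda>v. frechet_derivative (\<lambda>y. T y (vs[i := v])) (at x) w
        - (\<Sum>j<r. T x (vs[i := v, j := \<Gamma> x w (vs[i := v] ! j)])))"
    proof (intro linear_compose_sub linear_compose_sum ballI)
      show "linear (\<lambda>v. frechet_derivative (\<lambda>y. T y (vs[i := v])) (at x) w)"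
        by (rule tensor_field_frechet_linear[OF open_S T x ws(2) i])
      fix j assume j: "j \<in> {..<r}"
      show "linear (\<lambda>v. T x (vs[i := v, j := \<Gamma> x w (vs[i := v] ! j)]))"
      \<comment> \<open>In the slot being varied, the correction depends on \<open>v\<close> through
        \<open>\<Gamma>\<close>; in any other slot it commutes with the insertion of
        \<open>v\<close>.\<close>
      proof (cases "j = i")
        case True
        then show ?thesis
          using linear_compose[OF linear_christoffel_form_right[of G x w] tensor_field_linear[OF T x ws(2) i]]
            i ws(2) by (simp add: o_def)
      next
        case False
        then show ?thesis
          using tensor_field_linear[OF T x _ i, of "vs[j := \<Gamma> x w (vs ! j)]"] ws(2)
          by (simp add: list_update_swap[of i j])
      qed
    qed
    then show ?thesis using i ws by (simp add: list_update_append tensor_cov_deriv_snoc)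
  qed
qed

lemma riemann_tensor_eq: "riemann_tensor G x [a, b, c, d] = gm x
    (frechet_derivative (\<lambda>y. \<Gamma> y b c) (at x) a + \<Gamma> x a (\<Gamma> x b c)
    - (frechet_derivative (\<lambda>y. \<Gamma> y a c) (at x) b + \<Gamma> x b (\<Gamma> x a c))) d"
  by (simp add: riemann_tensor_def curvature_const numeral_2_eq_2 numeral_3_eq_3)

lemma hd_on_gm: "open A \<Longrightarrow> h ` A \<subseteq> S \<Longrightarrow> hd_on A h n \<Longrightarrow> hd_on A u n \<Longrightarrow> hd_on A v n \<Longrightarrow>
    hd_on A (\<lambda>y. gm (h y) (u y) (v y)) n"
  unfolding metric_at_def
  by (intro hd_on_inner hd_on_matrix_vector_mult hd_on_compose[OF open_S _ hd_on_G])

lemma tensor_field_riemann: "tensor_field_on S 4 (riemann_tensor G)"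
  unfolding tensor_field_on_def
proof (intro conjI allI impI ballI)
  fix vs :: "(real ^ 'm) list" assume "length vs = 4"
  then obtain a b c d where vs: "vs = [a, b, c, d]"
    by (auto simp: length_Suc_conv eval_nat_numeral)
  note h = smooth_on_imp_hd_on[OF smooth_on_christoffel_form]
  show "smooth_on S (\<lambda>y. riemann_tensor G y vs)"
    unfolding vs riemann_tensor_eq smooth_on_def
    by (intro allI hd_on_gm hd_on_diff hd_on_add hd_on_christoffel_form_compose open_S hd_on_ident hd_on_const
        h smooth_on_imp_hd_on[OF smooth_on_frechet_derivative[OF smooth_on_christoffel_form]]) auto
next
  fix x :: "real ^ 'm" and vs :: "(real ^ 'm) list" and i :: nat
  assume x: "x \<in> S" and l: "length vs = 4" and i: "i < 4"
  obtain a b c d where vs: "vs = [a, b, c, d]"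
    using l by (auto simp: length_Suc_conv eval_nat_numeral)
  note lin = linear_christoffel_form_left linear_christoffel_form_right frechet_christoffel_linear[OF x]
    linear_compose[OF linear_christoffel_form_right linear_christoffel_form_right, unfolded o_def]
    linear_compose[OF linear_christoffel_form_left linear_christoffel_form_right, unfolded o_def]
  have "linear (\<lambda>a. riemann_tensor G x [a, b, c, d])" "linear (\<lambda>b. riemann_tensor G x [a, b, c, d])"
    "linear (\<lambda>c. riemann_tensor G x [a, b, c, d])"
    unfolding riemann_tensor_eq
    by (rule linear_compose[OF _ linear_metric_at_left, unfolded o_def],
        intro linear_compose_sub linear_compose_add lin)+
  moreover have "linear (\<lambda>d. riemann_tensor G x [a, b, c, d])"
    unfolding riemann_tensor_eq by (rule linear_metric_at_right[unfolded eta_contract_eq])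
  moreover have "i = 0 \<or> i = 1 \<or> i = 2 \<or> i = 3" using i by auto
  ultimately show "linear (\<lambda>v. riemann_tensor G x (vs[i := v]))"
    by (auto simp: vs numeral_2_eq_2 numeral_3_eq_3)
qed

lemma tensor_field_cov_deriv_riemann:
  "tensor_field_on S (4 + k) ((tensor_cov_deriv G ^^ k) (riemann_tensor G))"
proof (induction k)
  case (Suc k)
  then show ?case using tensor_field_cov_deriv[OF Suc] by simp
qed (simp add: tensor_field_riemann)

text \<open>The components of a parallel field change by exactly the negative Christoffel term that
  the covariant derivative subtracts, so the ordinary derivative along the curve is the covariant
  one.\<close>

lemma tensor_along_parallel:
  assumes I: "open I" "t \<in> I" "x ` I \<subseteq> S" and T: "tensor_field_on S (length us) T"
    and x: "(x has_vector_derivative x') (at t)"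
    and us: "\<And>u. u \<in> set us \<Longrightarrow> (u has_vector_derivative - \<Gamma> (x t) x' (u t)) (at t)"
  shows "((\<lambda>t. T (x t) (map (\<lambda>u. u t) us)) has_vector_derivative
    tensor_cov_deriv G T (x t) (map (\<lambda>u. u t) us @ [x'])) (at t)"
proof -
  let ?U = "map (\<lambda>u. u t) us"
  have xS: "x t \<in> S" using I by auto
  have "list_all2 (\<lambda>u u'. (u has_vector_derivative u') (at t)) us (map (\<lambda>u. - \<Gamma> (x t) x' (u t)) us)"
    using us by (auto simp: list_all2_conv_all_nth)
  from tensor_along_curve[OF I open_S T x this, of "[]"]
  have "((\<lambda>t. T (x t) (map (\<lambda>u. u t) us)) has_vector_derivative
    frechet_derivative (\<lambda>y. T y ?U) (at (x t)) x'
    + (\<Sum>i<length us. T (x t) (?U[i := - \<Gamma> (x t) x' (?U ! i)]))) (at t)"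
    by (simp cong: sum.cong_simp)
  moreover have "T (x t) (?U[i := - v]) = - T (x t) (?U[i := v])" if "i < length us" for i v
    using linear_neg[OF tensor_field_linear[OF T xS _ that, of ?U]] by simp
  ultimately show ?thesis by (simp add: tensor_cov_deriv_snoc sum_negf)
qed

text \<open>The velocity of a geodesic is itself parallel, so it may fill the two inner slots of the
  curvature and all derivative slots. Each ordinary differentiation then appends one more copy of
  \<open>v t\<close>.\<close>

lemma riemann_derivatives_along_geodesic:
  assumes I: "open I" "t \<in> I" "x ` I \<subseteq> S"
    and x: "(x has_vector_derivative v t) (at t)"
    and v: "(v has_vector_derivative - \<Gamma> (x t) (v t) (v t)) (at t)"
    and e: "(e has_vector_derivative - \<Gamma> (x t) (v t) (e t)) (at t)"
    and f: "(f has_vector_derivative - \<Gamma> (x t) (v t) (f t)) (at t)"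
  shows "((\<lambda>t. (tensor_cov_deriv G ^^ k) (riemann_tensor G) (x t) ([e t, v t, v t, f t] @ replicate k (v t)))
    has_vector_derivative
     (tensor_cov_deriv G ^^ Suc k) (riemann_tensor G) (x t) ([e t, v t, v t, f t] @ replicate (Suc k) (v t))) (at t)"
proof -
  have "tensor_field_on S (length ([e, v, v, f] @ replicate k v)) ((tensor_cov_deriv G ^^ k) (riemann_tensor G))"
    using tensor_field_cov_deriv_riemann[of k] by (simp add: add.commute eval_nat_numeral)
  from tensor_along_parallel[OF I this x] show ?thesis
    using v e f by (auto simp: replicate_append_same)
qed

end

section \<open>Geodesics and changes of charts\<close>

lemma mixed_mean_value:
  fixes f :: "'a::real_normed_vector \<Rightarrow> real"
  assumes "open S" "hd_on S f 2" "ball x r \<subseteq> S" "0 < h" "h * (norm u + norm v) < r"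
  shows "\<exists>p\<in>ball x r. f (x + h *\<^sub>R u + h *\<^sub>R v) - f (x + h *\<^sub>R u) - f (x + h *\<^sub>R v) + f x =
    h * h * frechet_derivative (\<lambda>y. frechet_derivative f (at y) u) (at p) v"
proof -
  let ?Du = "\<lambda>y. frechet_derivative f (at y) u"
  have mem: "x + s *\<^sub>R u + t *\<^sub>R v \<in> ball x r" if "0 \<le> s" "s \<le> h" "0 \<le> t" "t \<le> h" for s t
  proof -
    have "norm (s *\<^sub>R u + t *\<^sub>R v) \<le> s * norm u + t * norm v"
      using norm_triangle_ineq[of "s *\<^sub>R u" "t *\<^sub>R v"] that by simp
    also have "\<dots> \<le> h * norm u + h * norm v" using that by (intro add_mono mult_right_mono) auto
    finally have "dist x (x + (s *\<^sub>R u + t *\<^sub>R v)) < r"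
      using assms(5) by (simp add: dist_norm algebra_simps norm_minus_commute)
    then show ?thesis by (simp add: add.assoc)
  qed
  have d1: "f differentiable (at y)" if "y \<in> S" for y using assms(2) that by (simp add: numeral_2_eq_2)
  have d2: "?Du differentiable (at y)" if "y \<in> S" for y using assms(2) that by (simp add: numeral_2_eq_2)
  have line: "((\<lambda>s. F (a + s *\<^sub>R w)) has_real_derivative frechet_derivative F (at (a + s *\<^sub>R w)) w) (at s)"
    if F: "F differentiable (at (a + s *\<^sub>R w))" for F :: "'a \<Rightarrow> real" and a w s
  proof -
    have "((\<lambda>s. a + s *\<^sub>R w) has_derivative (\<lambda>h. h *\<^sub>R w)) (at s)" by (auto intro!: derivative_eq_intros)
    from diff_chain_at[OF this has_derivative_frechet[OF F]]
    show ?thesis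
      using linear_scale[OF linear_frechet_derivative[OF F]]
      by (simp add: o_def has_field_derivative_def mult.commute[of _ "frechet_derivative F _ _"])
  qed
  \<comment> \<open>The mean value theorem is applied to the increment in direction \<open>v\<close>
    as a function of the coefficient of \<open>u\<close>, and then to the resulting increment of the
    derivative.\<close>
  have k: "((\<lambda>s. f (x + s *\<^sub>R u + h *\<^sub>R v) - f (x + s *\<^sub>R u)) has_real_derivative
      ?Du (x + s *\<^sub>R u + h *\<^sub>R v) - ?Du (x + s *\<^sub>R u)) (at s)" if "0 \<le> s" "s \<le> h" for s
    using line[of f "x + h *\<^sub>R v" s u] line[of f x s u] d1 mem[of s h] mem[of s 0] that assms(3,4)
    by (intro DERIV_diff) (auto simp: algebra_simps subset_iff)
  obtain s where s: "0 < s" "s < h" and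
    1: "(f (x + h *\<^sub>R u + h *\<^sub>R v) - f (x + h *\<^sub>R u)) - (f (x + 0 *\<^sub>R u + h *\<^sub>R v) - f (x + 0 *\<^sub>R u)) =
      (h - 0) * (?Du (x + s *\<^sub>R u + h *\<^sub>R v) - ?Du (x + s *\<^sub>R u))"
    using MVT2[OF assms(4) k] by blast
  have l: "((\<lambda>t. ?Du (x + s *\<^sub>R u + t *\<^sub>R v)) has_real_derivative
      frechet_derivative ?Du (at (x + s *\<^sub>R u + t *\<^sub>R v)) v) (at t)" if "0 \<le> t" "t \<le> h" for t
    using line[of ?Du "x + s *\<^sub>R u" t v] d2 mem[of s t] that s assms(3) by (auto simp: subset_iff)
  obtain t where t: "0 < t" "t < h" and
    2: "?Du (x + s *\<^sub>R u + h *\<^sub>R v) - ?Du (x + s *\<^sub>R u + 0 *\<^sub>R v) =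
      (h - 0) * frechet_derivative ?Du (at (x + s *\<^sub>R u + t *\<^sub>R v)) v"
    using MVT2[OF assms(4) l] by blast
  show ?thesis
    using 1 2 mem[of s t] s t by (intro bexI[of _ "x + s *\<^sub>R u + t *\<^sub>R v"]) auto
qed

text \<open>The second difference is unchanged when \<open>u\<close> and \<open>v\<close> are
  exchanged. By \<open>mixed_mean_value\<close> it is \<open>h * h\<close> times a value near
  \<open>x\<close> of either mixed derivative, and continuity at \<open>x\<close> forces the two to
  agree.\<close>

lemma symmetric_second_derivative_real:
  fixes f :: "'a::real_normed_vector \<Rightarrow> real"
  assumes "open S" "hd_on S f 2" "x \<in> S"
  shows "frechet_derivative (\<lambda>y. frechet_derivative f (at y) u) (at x) v =
    frechet_derivative (\<lambda>y. frechet_derivative f (at y) v) (at x) u" (is "?uv x = ?vu x")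
proof (rule ccontr)
  assume ne: "?uv x \<noteq> ?vu x"
  \<comment> \<open>Half of the supposed gap: values closer than \<epsilon> to the two limits cannot
    coincide.\<close>
  define \<epsilon> where "\<epsilon> = \<bar>?uv x - ?vu x\<bar> / 2"
  have \<epsilon>: "\<epsilon> > 0" using ne by (simp add: \<epsilon>_def)
  have "isCont ?uv x" "isCont ?vu x"
    using assms by (auto simp: numeral_2_eq_2 continuous_on_eq_continuous_at)
  then obtain d1 d2 where d: "d1 > 0" "d2 > 0" "\<And>p. dist p x < d1 \<Longrightarrow> dist (?uv p) (?uv x) < \<epsilon>"
    "\<And>p. dist p x < d2 \<Longrightarrow> dist (?vu p) (?vu x) < \<epsilon>"
    using \<epsilon> unfolding continuous_at_eps_delta by (metis dist_norm real_norm_def dist_commute)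
  obtain d3 where d3: "d3 > 0" "ball x d3 \<subseteq> S" using assms(1,3) open_contains_ball by blast
  define r where "r = min d3 (min d1 d2)"
  have r: "r > 0" "ball x r \<subseteq> S" "r \<le> d1" "r \<le> d2" using d d3 by (auto simp: r_def)
  define h where "h = r / (2 * (norm u + norm v + 1))"
  have N: "norm u + norm v + 1 > 0" by (simp add: add_nonneg_pos)
  have h: "h > 0" using r N by (simp add: h_def)
  have "h * (norm u + norm v) \<le> h * (norm u + norm v + 1)" using h by simp
  also have "\<dots> = r / 2" using N by (simp add: h_def field_simps)
  also have "\<dots> < r" using r by simp
  finally have hr: "h * (norm u + norm v) < r" .
  obtain p where p: "p \<in> ball x r" "f (x + h *\<^sub>R u + h *\<^sub>R v) - f (x + h *\<^sub>R u) - f (x + h *\<^sub>R v) + f x = h * h * ?uv p"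
    using mixed_mean_value[OF assms(1,2) r(2) h hr] by blast
  have "h * (norm v + norm u) < r" using hr by (simp add: add.commute)
  from mixed_mean_value[OF assms(1,2) r(2) h this]
  obtain q where q: "q \<in> ball x r" "f (x + h *\<^sub>R v + h *\<^sub>R u) - f (x + h *\<^sub>R v) - f (x + h *\<^sub>R u) + f x = h * h * ?vu q"
    by blast
  have "h * h * ?uv p = h * h * ?vu q" using p(2) q(2) by (simp add: algebra_simps)
  then have "?uv p = ?vu q" using h by simp
  moreover have "dist (?uv p) (?uv x) < \<epsilon>" "dist (?vu q) (?vu x) < \<epsilon>"
    using p(1) q(1) r d(3)[of p] d(4)[of q] by (auto simp: dist_commute)
  ultimately have "\<bar>?uv x - ?vu x\<bar> < \<epsilon> + \<epsilon>" unfolding dist_real_def by linarith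
  then show False by (simp add: \<epsilon>_def)
qed

lemma symmetric_second_derivative:
  fixes f :: "'a::real_normed_vector \<Rightarrow> 'b::euclidean_space"
  assumes "open S" "hd_on S f 2" "x \<in> S"
  shows "frechet_derivative (\<lambda>y. frechet_derivative f (at y) u) (at x) v =
    frechet_derivative (\<lambda>y. frechet_derivative f (at y) v) (at x) u"
proof (rule euclidean_eqI)
  fix b :: 'b assume "b \<in> Basis"
  have hb: "hd_on S (\<lambda>y. f y \<bullet> b) 2" by (rule hd_on_inner[OF assms(1,2) hd_on_const])
  have D1: "frechet_derivative (\<lambda>y. f y \<bullet> b) (at y) w = frechet_derivative f (at y) w \<bullet> b" if "y \<in> S" for y w
    using frechet_derivativeI[OF bounded_linear.has_derivative[OF bounded_linear_inner_left
          hd_on_Suc_has_derivative[of S f 1]]] assms(2) that by (metis numeral_2_eq_2 One_nat_def)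
  have D2: "frechet_derivative (\<lambda>y. frechet_derivative (\<lambda>y. f y \<bullet> b) (at y) w) (at x) z =
      frechet_derivative (\<lambda>y. frechet_derivative f (at y) w) (at x) z \<bullet> b" for w z
  proof -
    have "((\<lambda>y. frechet_derivative f (at y) w) has_derivative
        frechet_derivative (\<lambda>y. frechet_derivative f (at y) w) (at x)) (at x)"
      using assms(2,3) by (intro has_derivative_frechet) (simp add: numeral_2_eq_2)
    from has_derivative_transform_within_open[OF bounded_linear.has_derivative[OF bounded_linear_inner_left this]
        assms(1,3), of b "\<lambda>y. frechet_derivative (\<lambda>y. f y \<bullet> b) (at y) w"]
    have "((\<lambda>y. frechet_derivative (\<lambda>y. f y \<bullet> b) (at y) w) has_derivative
        (\<lambda>z. frechet_derivative (\<lambda>y. frechet_derivative f (at y) w) (at x) z \<bullet> b)) (at x)"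
      by (simp add: D1)
    from frechet_derivativeI[OF this] show ?thesis by simp
  qed
  show "frechet_derivative (\<lambda>y. frechet_derivative f (at y) u) (at x) v \<bullet> b =
      frechet_derivative (\<lambda>y. frechet_derivative f (at y) v) (at x) u \<bullet> b"
    using symmetric_second_derivative_real[OF assms(1) hb assms(3), of u v] by (simp add: D2)
qed

section \<open>Chain rules along curves and the transformation law\<close>

lemma linear_family_along_curve:
  fixes F :: "'a::real_normed_vector \<Rightarrow> 'c::euclidean_space \<Rightarrow> 'b::real_normed_vector"
  assumes S: "open S" "\<And>y. y \<in> S \<Longrightarrow> linear (F y)" "\<And>y v. y \<in> S \<Longrightarrow> (\<lambda>y. F y v) differentiable (at y)"
    and x: "(x has_vector_derivative x') (at t within I)" and v: "(v has_vector_derivative v') (at t within I)"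
    and t: "t \<in> I" "0 < \<delta>" "\<And>s. s \<in> I \<Longrightarrow> dist s t < \<delta> \<Longrightarrow> x s \<in> S"
  shows "((\<lambda>s. F (x s) (v s)) has_vector_derivative
    frechet_derivative (\<lambda>y. F y (v t)) (at (x t)) x' + F (x t) v') (at t within I)"
proof -
  have xS: "x t \<in> S" using t by simp
  have F: "((\<lambda>s. F (x s) b) has_vector_derivative frechet_derivative (\<lambda>y. F y b) (at (x t)) x') (at t within I)" for b
    using diff_chain_within[OF x[unfolded has_vector_derivative_def]
        has_derivative_at_withinI[OF has_derivative_frechet[OF S(3)[OF xS, of b]]]]
      linear_scale[OF linear_frechet_derivative[OF S(3)[OF xS, of b]]]
    by (simp add: o_def has_vector_derivative_def)
  \<comment> \<open>The moving argument is expanded in the basis, so that only the base point moves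
    inside the linear map of each summand.\<close>
  have "((\<lambda>s. \<Sum>b\<in>Basis. (v s \<bullet> b) *\<^sub>R F (x s) b) has_vector_derivative
      (\<Sum>b\<in>Basis. (v t \<bullet> b) *\<^sub>R frechet_derivative (\<lambda>y. F y b) (at (x t)) x' + (v' \<bullet> b) *\<^sub>R F (x t) b)) (at t within I)"
    by (intro has_vector_derivative_sum bounded_bilinear.has_vector_derivative[OF bounded_bilinear_scaleR] F
        bounded_linear.has_vector_derivative[OF bounded_linear_inner_left v])
  then have "((\<lambda>s. F (x s) (v s)) has_vector_derivative
      (\<Sum>b\<in>Basis. (v t \<bullet> b) *\<^sub>R frechet_derivative (\<lambda>y. F y b) (at (x t)) x' + (v' \<bullet> b) *\<^sub>R F (x t) b)) (at t within I)"
    by (rule has_vector_derivative_transform_within[OF _ t(2,1)])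
      (simp add: linear_sum_basis[OF S(2)[OF t(3)], symmetric])
  then show ?thesis
    by (simp add: sum.distrib linear_sum_basis[OF S(2)[OF xS], symmetric]
        linear_sum_basis[OF linear_frechet_derivative_param[OF S(1) xS S(2) S(3)[OF xS], of x'], symmetric])
qed

context metric_chart
begin

lemma christoffel_along_curve:
  assumes I: "open I" "t \<in> I" "x ` I \<subseteq> S" and x: "(x has_vector_derivative x') (at t)"
    and u: "(u has_vector_derivative u') (at t)" and w: "(w has_vector_derivative w') (at t)"
  shows "((\<lambda>s. \<Gamma> (x s) (u s) (w s)) has_vector_derivative
    frechet_derivative (\<lambda>y. \<Gamma> y (u t) (w t)) (at (x t)) x' + \<Gamma> (x t) u' (w t) + \<Gamma> (x t) (u t) w') (at t)"
proof -
  have xS: "x t \<in> S" using I by auto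
  obtain \<delta> where \<delta>: "\<delta> > 0" "\<And>s. dist s t < \<delta> \<Longrightarrow> x s \<in> S"
    using I by (metis open_dist image_subset_iff)
  have F: "((\<lambda>s. \<Gamma> (x s) b (w s)) has_vector_derivative
      frechet_derivative (\<lambda>y. \<Gamma> y b (w t)) (at (x t)) x' + \<Gamma> (x t) b w') (at t)" for b
    by (rule linear_family_along_curve[OF open_S linear_christoffel_form_right christoffel_form_differentiable x w _ \<delta>(1)])
      (use \<delta>(2) in auto)
  have "((\<lambda>s. \<Sum>b\<in>Basis. (u s \<bullet> b) *\<^sub>R \<Gamma> (x s) b (w s)) has_vector_derivative
      (\<Sum>b\<in>Basis. (u t \<bullet> b) *\<^sub>R (frechet_derivative (\<lambda>y. \<Gamma> y b (w t)) (at (x t)) x' + \<Gamma> (x t) b w')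
        + (u' \<bullet> b) *\<^sub>R \<Gamma> (x t) b (w t))) (at t)"
    by (intro has_vector_derivative_sum bounded_bilinear.has_vector_derivative[OF bounded_bilinear_scaleR] F
        bounded_linear.has_vector_derivative[OF bounded_linear_inner_left u])
  then show ?thesis
    by (simp add: sum.distrib scaleR_add_right linear_sum_basis[OF linear_christoffel_form_left, symmetric]
        linear_sum_basis[OF frechet_christoffel_linear(2)[OF xS], symmetric] algebra_simps)
qed

end

text \<open>The defect \<open>K\<close> of the transformation law is symmetric in its two arguments, while
  \<open>(w, u, v) \<mapsto> h(K(w,u), d\<phi> v)\<close> is antisymmetric in \<open>u, v\<close> by metric compatibility; hence it vanishes.\<close>

lemma christoffel_transformation:
  fixes \<phi> :: "real ^ 'm::finite \<Rightarrow> real ^ 'm"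
  assumes G: "metric_chart G S" and H: "metric_chart H T"
    and O: "open O'" "O' \<subseteq> S" "\<phi> ` O' \<subseteq> T" and \<phi>: "smooth_on O' \<phi>" and x: "x \<in> O'"
    and iso: "\<And>y u v. y \<in> O' \<Longrightarrow> metric_at G y u v =
      metric_at H (\<phi> y) (frechet_derivative \<phi> (at y) u) (frechet_derivative \<phi> (at y) v)"
  shows "frechet_derivative \<phi> (at x) (christoffel_form G x w u) =
    frechet_derivative (\<lambda>y. frechet_derivative \<phi> (at y) u) (at x) w +
    christoffel_form H (\<phi> x) (frechet_derivative \<phi> (at x) w) (frechet_derivative \<phi> (at x) u)"
proof -
  interpret G: metric_chart G S by fact
  interpret H: metric_chart H T by fact
  let ?D = "\<lambda>y. frechet_derivative \<phi> (at y)"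
  let ?DD = "\<lambda>w u. frechet_derivative (\<lambda>y. ?D y u) (at x) w"
  have d: "(\<phi> has_derivative ?D y) (at y)" if "y \<in> O'" for y using smooth_on_has_derivative[OF \<phi> that] .
  have dd: "((\<lambda>y. ?D y u) has_derivative (\<lambda>w. ?DD w u)) (at x)" for u
    using smooth_on_has_derivative[OF smooth_on_frechet_derivative[OF \<phi>] x] .
  have lD: "linear (?D x)" using d[OF x] by (rule has_derivative_linear)
  have xS: "x \<in> S" and \<phi>T: "\<phi> x \<in> T" using O x by auto
  define K where "K w u = ?DD w u + H.\<Gamma> (\<phi> x) (?D x w) (?D x u) - ?D x (G.\<Gamma> x w u)" for w u
  have Ksym: "K w u = K u w" for w u
    unfolding K_def using symmetric_second_derivative[OF O(1) smooth_on_imp_hd_on[OF \<phi>] x, of u w]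
      G.christoffel_form_sym[OF xS] H.christoffel_form_sym[OF \<phi>T] by metis
  define c where "c w u v = H.gm (\<phi> x) (K w u) (?D x v)" for w u v
  \<comment> \<open>Both sides of the isometry condition are differentiated along the line
    \<open>x + t *\<^sub>R w\<close>. Metric compatibility expresses each derivative through the
    Christoffel form of its own chart, and their equality is the antisymmetry.\<close>
  have anti: "c w u v = - c w v u" for w u v
  proof -
    have line: "((\<lambda>t. x + t *\<^sub>R w) has_vector_derivative w) (at 0)"
      by (auto intro!: derivative_eq_intros)
    have line': "((\<lambda>t. x + t *\<^sub>R w) has_derivative (\<lambda>t. t *\<^sub>R w)) (at 0)"
      using line by (simp add: has_vector_derivative_def)
    have L: "((\<lambda>t. G.gm (x + t *\<^sub>R w) u v) has_vector_derivative
        G.gm x (G.\<Gamma> x w u) v + G.gm x u (G.\<Gamma> x w v)) (at 0)"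
      using G.gm_along_curve[OF _ line has_vector_derivative_const has_vector_derivative_const] xS by simp
    have \<phi>l: "((\<lambda>t. \<phi> (x + t *\<^sub>R w)) has_vector_derivative ?D x w) (at 0)"
      using diff_chain_at[OF line', of \<phi> "?D x"] d[OF x] linear_scale[OF lD]
      by (simp add: o_def has_vector_derivative_def)
    have Dl: "((\<lambda>t. ?D (x + t *\<^sub>R w) u) has_vector_derivative ?DD w u) (at 0)" for u
      using diff_chain_at[OF line', of "\<lambda>y. ?D y u" "\<lambda>w. ?DD w u"] dd[of u]
        linear_scale[OF has_derivative_linear[OF dd[of u]]]
      by (simp add: o_def has_vector_derivative_def)
    have R: "((\<lambda>t. H.gm (\<phi> (x + t *\<^sub>R w)) (?D (x + t *\<^sub>R w) u) (?D (x + t *\<^sub>R w) v)) has_vector_derivative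
        H.gm (\<phi> x) (?DD w u + H.\<Gamma> (\<phi> x) (?D x w) (?D x u)) (?D x v)
        + H.gm (\<phi> x) (?D x u) (?DD w v + H.\<Gamma> (\<phi> x) (?D x w) (?D x v))) (at 0)"
      using H.gm_along_curve[OF _ \<phi>l Dl Dl] \<phi>T by simp
    have "open ((\<lambda>t. x + t *\<^sub>R w) -` O')"
      by (rule open_vimage[OF O(1)]) (auto intro!: continuous_intros)
    from has_vector_derivative_transform_within_open[OF R this, of "\<lambda>t. G.gm (x + t *\<^sub>R w) u v"]
    have "((\<lambda>t. G.gm (x + t *\<^sub>R w) u v) has_vector_derivative
        H.gm (\<phi> x) (?DD w u + H.\<Gamma> (\<phi> x) (?D x w) (?D x u)) (?D x v)
        + H.gm (\<phi> x) (?D x u) (?DD w v + H.\<Gamma> (\<phi> x) (?D x w) (?D x v))) (at 0)"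
      using x iso by simp
    from vector_derivative_unique_at[OF L this]
    have "H.gm (\<phi> x) (?D x (G.\<Gamma> x w u)) (?D x v) + H.gm (\<phi> x) (?D x u) (?D x (G.\<Gamma> x w v)) =
        H.gm (\<phi> x) (?DD w u + H.\<Gamma> (\<phi> x) (?D x w) (?D x u)) (?D x v)
        + H.gm (\<phi> x) (?D x u) (?DD w v + H.\<Gamma> (\<phi> x) (?D x w) (?D x v))"
      by (simp add: iso[OF x])
    then show ?thesis
      unfolding c_def K_def H.gm_sym[OF \<phi>T, of _ "?D x u"]
      by (simp add: linear_diff[OF linear_metric_at_left] linear_diff[OF linear_metric_at_right])
  qed
  \<comment> \<open>Alternating swaps of the first two and of the last two arguments return to the
    start after six steps, three of which change the sign.\<close>
  have "c w u v = 0" for w u v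
  proof -
    have s: "c a b d = c b a d" for a b d by (simp add: c_def Ksym)
    show ?thesis using anti[of u w v] anti[of v u w] anti[of w v u] s[of w u v] s[of u v w] s[of v w u] by linarith
  qed
  \<comment> \<open>\<open>K\<close> has been tested against images of \<open>?D x\<close> only. An
    isometry is injective, hence surjective between equal dimensions, so these images are all
    vectors.\<close>
  moreover have "surj (?D x)"
  proof (rule linear_injective_imp_surjective[OF lD], rule linear_injective_0[OF lD, THEN iffD2], intro allI impI)
    fix u assume "?D x u = 0"
    then have "G.gm x u u = 0" using iso[OF x, of u u] by (simp add: metric_at_def)
    then show "u = 0" using G.pos_G[OF xS, of u] by (auto simp: metric_at_def)
  qed simp
  ultimately have "H.gm (\<phi> x) (K w u) v = H.gm (\<phi> x) 0 v" for v
    unfolding c_def by (metis surjD linear_0[OF linear_metric_at_left])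
  then have "K w u = 0" using H.gm_eqI[OF \<phi>T] by blast
  then show ?thesis by (simp add: K_def)
qed

section \<open>The exponential map\<close>

lemma hd_on_fst:
  fixes U :: "('x::real_normed_vector \<times> 'y::real_normed_vector) set"
  assumes "open U"
  shows "hd_on U fst n"
  by (rule hd_on_bounded_linear[OF assms bounded_linear_fst hd_on_ident[OF assms]])

lemma hd_on_snd:
  fixes U :: "('x::real_normed_vector \<times> 'y::real_normed_vector) set"
  assumes "open U"
  shows "hd_on U snd n"
  by (rule hd_on_bounded_linear[OF assms bounded_linear_snd hd_on_ident[OF assms]])

lemma hd_on_Pair:
  assumes "open U" "hd_on U f n" "hd_on U h n"
  shows "hd_on U (\<lambda>x. (f x, h x)) n"
proof -
  have "hd_on U (\<lambda>x. (f x, 0) + (0, h x)) n"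
    using hd_on_bounded_linear[OF assms(1) bounded_linear_Pair[OF bounded_linear_ident bounded_linear_zero] assms(2)]
      hd_on_bounded_linear[OF assms(1) bounded_linear_Pair[OF bounded_linear_zero bounded_linear_ident] assms(3)]
    by (intro hd_on_add[OF assms(1)])
  then show ?thesis by simp
qed

lemma has_vector_derivative_Pair_iff:
  shows "((\<lambda>t. (x t, v t)) has_vector_derivative (x', v')) (at t within I) \<longleftrightarrow>
    (x has_vector_derivative x') (at t within I) \<and> (v has_vector_derivative v') (at t within I)"
proof
  assume "((\<lambda>t. (x t, v t)) has_vector_derivative (x', v')) (at t within I)"
  then show "(x has_vector_derivative x') (at t within I) \<and> (v has_vector_derivative v') (at t within I)"
    using bounded_linear.has_vector_derivative[OF bounded_linear_fst, of "\<lambda>t. (x t, v t)" "(x', v')"]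
      bounded_linear.has_vector_derivative[OF bounded_linear_snd, of "\<lambda>t. (x t, v t)" "(x', v')"] by simp
next
  assume "(x has_vector_derivative x') (at t within I) \<and> (v has_vector_derivative v') (at t within I)"
  then show "((\<lambda>t. (x t, v t)) has_vector_derivative (x', v')) (at t within I)"
    using has_derivative_Pair[where f=x and f'="\<lambda>h. h *\<^sub>R x'" and s=I and x=t and g=v and g'="\<lambda>h. h *\<^sub>R v'"]
    by (simp add: has_vector_derivative_def)
qed

lemma chart_facts:
  assumes "is_chart c"
  shows "inj_on (snd c) (fst c)" "continuous_on (fst c) (snd c)"
    "continuous_on (snd c ` fst c) (inv_into (fst c) (snd c))" "open (fst c)" "open (snd c ` fst c)"
proof -
  obtain \<psi> where h: "homeomorphism (fst c) (snd c ` fst c) (snd c) \<psi>"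
    using assms unfolding is_chart_def by (elim conjE exE)
  show inj: "inj_on (snd c) (fst c)"
    by (rule inj_on_inverseI[of _ \<psi>]) (rule homeomorphism_apply1[OF h])
  have "inv_into (fst c) (snd c) y = \<psi> y" if "y \<in> snd c ` fst c" for y
  proof -
    obtain q where q: "y = snd c q" "q \<in> fst c" using \<open>y \<in> snd c ` fst c\<close> by (rule imageE)
    show ?thesis unfolding q(1) inv_into_f_f[OF inj q(2)] homeomorphism_apply1[OF h q(2)] ..
  qed
  then show "continuous_on (snd c ` fst c) (inv_into (fst c) (snd c))"
    using continuous_on_cong[OF refl] homeomorphism_cont2[OF h] by blast
  show "continuous_on (fst c) (snd c)" by (rule homeomorphism_cont1[OF h])
  show "open (fst c)" using assms unfolding is_chart_def by (rule conjunct1)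
  show "open (snd c ` fst c)" using assms unfolding is_chart_def by (rule conjunct1[OF conjunct2])
qed

lemma metric_chart_of_manifold:
  assumes "riemannian_manifold A g" "d \<in> A"
  shows "metric_chart (g d) (snd d ` fst d)"
proof -
  have "is_chart d"
    using conjunct1[OF conjunct1[OF assms(1)[unfolded riemannian_manifold_def], unfolded smooth_atlas_def]] assms(2)
    by (rule bspec)
  then have o: "open (snd d ` fst d)" by (rule chart_facts(5))
  note m = bspec[OF conjunct1[OF conjunct2[OF assms(1)[unfolded riemannian_manifold_def],
          unfolded riemannian_metric_def]] assms(2)]
  note m' = bspec[OF conjunct2[OF m]]
  show ?thesis
    by (rule metric_chart.intro[OF o conjunct1[OF m] conjunct1[OF m'] conjunct2[OF m', rule_format]])
qed

locale manifold_chart =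
  fixes A :: "('a::{t2_space, second_countable_topology}, 'm::finite) chart set"
    and g :: "('a, 'm) metric" and c :: "('a, 'm) chart" and P :: 'a
  assumes manifold: "riemannian_manifold A g" and c: "c \<in> A" and P: "P \<in> fst c"
begin

abbreviation S where "S \<equiv> snd c ` fst c"
abbreviation \<psi> where "\<psi> \<equiv> inv_into (fst c) (snd c)"

sublocale metric_chart "g c" S
  by (rule metric_chart_of_manifold[OF manifold c])

lemma is_chart: "d \<in> A \<Longrightarrow> is_chart d"
  by (rule bspec[OF conjunct1[OF conjunct1[OF manifold[unfolded riemannian_manifold_def], unfolded smooth_atlas_def]]])

lemma \<psi>_in: "y \<in> S \<Longrightarrow> \<psi> y \<in> fst c" and snd_\<psi>: "y \<in> S \<Longrightarrow> snd c (\<psi> y) = y"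
  and \<psi>_snd: "q \<in> fst c \<Longrightarrow> \<psi> (snd c q) = q"
  by (rule inv_into_into, assumption, rule f_inv_into_f, assumption,
      rule inv_into_f_f[OF chart_facts(1)[OF is_chart[OF c]]])

abbreviation overlap where "overlap d \<equiv> snd c ` (fst c \<inter> fst d)"

lemma overlap_eq: "overlap d = S \<inter> \<psi> -` fst d"
proof
  show "overlap d \<subseteq> S \<inter> \<psi> -` fst d"
  proof
    fix y assume "y \<in> overlap d"
    then obtain q where q: "y = snd c q" "q \<in> fst c" "q \<in> fst d" by (elim imageE IntE)
    then show "y \<in> S \<inter> \<psi> -` fst d" using \<psi>_snd[OF q(2)] by simp
  qed
  show "S \<inter> \<psi> -` fst d \<subseteq> overlap d"
  proof
    fix y assume "y \<in> S \<inter> \<psi> -` fst d"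
    then have y: "y \<in> S" "\<psi> y \<in> fst d" by simp_all
    show "y \<in> overlap d"
      by (rule image_eqI[where x="\<psi> y"], rule snd_\<psi>[OF y(1), symmetric], rule IntI[OF \<psi>_in[OF y(1)] y(2)])
  qed
qed

lemma open_overlap: "d \<in> A \<Longrightarrow> open (overlap d)"
  unfolding overlap_eq
  by (rule continuous_open_preimage[OF chart_facts(3,5)[OF is_chart[OF c]] chart_facts(4)[OF is_chart]])

lemma transition_smooth: "d \<in> A \<Longrightarrow> smooth_on (overlap d) (transition c d)"
  by (rule bspec[OF bspec[OF conjunct2[OF conjunct1[OF manifold[unfolded riemannian_manifold_def],
          unfolded smooth_atlas_def]] c]])

lemma transition_in: "transition c d ` overlap d \<subseteq> snd d ` fst d"
proof
  fix y assume "y \<in> transition c d ` overlap d"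
  then obtain q where "y = transition c d (snd c q)" "q \<in> fst c" "q \<in> fst d" by (elim imageE IntE) simp
  then show "y \<in> snd d ` fst d" using \<psi>_snd[of q] by (simp add: transition_def)
qed

lemma transition_isometry:
  assumes d: "d \<in> A" and y: "y \<in> overlap d"
  shows "metric_at (g c) y u v = metric_at (g d) (transition c d y)
    (frechet_derivative (transition c d) (at y) u) (frechet_derivative (transition c d) (at y) v)"
proof -
  let ?D = "matrix (frechet_derivative (transition c d) (at y))"
  have lin: "linear (frechet_derivative (transition c d) (at y))"
    using smooth_on_has_derivative[OF transition_smooth[OF d] y] by (rule has_derivative_linear)
  then have D: "frechet_derivative (transition c d) (at y) w = ?D *v w" for w by (simp add: matrix_works)
  have "g c y = transpose ?D ** g d (transition c d y) ** ?D"
    using bspec[OF bspec[OF bspec[OF conjunct2[OF conjunct2[OF manifold[unfolded riemannian_manifold_def],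
              unfolded riemannian_metric_def]] c] d] y] by (simp only: Let_def)
  then have "g c y *v v = transpose ?D *v (g d (transition c d y) *v (?D *v v))"
    by (simp only: matrix_vector_mul_assoc matrix_mul_assoc)
  then have "u \<bullet> (g c y *v v) = (?D *v u) \<bullet> (g d (transition c d y) *v (?D *v v))"
    using matrix_inner_transpose[of u "transpose ?D"] by (simp only: transpose_transpose)
  then show ?thesis unfolding metric_at_def by (simp only: D[of u] D[of v])
qed

text \<open>\<open>geodesic_on\<close> demands the geodesic equation in every chart that the curve
  meets. Pushing the velocity forward produces a second derivative of the transition map, which the
  transformation law of the Christoffel symbols absorbs.\<close>

lemma geodesic_in_all_charts:
  assumes I: "\<And>t. t \<in> I \<Longrightarrow> x t \<in> S"
    and x: "\<And>t. t \<in> I \<Longrightarrow> (x has_vector_derivative v t) (at t within I)"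
    and v: "\<And>t. t \<in> I \<Longrightarrow> (v has_vector_derivative - \<Gamma> (x t) (v t) (v t)) (at t within I)"
  shows "geodesic_on A g I (\<psi> \<circ> x)"
  unfolding geodesic_on_def
proof (intro conjI ballI)
  have cx: "continuous_on I x" by (rule continuous_on_vector_derivative[OF x])
  show "continuous_on I (\<psi> \<circ> x)"
    using I by (intro continuous_on_compose cx continuous_on_subset[OF chart_facts(3)[OF is_chart[OF c]]]) auto
  show "(\<psi> \<circ> x) ` I \<subseteq> manifold_carrier A"
    using I \<psi>_in c by (auto simp: manifold_carrier_def)
  fix d assume d: "d \<in> A"
  let ?f = "transition c d"
  let ?D = "\<lambda>y. frechet_derivative ?f (at y)"
  note fd = smooth_on_has_derivative[OF transition_smooth[OF d]]
  show "\<exists>w. \<forall>t\<in>I. (\<psi> \<circ> x) t \<in> fst d \<longrightarrow>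
      ((snd d \<circ> (\<psi> \<circ> x)) has_vector_derivative w t) (at t within I) \<and>
      (w has_vector_derivative - christoffel_form (g d) (snd d ((\<psi> \<circ> x) t)) (w t) (w t)) (at t within I)"
  proof (intro exI[of _ "\<lambda>t. ?D (x t) (v t)"] ballI impI conjI)
    fix t assume t: "t \<in> I" and "(\<psi> \<circ> x) t \<in> fst d"
    then have xt: "x t \<in> overlap d" using I by (auto simp: overlap_eq)
    have lin: "linear (?D y)" if "y \<in> overlap d" for y using fd[OF that] by (rule has_derivative_linear)
    have "(?f \<circ> x has_vector_derivative ?D (x t) (v t)) (at t within I)"
      using diff_chain_within[OF x[OF t, unfolded has_vector_derivative_def] has_derivative_at_withinI[OF fd[OF xt]]]
        linear_scale[OF lin[OF xt]] by (simp add: has_vector_derivative_def o_def)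
    then show "((snd d \<circ> (\<psi> \<circ> x)) has_vector_derivative ?D (x t) (v t)) (at t within I)"
      by (simp add: transition_def o_assoc)
    obtain r where r: "r > 0" "ball (x t) r \<subseteq> overlap d"
      using open_overlap[OF d] xt open_contains_ball by blast
    have "continuous (at t within I) x" using cx t by (simp add: continuous_on_eq_continuous_within)
    \<comment> \<open>By continuity the curve stays in the open overlap near \<open>t\<close>, where
      the transition map is smooth.\<close>
    then obtain \<delta> where \<delta>: "\<delta> > 0" "\<And>s. s \<in> I \<Longrightarrow> dist s t < \<delta> \<Longrightarrow> x s \<in> overlap d"
      using r unfolding continuous_within_eps_delta by (metis dist_commute mem_ball subsetD)
    have "((\<lambda>s. ?D (x s) (v s)) has_vector_derivative
        frechet_derivative (\<lambda>y. ?D y (v t)) (at (x t)) (v t) + ?D (x t) (- \<Gamma> (x t) (v t) (v t))) (at t within I)"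
    proof (rule linear_family_along_curve[OF open_overlap[OF d] lin _ x[OF t] v[OF t] t \<delta>])
      show "(\<lambda>y. ?D y v) differentiable (at y)" if "y \<in> overlap d" for y v
        using smooth_on_has_derivative[OF smooth_on_frechet_derivative[OF transition_smooth[OF d]] that]
        by (auto simp: differentiable_def)
    qed
    moreover have "?D (x t) (\<Gamma> (x t) (v t) (v t)) =
        frechet_derivative (\<lambda>y. ?D y (v t)) (at (x t)) (v t) +
        christoffel_form (g d) (?f (x t)) (?D (x t) (v t)) (?D (x t) (v t))"
      by (rule christoffel_transformation[OF metric_chart_of_manifold[OF manifold c]
            metric_chart_of_manifold[OF manifold d] open_overlap[OF d] _ transition_in transition_smooth[OF d] xt
            transition_isometry[OF d]]) auto
    ultimately show "((\<lambda>t. ?D (x t) (v t)) has_vector_derivative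
        - christoffel_form (g d) (snd d ((\<psi> \<circ> x) t)) (?D (x t) (v t)) (?D (x t) (v t))) (at t within I)"
      by (simp add: linear_neg[OF lin[OF xt]]) (simp add: transition_def)
  qed
qed

definition geodesic_field :: "(real ^ 'm) \<times> (real ^ 'm) \<Rightarrow> (real ^ 'm) \<times> (real ^ 'm)" where
  "geodesic_field y = (snd y, - \<Gamma> (fst y) (snd y) (snd y))"

lemma open_phase: "open (S \<times> (UNIV :: (real ^ 'm) set))"
  by (intro open_Times open_S open_UNIV)

lemma hd_on_geodesic_field: "hd_on (S \<times> UNIV) geodesic_field n"
proof -
  have "hd_on (S \<times> UNIV) (\<lambda>y. (snd y, - \<Gamma> (fst y) (snd y) (snd y))) n"
    by (intro hd_on_Pair hd_on_minus hd_on_christoffel_form_compose hd_on_fst hd_on_snd open_phase) simp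
  then show ?thesis unfolding geodesic_field_def[abs_def] .
qed

text \<open>The competitor \<gamma> is not assumed to stay in the chart. The times at which position
  and velocity both agree form a nonempty subset of \<open>{0..1}\<close> that is relatively open,
  by uniqueness for the differential equation, and closed; so it is the whole interval.\<close>

lemma geodesic_unique:
  assumes x: "\<And>t. t \<in> {0..1} \<Longrightarrow> x t \<in> S"
      "\<And>t. t \<in> {0..1} \<Longrightarrow> (x has_vector_derivative v t) (at t within {0..1})"
      "\<And>t. t \<in> {0..1} \<Longrightarrow> (v has_vector_derivative - \<Gamma> (x t) (v t) (v t)) (at t within {0..1})"
    and x0: "x 0 = snd c P"
    and \<gamma>: "geodesic_on A g {0..1} \<gamma>" "\<gamma> 0 = P" "((snd c \<circ> \<gamma>) has_vector_derivative v 0) (at 0 within {0..1})"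
    and t: "t \<in> {0..1}"
  shows "\<gamma> t = \<psi> (x t)"
proof -
  have c\<gamma>: "continuous_on {0..1} \<gamma>" using \<gamma>(1) unfolding geodesic_on_def by (rule conjunct1)
  obtain w where w: "\<And>t. t \<in> {0..1} \<Longrightarrow> \<gamma> t \<in> fst c \<Longrightarrow> ((snd c \<circ> \<gamma>) has_vector_derivative w t) (at t within {0..1})"
     "\<And>t. t \<in> {0..1} \<Longrightarrow> \<gamma> t \<in> fst c \<Longrightarrow>
        (w has_vector_derivative - \<Gamma> (snd c (\<gamma> t)) (w t) (w t)) (at t within {0..1})"
    using bspec[OF conjunct2[OF conjunct2[OF \<gamma>(1)[unfolded geodesic_on_def]]] c] by (elim exE) (rule that, blast+)
  have c\<psi>x: "continuous_on {0..1} (\<lambda>t. \<psi> (x t))"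
    using x(1) by (intro continuous_on_compose2[OF chart_facts(3)[OF is_chart[OF c]] continuous_on_vector_derivative[OF x(2)]]) auto
  \<comment> \<open>The coordinate velocity \<open>w\<close> is known to be the derivative only
    while \<gamma> is in the chart, so uniqueness is applied on a neighbourhood where this
    holds.\<close>
  have near: "\<exists>\<delta>>0. \<forall>t\<in>{0..1}. \<bar>t - s\<bar> < \<delta> \<longrightarrow> \<gamma> t \<in> fst c" if "s \<in> {0..1}" "\<gamma> s \<in> fst c" for s
  proof -
    obtain B where B: "open B" "B \<inter> {0..1} = \<gamma> -` fst c \<inter> {0..1}"
      using continuous_on_open_invariant[THEN iffD1, rule_format, OF c\<gamma> chart_facts(4)[OF is_chart[OF c]]]
      by (elim exE conjE) (rule that)
    have iff: "t \<in> B \<longleftrightarrow> \<gamma> t \<in> fst c" if "t \<in> {0..1}" for t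
      using that B(2)[THEN eqset_imp_iff, of t] by simp
    then have "s \<in> B" using that by simp
    with B(1) obtain \<delta> where \<delta>: "\<delta> > 0" "\<And>t. dist t s < \<delta> \<Longrightarrow> t \<in> B" by (metis open_dist)
    show ?thesis
    proof (intro exI[of _ \<delta>] conjI ballI impI)
      fix t assume "t \<in> {0..1::real}" "\<bar>t - s\<bar> < \<delta>"
      then show "\<gamma> t \<in> fst c" using iff[of t] \<delta>(2)[of t] by (simp add: dist_real_def)
    qed (rule \<delta>(1))
  qed
  define Q where "Q = {s \<in> {0..1}. \<gamma> s = \<psi> (x s) \<and> w s = v s}"
  have Q\<gamma>: "\<gamma> s \<in> fst c" if "s \<in> {0..1}" "\<gamma> s = \<psi> (x s)" for s
    using \<psi>_in[OF x(1)[OF that(1)]] that(2) by simp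
  have "0 \<in> Q"
  proof -
    have "\<gamma> 0 = \<psi> (x 0)" using \<gamma>(2) x0 \<psi>_snd[OF P] by simp
    moreover have "w 0 = v 0"
      by (rule vector_derivative_unique_within_closed_interval[where a=0 and b=1 and x="0::real", unfolded cbox_interval,
            OF _ _ w(1) \<gamma>(3)]) (use \<gamma>(2) P in auto)
    ultimately show ?thesis by (simp add: Q_def)
  qed
  have "openin (top_of_set {0..1}) Q"
    unfolding openin_euclidean_subtopology_iff
  proof (intro conjI ballI)
    fix s assume s: "s \<in> Q"
    then have s1: "s \<in> {0..1}" and e: "\<gamma> s = \<psi> (x s)" "w s = v s" by (auto simp: Q_def)
    obtain \<delta> where \<delta>: "\<delta> > 0" "\<And>t. t \<in> {0..1} \<Longrightarrow> \<bar>t - s\<bar> < \<delta> \<Longrightarrow> \<gamma> t \<in> fst c"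
      using near[OF s1 Q\<gamma>[OF s1 e(1)]] by blast
    obtain \<delta>' where \<delta>': "\<delta>' > 0" "\<And>t. t \<in> {0..1} \<Longrightarrow> \<bar>t - s\<bar> < \<delta>' \<Longrightarrow> (snd c (\<gamma> t), w t) = (x t, v t)"
    proof (rule ode_local_uniqueness[OF open_phase hd_on_geodesic_field[of 1] s1 _ _ _ \<delta>(1),
            of "\<lambda>t. (snd c (\<gamma> t), w t)" "\<lambda>t. (x t, v t)"])
      fix t assume t: "t \<in> {0..1::real}" "\<bar>t - s\<bar> < \<delta>"
      show "(snd c (\<gamma> t), w t) \<in> S \<times> UNIV \<and> ((\<lambda>t. (snd c (\<gamma> t), w t)) has_vector_derivative
          geodesic_field (snd c (\<gamma> t), w t)) (at t within {0..1})"
        using w[OF t(1) \<delta>(2)[OF t]] \<delta>(2)[OF t]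
        by (auto simp: geodesic_field_def o_def has_vector_derivative_Pair_iff)
      show "(x t, v t) \<in> S \<times> UNIV \<and> ((\<lambda>t. (x t, v t)) has_vector_derivative
          geodesic_field (x t, v t)) (at t within {0..1})"
        using x(2,3)[OF t(1)] x(1)[OF t(1)]
        by (auto simp: geodesic_field_def has_vector_derivative_Pair_iff)
    next
      show "(snd c (\<gamma> s), w s) = (x s, v s)" using e snd_\<psi> x(1)[OF s1] by simp
    qed blast
    show "\<exists>e>0. \<forall>t\<in>{0..1}. dist t s < e \<longrightarrow> t \<in> Q"
    proof (intro exI[of _ "min \<delta> \<delta>'"] conjI ballI impI)
      fix t assume t: "t \<in> {0..1::real}" "dist t s < min \<delta> \<delta>'"
      have "(snd c (\<gamma> t), w t) = (x t, v t)" using \<delta>'(2)[OF t(1)] t(2) by (simp add: dist_real_def)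
      moreover have "\<gamma> t \<in> fst c" using \<delta>(2)[OF t(1)] t(2) by (simp add: dist_real_def)
      ultimately show "t \<in> Q" using t(1) \<psi>_snd[of "\<gamma> t"] by (simp add: Q_def)
    qed (use \<delta>(1) \<delta>'(1) in auto)
  qed (auto simp: Q_def)
  have "closed Q"
  proof -
    \<comment> \<open>Closedness takes two stages. Agreement of positions is closed because the
      manifold is Hausdorff. At such times \<gamma> lies in the chart, so \<open>w\<close> is
      continuous on \<open>Q'\<close>, and agreement of velocities is closed within it.\<close>
    define Q' where "Q' = {s \<in> {0..1}. \<gamma> s = \<psi> (x s)}"
    \<comment> \<open>Clamping the time extends both curves continuously to the whole line, where
      the set of coincidences is closed.\<close>
    let ?cl = "\<lambda>s::real. max 0 (min 1 s)"
    have cl: "closed {s. \<gamma> (?cl s) = \<psi> (x (?cl s))}"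
      by (intro closed_Collect_eq continuous_on_compose2[OF c\<gamma>] continuous_on_compose2[OF c\<psi>x] continuous_intros) auto
    have eq: "Q' = {s. \<gamma> (?cl s) = \<psi> (x (?cl s))} \<inter> {0..1}" by (auto simp: Q'_def)
    have Q': "closed Q'" unfolding eq by (rule closed_Int[OF cl closed_atLeastAtMost])
    have "continuous_on Q' (\<lambda>s. w s - v s)"
    proof (intro continuous_on_diff)
      have "continuous (at s within Q') w" if "s \<in> Q'" for s
      proof -
        have s: "s \<in> {0..1}" "\<gamma> s = \<psi> (x s)" using that by (auto simp: Q'_def)
        show ?thesis
          by (rule continuous_within_subset[OF has_vector_derivative_continuous[OF w(2)[OF s(1) Q\<gamma>[OF s]]]])
            (auto simp: Q'_def)
      qed
      then show "continuous_on Q' w" by (simp add: continuous_on_eq_continuous_within)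
      show "continuous_on Q' v"
        by (rule continuous_on_subset[OF continuous_on_vector_derivative[OF x(3)]]) (auto simp: Q'_def)
    qed
    from continuous_closed_preimage_constant[OF this Q', of 0] have "closed {s \<in> Q'. w s - v s = 0}" .
    also have "{s \<in> Q'. w s - v s = 0} = Q" unfolding Q_def Q'_def by auto
    finally show ?thesis .
  qed
  have "Q = {0..1}"
  proof -
    have "Q \<subseteq> {0..1}" by (auto simp: Q_def)
    then have "closedin (top_of_set {0..1}) Q" using \<open>closed Q\<close> by (rule closed_subset)
    then have "Q = {} \<or> Q = {0..1}"
      using connected_clopen[of "{0..1::real}"] connected_Icc[of "0::real" 1] \<open>openin _ Q\<close> by metis
    then show ?thesis using \<open>0 \<in> Q\<close> by blast
  qed
  with t have "t \<in> Q" by simp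
  then show ?thesis unfolding Q_def by blast
qed

text \<open>Existence by \<open>geodesic_in_all_charts\<close> and uniqueness by
  \<open>geodesic_unique\<close> give the definite description in \<open>exp_map\<close> its
  value.\<close>

lemma exp_map_eq:
  assumes x: "\<And>t. t \<in> {0..1} \<Longrightarrow> x t \<in> S"
      "\<And>t. t \<in> {0..1} \<Longrightarrow> (x has_vector_derivative v t) (at t within {0..1})"
      "\<And>t. t \<in> {0..1} \<Longrightarrow> (v has_vector_derivative - \<Gamma> (x t) (v t) (v t)) (at t within {0..1})"
    and x0: "x 0 = snd c P"
  shows "snd c (exp_map A g c P (v 0)) = x 1"
proof -
  have "exp_map A g c P (v 0) = \<psi> (x 1)"
    unfolding exp_map_def
  proof (rule the_equality)
    have d0: "(x has_vector_derivative v 0) (at 0 within {0..1})" by (rule x(2)) simp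
    have eq: "(snd c \<circ> (\<psi> \<circ> x)) t = x t" if "t \<in> {0..1}" for t
      using snd_\<psi>[OF x(1)[OF that]] by simp
    have "((snd c \<circ> (\<psi> \<circ> x)) has_vector_derivative v 0) (at 0 within {0..1})"
      by (rule has_vector_derivative_transform[OF _ eq d0]) simp
    then show "\<exists>\<gamma>. geodesic_on A g {0..1} \<gamma> \<and> \<gamma> 0 = P \<and>
        ((snd c \<circ> \<gamma>) has_vector_derivative v 0) (at 0 within {0..1}) \<and> \<gamma> 1 = \<psi> (x 1)"
      using geodesic_in_all_charts[OF x] x0 \<psi>_snd[OF P] by (intro exI[of _ "\<psi> \<circ> x"] conjI) simp_all
    fix q assume "\<exists>\<gamma>. geodesic_on A g {0..1} \<gamma> \<and> \<gamma> 0 = P \<and>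
        ((snd c \<circ> \<gamma>) has_vector_derivative v 0) (at 0 within {0..1}) \<and> \<gamma> 1 = q"
    then obtain \<gamma> where \<gamma>: "geodesic_on A g {0..1} \<gamma>" "\<gamma> 0 = P"
        "((snd c \<circ> \<gamma>) has_vector_derivative v 0) (at 0 within {0..1})" and q: "\<gamma> 1 = q" by blast
    have "\<gamma> 1 = \<psi> (x 1)" by (rule geodesic_unique[OF x x0 \<gamma>]) auto
    then show "q = \<psi> (x 1)" using q by simp
  qed
  then show ?thesis using snd_\<psi>[OF x(1)[of 1]] by simp
qed

text \<open>The curve \<open>\<lambda>s. x (t * s)\<close> has initial velocity
  \<open>t *\<^sub>R v 0\<close>, and it is again a geodesic because both sides of the equation
  scale by the square of \<open>t\<close>. Negative \<open>t\<close> is included, for the sake of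
  two-sided derivatives at 0.\<close>

lemma exp_map_along_ray:
  assumes x: "\<And>t. \<bar>t\<bar> < T \<Longrightarrow> x t \<in> S" "\<And>t. \<bar>t\<bar> < T \<Longrightarrow> (x has_vector_derivative v t) (at t)"
      "\<And>t. \<bar>t\<bar> < T \<Longrightarrow> (v has_vector_derivative - \<Gamma> (x t) (v t) (v t)) (at t)"
    and x0: "x 0 = snd c P" and t: "\<bar>t\<bar> < T"
  shows "snd c (exp_map A g c P (t *\<^sub>R v 0)) = x t"
proof -
  have small: "\<bar>t * s\<bar> < T" if "s \<in> {0..1}" for s
  proof -
    have "\<bar>t * s\<bar> \<le> \<bar>t\<bar> * 1" unfolding abs_mult using that by (intro mult_left_mono) auto
    then show ?thesis using t by simp
  qed
  have chain: "((\<lambda>s. f (t * s)) has_vector_derivative t *\<^sub>R f') (at s within {0..1})"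
    if "(f has_vector_derivative f') (at (t * s))" for f :: "real \<Rightarrow> real ^ 'm" and f' s
  proof -
    have "((\<lambda>s. t * s) has_vector_derivative t) (at s within {0..1})"
      by (auto intro!: derivative_eq_intros)
    from vector_diff_chain_within[OF this has_vector_derivative_at_within[OF that]]
    show ?thesis by (simp add: o_def)
  qed
  have "snd c (exp_map A g c P (t *\<^sub>R v (t * 0))) = x (t * 1)"
  proof (rule exp_map_eq[of "\<lambda>s. x (t * s)" "\<lambda>s. t *\<^sub>R v (t * s)"])
    fix s :: real assume "s \<in> {0..1}"
    then have s: "\<bar>t * s\<bar> < T" by (rule small)
    show "x (t * s) \<in> S" by (rule x(1)[OF s])
    show "((\<lambda>s. x (t * s)) has_vector_derivative t *\<^sub>R v (t * s)) (at s within {0..1})"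
      by (rule chain[OF x(2)[OF s]])
    have "((\<lambda>s. t *\<^sub>R v (t * s)) has_vector_derivative
        t *\<^sub>R (t *\<^sub>R (- \<Gamma> (x (t * s)) (v (t * s)) (v (t * s))))) (at s within {0..1})"
      by (rule bounded_linear.has_vector_derivative[OF bounded_linear_scaleR_right chain[OF x(3)[OF s]]])
    then show "((\<lambda>s. t *\<^sub>R v (t * s)) has_vector_derivative
        - \<Gamma> (x (t * s)) (t *\<^sub>R v (t * s)) (t *\<^sub>R v (t * s))) (at s within {0..1})"
      by (simp add: linear_scale[OF linear_christoffel_form_left] linear_scale[OF linear_christoffel_form_right])
  qed (simp add: x0)
  then show ?thesis by simp
qed

section \<open>The geodesic flow and the differential of the exponential map\<close>

lemma frechet_geodesic_field:
  assumes x: "x \<in> S"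
  shows "frechet_derivative geodesic_field (at (x, v)) (a, b) =
    (b, - (frechet_derivative (\<lambda>y. \<Gamma> y v v) (at x) a + \<Gamma> x b v + \<Gamma> x v b))"
proof -
  have D: "(geodesic_field has_derivative frechet_derivative geodesic_field (at (x, v))) (at (x, v))"
    using hd_on_Suc_has_derivative[OF hd_on_geodesic_field, of "(x, v)"] x by simp
  \<comment> \<open>Differentiability of the field is already known, so its derivative in the
    direction \<open>(a, b)\<close> can be read off along a single line.\<close>
  have la: "((\<lambda>s. x + s *\<^sub>R a) has_vector_derivative a) (at 0)"
    and lb: "((\<lambda>s. v + s *\<^sub>R b) has_vector_derivative b) (at 0)"
    by (auto intro!: derivative_eq_intros)
  have l: "((\<lambda>s. (x + s *\<^sub>R a, v + s *\<^sub>R b)) has_derivative (\<lambda>s. s *\<^sub>R (a, b))) (at 0)"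
    using has_vector_derivative_Pair_iff[THEN iffD2, OF conjI[OF la lb]] by (simp add: has_vector_derivative_def)
  have 1: "((\<lambda>s. geodesic_field (x + s *\<^sub>R a, v + s *\<^sub>R b)) has_vector_derivative
      frechet_derivative geodesic_field (at (x, v)) (a, b)) (at 0)"
    using diff_chain_at[OF l, of geodesic_field "frechet_derivative geodesic_field (at (x, v))"] D
      linear_scale[OF has_derivative_linear[OF D], of _ "(a, b)"]
    by (simp add: o_def has_vector_derivative_def)
  have "open ((\<lambda>s. x + s *\<^sub>R a) -` S)"
    by (rule open_vimage[OF open_S]) (auto intro!: continuous_intros)
  from christoffel_along_curve[OF this _ _ la lb lb] x
  have "((\<lambda>s. \<Gamma> (x + s *\<^sub>R a) (v + s *\<^sub>R b) (v + s *\<^sub>R b)) has_vector_derivative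
      frechet_derivative (\<lambda>y. \<Gamma> y v v) (at x) a + \<Gamma> x b v + \<Gamma> x v b) (at 0)" by simp
  from has_vector_derivative_Pair_iff[THEN iffD2, OF conjI[OF lb has_vector_derivative_minus[OF this]]]
  have "((\<lambda>s. geodesic_field (x + s *\<^sub>R a, v + s *\<^sub>R b)) has_vector_derivative
      (b, - (frechet_derivative (\<lambda>y. \<Gamma> y v v) (at x) a + \<Gamma> x b v + \<Gamma> x v b))) (at 0)"
    by (simp add: geodesic_field_def)
  from vector_derivative_unique_at[OF 1 this] show ?thesis .
qed

lemma geodesic_field_components:
  assumes "(y has_vector_derivative geodesic_field (y t)) (at t)"
  shows "((\<lambda>t. fst (y t)) has_vector_derivative snd (y t)) (at t)"
    "((\<lambda>t. snd (y t)) has_vector_derivative - \<Gamma> (fst (y t)) (snd (y t)) (snd (y t))) (at t)"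
  using bounded_linear.has_vector_derivative[OF bounded_linear_fst assms]
    bounded_linear.has_vector_derivative[OF bounded_linear_snd assms]
  by (simp_all add: geodesic_field_def)

lemma geodesic_flow:
  fixes \<xi> :: "real ^ 'm"
  obtains T r \<phi> D where "0 < T" "0 < r"
    "\<And>y. y \<in> ball (snd c P, \<xi>) r \<Longrightarrow> \<phi> 0 y = y"
    "\<And>y t. y \<in> ball (snd c P, \<xi>) r \<Longrightarrow> \<bar>t\<bar> < T \<Longrightarrow> fst (\<phi> t y) \<in> S"
    "\<And>y t. y \<in> ball (snd c P, \<xi>) r \<Longrightarrow> \<bar>t\<bar> < T \<Longrightarrow>
       ((\<lambda>t. \<phi> t y) has_vector_derivative geodesic_field (\<phi> t y)) (at t)"
    "\<And>y t. y \<in> ball (snd c P, \<xi>) r \<Longrightarrow> \<bar>t\<bar> < T \<Longrightarrow> (\<phi> t has_derivative D t y) (at y)"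
    "\<And>y h. y \<in> ball (snd c P, \<xi>) r \<Longrightarrow> D 0 y h = h"
    "\<And>y t h. y \<in> ball (snd c P, \<xi>) r \<Longrightarrow> \<bar>t\<bar> < T \<Longrightarrow>
       ((\<lambda>t. D t y h) has_vector_derivative frechet_derivative geodesic_field (at (\<phi> t y)) (D t y h)) (at t)"
    "\<And>\<zeta> t. (snd c P, \<zeta>) \<in> ball (snd c P, \<xi>) r \<Longrightarrow> \<bar>t\<bar> < T \<Longrightarrow>
       snd c (exp_map A g c P (t *\<^sub>R \<zeta>)) = fst (\<phi> t (snd c P, \<zeta>))"
proof -
  let ?y = "(snd c P, \<xi>)"
  have U: "?y \<in> S \<times> UNIV" using P by simp
  show ?thesis
  proof (rule local_flow[OF open_phase hd_on_geodesic_field[of 1] U])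
    fix T r :: real and \<phi> D
    assume T: "0 < T" and r: "0 < r"
      and \<phi>0: "\<And>y. y \<in> ball ?y r \<Longrightarrow> \<phi> 0 y = y"
      and \<phi>U: "\<And>y t. y \<in> ball ?y r \<Longrightarrow> \<bar>t\<bar> < T \<Longrightarrow> \<phi> t y \<in> S \<times> UNIV"
      and \<phi>': "\<And>y t. y \<in> ball ?y r \<Longrightarrow> \<bar>t\<bar> < T \<Longrightarrow>
         ((\<lambda>t. \<phi> t y) has_vector_derivative geodesic_field (\<phi> t y)) (at t)"
      and D: "\<And>y t. y \<in> ball ?y r \<Longrightarrow> \<bar>t\<bar> < T \<Longrightarrow> (\<phi> t has_derivative D t y) (at y)"
        "\<And>y h. y \<in> ball ?y r \<Longrightarrow> D 0 y h = h"
        "\<And>y t h. y \<in> ball ?y r \<Longrightarrow> \<bar>t\<bar> < T \<Longrightarrow>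
         ((\<lambda>t. D t y h) has_vector_derivative frechet_derivative geodesic_field (at (\<phi> t y)) (D t y h)) (at t)"
    have \<phi>S: "fst (\<phi> t y) \<in> S" if "y \<in> ball ?y r" "\<bar>t\<bar> < T" for y t
      using \<phi>U[OF that] by (simp add: mem_Times_iff)
    have "snd c (exp_map A g c P (t *\<^sub>R \<zeta>)) = fst (\<phi> t (snd c P, \<zeta>))"
      if \<zeta>: "(snd c P, \<zeta>) \<in> ball ?y r" and t: "\<bar>t\<bar> < T" for \<zeta> t
      using exp_map_along_ray[OF \<phi>S[OF \<zeta>] geodesic_field_components[OF \<phi>'[OF \<zeta>]] _ t] \<phi>0[OF \<zeta>] by simp
    from that[OF T r \<phi>0 \<phi>S \<phi>' D this] show ?thesis .
  qed
qed

text \<open>\<open>Z h\<close> is the variation of the geodesic \<open>x\<close> in the direction \<open>h\<close> of its initial velocity.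
  Differentiating \<open>exp(t(\<xi> + s h))\<close> at \<open>s = 0\<close> expresses the differential of the exponential map through it.\<close>

theorem exp_map_ray:
  fixes \<xi> :: "real ^ 'm"
  obtains T x v Z W where "0 < T" "x 0 = snd c P" "v 0 = \<xi>"
    "\<And>t. \<bar>t\<bar> < T \<Longrightarrow> x t \<in> S"
    "\<And>t. \<bar>t\<bar> < T \<Longrightarrow> (x has_vector_derivative v t) (at t)"
    "\<And>t. \<bar>t\<bar> < T \<Longrightarrow> (v has_vector_derivative - \<Gamma> (x t) (v t) (v t)) (at t)"
    "\<And>h. Z h 0 = 0" "\<And>h. W h 0 = h"
    "\<And>t h. \<bar>t\<bar> < T \<Longrightarrow> (Z h has_vector_derivative W h t) (at t)"
    "\<And>t h. \<bar>t\<bar> < T \<Longrightarrow> (W h has_vector_derivative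
       - (frechet_derivative (\<lambda>y. \<Gamma> y (v t) (v t)) (at (x t)) (Z h t) + \<Gamma> (x t) (W h t) (v t) + \<Gamma> (x t) (v t) (W h t))) (at t)"
    "\<And>t. \<bar>t\<bar> < T \<Longrightarrow> snd c (exp_map A g c P (t *\<^sub>R \<xi>)) = x t"
    "\<And>t. \<bar>t\<bar> < T \<Longrightarrow> t \<noteq> 0 \<Longrightarrow>
       ((\<lambda>\<eta>. snd c (exp_map A g c P \<eta>)) has_derivative (\<lambda>h. (1/t) *\<^sub>R Z h t)) (at (t *\<^sub>R \<xi>))"
proof -
  let ?x0 = "snd c P"
  let ?y = "(?x0, \<xi>)"
  obtain T r \<phi> D where T: "0 < T" and r: "0 < r"
    and \<phi>0: "\<And>y. y \<in> ball ?y r \<Longrightarrow> \<phi> 0 y = y"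
    and \<phi>S: "\<And>y t. y \<in> ball ?y r \<Longrightarrow> \<bar>t\<bar> < T \<Longrightarrow> fst (\<phi> t y) \<in> S"
    and \<phi>': "\<And>y t. y \<in> ball ?y r \<Longrightarrow> \<bar>t\<bar> < T \<Longrightarrow>
       ((\<lambda>t. \<phi> t y) has_vector_derivative geodesic_field (\<phi> t y)) (at t)"
    and \<phi>D: "\<And>y t. y \<in> ball ?y r \<Longrightarrow> \<bar>t\<bar> < T \<Longrightarrow> (\<phi> t has_derivative D t y) (at y)"
    and D0: "\<And>y h. y \<in> ball ?y r \<Longrightarrow> D 0 y h = h"
    and D': "\<And>y t h. y \<in> ball ?y r \<Longrightarrow> \<bar>t\<bar> < T \<Longrightarrow>
       ((\<lambda>t. D t y h) has_vector_derivative frechet_derivative geodesic_field (at (\<phi> t y)) (D t y h)) (at t)"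
    and exp: "\<And>\<zeta> t. (?x0, \<zeta>) \<in> ball ?y r \<Longrightarrow> \<bar>t\<bar> < T \<Longrightarrow>
       snd c (exp_map A g c P (t *\<^sub>R \<zeta>)) = fst (\<phi> t (?x0, \<zeta>))"
    by (rule geodesic_flow[of \<xi>]) (rule that; assumption)
  have y: "?y \<in> ball ?y r" using r by simp
  show ?thesis
  proof (rule that[of T "\<lambda>t. fst (\<phi> t ?y)" "\<lambda>t. snd (\<phi> t ?y)" "\<lambda>h t. fst (D t ?y (0, h))" "\<lambda>h t. snd (D t ?y (0, h))"])
    fix t :: real assume t: "\<bar>t\<bar> < T"
    show xS: "fst (\<phi> t ?y) \<in> S" by (rule \<phi>S[OF y t])
    show "((\<lambda>t. fst (\<phi> t ?y)) has_vector_derivative snd (\<phi> t ?y)) (at t)"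
      "((\<lambda>t. snd (\<phi> t ?y)) has_vector_derivative - \<Gamma> (fst (\<phi> t ?y)) (snd (\<phi> t ?y)) (snd (\<phi> t ?y))) (at t)"
      by (rule geodesic_field_components[OF \<phi>'[OF y t]])+
    show "snd c (exp_map A g c P (t *\<^sub>R \<xi>)) = fst (\<phi> t ?y)" by (rule exp[OF y t])
    fix h
    have fD: "frechet_derivative geodesic_field (at (\<phi> t ?y)) (D t ?y (0, h)) =
      (snd (D t ?y (0, h)), - (frechet_derivative (\<lambda>z. \<Gamma> z (snd (\<phi> t ?y)) (snd (\<phi> t ?y))) (at (fst (\<phi> t ?y))) (fst (D t ?y (0, h)))
        + \<Gamma> (fst (\<phi> t ?y)) (snd (D t ?y (0, h))) (snd (\<phi> t ?y)) + \<Gamma> (fst (\<phi> t ?y)) (snd (\<phi> t ?y)) (snd (D t ?y (0, h)))))"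
      using frechet_geodesic_field[OF xS, of "snd (\<phi> t ?y)" "fst (D t ?y (0, h))" "snd (D t ?y (0, h))"] by simp
    show "((\<lambda>t. fst (D t ?y (0, h))) has_vector_derivative snd (D t ?y (0, h))) (at t)"
      using bounded_linear.has_vector_derivative[OF bounded_linear_fst D'[OF y t, of "(0, h)"]] by (simp add: fD)
    show "((\<lambda>t. snd (D t ?y (0, h))) has_vector_derivative
      - (frechet_derivative (\<lambda>z. \<Gamma> z (snd (\<phi> t ?y)) (snd (\<phi> t ?y))) (at (fst (\<phi> t ?y))) (fst (D t ?y (0, h)))
        + \<Gamma> (fst (\<phi> t ?y)) (snd (D t ?y (0, h))) (snd (\<phi> t ?y)) + \<Gamma> (fst (\<phi> t ?y)) (snd (\<phi> t ?y)) (snd (D t ?y (0, h))))) (at t)"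
      using bounded_linear.has_vector_derivative[OF bounded_linear_snd D'[OF y t, of "(0, h)"]] by (simp add: fD)
  next
    fix t :: real assume t: "\<bar>t\<bar> < T" "t \<noteq> 0"
    have lD: "linear (D t ?y)" using has_derivative_linear[OF \<phi>D[OF y t(1)]] .
    \<comment> \<open>At a fixed time \<open>t\<close> the exponential of \<eta> is the position
      reached by the flow from velocity \<eta>/t, for all \<eta> near
      \<open>t *\<^sub>R \<xi>\<close>. Differentiability in the initial velocity thus becomes
      differentiability in \<eta>, with the factor \<open>1/t\<close>.\<close>
    have s: "((\<lambda>\<eta>. (?x0, (1/t) *\<^sub>R \<eta>)) has_derivative (\<lambda>h. (0, (1/t) *\<^sub>R h))) (at (t *\<^sub>R \<xi>))"
      by (auto intro!: derivative_eq_intros)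
    have e: "(?x0, (1/t) *\<^sub>R (t *\<^sub>R \<xi>)) = ?y" using t by simp
    have "((\<lambda>\<eta>. fst (\<phi> t (?x0, (1/t) *\<^sub>R \<eta>))) has_derivative (\<lambda>h. fst (D t ?y (0, (1/t) *\<^sub>R h)))) (at (t *\<^sub>R \<xi>))"
      using bounded_linear.has_derivative[OF bounded_linear_fst diff_chain_at[OF s, of "\<phi> t" "D t ?y"]] \<phi>D[OF y t(1)] t(2)
      by (simp add: o_def)
    moreover have "D t ?y (0, (1/t) *\<^sub>R h) = (1/t) *\<^sub>R D t ?y (0, h)" for h
      using linear_scale[OF lD, of "1/t" "(0, h)"] by simp
    ultimately have d: "((\<lambda>\<eta>. fst (\<phi> t (?x0, (1/t) *\<^sub>R \<eta>))) has_derivative (\<lambda>h. (1/t) *\<^sub>R fst (D t ?y (0, h)))) (at (t *\<^sub>R \<xi>))"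
      by simp
    have "open ((\<lambda>\<eta>. (?x0, (1/t) *\<^sub>R \<eta>)) -` ball ?y r)"
      by (rule open_vimage) (auto intro!: continuous_intros)
    then show "((\<lambda>\<eta>. snd c (exp_map A g c P \<eta>)) has_derivative (\<lambda>h. (1/t) *\<^sub>R fst (D t ?y (0, h)))) (at (t *\<^sub>R \<xi>))"
    proof (rule has_derivative_transform_within_open[OF d])
      show "t *\<^sub>R \<xi> \<in> (\<lambda>\<eta>. (?x0, (1/t) *\<^sub>R \<eta>)) -` ball ?y r" using e r by simp
      fix \<eta> assume "\<eta> \<in> (\<lambda>\<eta>. (?x0, (1/t) *\<^sub>R \<eta>)) -` ball ?y r"
      then have "(?x0, (1/t) *\<^sub>R \<eta>) \<in> ball ?y r" by simp
      from exp[OF this t(1)] show "fst (\<phi> t (?x0, (1/t) *\<^sub>R \<eta>)) = snd c (exp_map A g c P \<eta>)" using t by simp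
    qed
  qed (use T \<phi>0[OF y] D0[OF y] in auto)
qed

text \<open>The formula of \<open>exp_map_ray\<close> divides by \<open>t\<close> and does not reach
  the origin. Near velocity 0 the flow runs for a common positive time, which gives
  differentiability at the origin; the derivative is then identified along rays. It gives the
  density its value 1 at 0.\<close>

lemma exp_map_derivative_at_0: "((\<lambda>\<eta>. snd c (exp_map A g c P \<eta>)) has_derivative (\<lambda>h. h)) (at 0)"
proof -
  let ?x0 = "snd c P" and ?e = "\<lambda>\<eta>. snd c (exp_map A g c P \<eta>)"
  let ?y = "(?x0, 0 :: real ^ 'm)"
  obtain T r \<phi> D where T: "0 < T" and r: "0 < r"
    and \<phi>0: "\<And>y. y \<in> ball ?y r \<Longrightarrow> \<phi> 0 y = y"
    and \<phi>': "\<And>y t. y \<in> ball ?y r \<Longrightarrow> \<bar>t\<bar> < T \<Longrightarrow>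
       ((\<lambda>t. \<phi> t y) has_vector_derivative geodesic_field (\<phi> t y)) (at t)"
    and \<phi>D: "\<And>y t. y \<in> ball ?y r \<Longrightarrow> \<bar>t\<bar> < T \<Longrightarrow> (\<phi> t has_derivative D t y) (at y)"
    and exp: "\<And>\<zeta> t. (?x0, \<zeta>) \<in> ball ?y r \<Longrightarrow> \<bar>t\<bar> < T \<Longrightarrow> ?e (t *\<^sub>R \<zeta>) = fst (\<phi> t (?x0, \<zeta>))"
    by (rule geodesic_flow[of 0]) (rule that; assumption)
  define t where "t = T/2"
  have t: "\<bar>t\<bar> < T" "t \<noteq> 0" using T by (auto simp: t_def)
  have y: "?y \<in> ball ?y r" using r by simp
  have s: "((\<lambda>\<eta>. (?x0, (1/t) *\<^sub>R \<eta>)) has_derivative (\<lambda>h. (0, (1/t) *\<^sub>R h))) (at 0)"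
    by (auto intro!: derivative_eq_intros)
  have d: "((\<lambda>\<eta>. fst (\<phi> t (?x0, (1/t) *\<^sub>R \<eta>))) has_derivative (\<lambda>h. fst (D t ?y (0, (1/t) *\<^sub>R h)))) (at 0)"
    using bounded_linear.has_derivative[OF bounded_linear_fst diff_chain_at[OF s, of "\<phi> t" "D t ?y"]] \<phi>D[OF y t(1)]
    by (simp add: o_def)
  have o: "open ((\<lambda>\<eta>. (?x0, (1/t) *\<^sub>R \<eta>)) -` ball ?y r)"
    by (rule open_vimage) (auto intro!: continuous_intros)
  have de: "(?e has_derivative (\<lambda>h. fst (D t ?y (0, (1/t) *\<^sub>R h)))) (at 0)"
  proof (rule has_derivative_transform_within_open[OF d o])
    show "0 \<in> (\<lambda>\<eta>. (?x0, (1/t) *\<^sub>R \<eta>)) -` ball ?y r" using r by simp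
    fix \<eta> assume "\<eta> \<in> (\<lambda>\<eta>. (?x0, (1/t) *\<^sub>R \<eta>)) -` ball ?y r"
    then have "(?x0, (1/t) *\<^sub>R \<eta>) \<in> ball ?y r" by simp
    from exp[OF this t(1)] show "fst (\<phi> t (?x0, (1/t) *\<^sub>R \<eta>)) = ?e \<eta>" using t by simp
  qed
  have "fst (D t ?y (0, (1/t) *\<^sub>R h)) = h" for h
  proof -
    \<comment> \<open>Scaling by \<kappa> brings \<open>h\<close> into the ball of velocities on
      which the flow is controlled; the summand 1 covers \<open>h = 0\<close>.\<close>
    define \<kappa> where "\<kappa> = r / (2 * (norm h + 1))"
    have N: "norm h + 1 > 0" by (simp add: add_nonneg_pos)
    have \<kappa>: "\<kappa> > 0" using r N by (simp add: \<kappa>_def)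
    have "\<kappa> * norm h \<le> \<kappa> * (norm h + 1)" using \<kappa> by simp
    also have "\<dots> = r / 2" using N by (simp add: \<kappa>_def field_simps)
    finally have "\<kappa> * norm h < r" using r by simp
    then have \<zeta>: "(?x0, \<kappa> *\<^sub>R h) \<in> ball ?y r" using \<kappa> by (simp add: dist_norm norm_Pair)
    have l: "((\<lambda>s. s *\<^sub>R (\<kappa> *\<^sub>R h)) has_derivative (\<lambda>s. s *\<^sub>R (\<kappa> *\<^sub>R h))) (at 0)"
      by (auto intro!: derivative_eq_intros)
    have 1: "((\<lambda>s. ?e (s *\<^sub>R (\<kappa> *\<^sub>R h))) has_vector_derivative fst (D t ?y (0, (1/t) *\<^sub>R (\<kappa> *\<^sub>R h)))) (at 0)"
      using diff_chain_at[OF l, of ?e "\<lambda>h. fst (D t ?y (0, (1/t) *\<^sub>R h))"] de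
        linear_scale[OF has_derivative_linear[OF de], of _ "\<kappa> *\<^sub>R h"]
      by (simp add: o_def has_vector_derivative_def)
    have "((\<lambda>s. fst (\<phi> s (?x0, \<kappa> *\<^sub>R h))) has_vector_derivative \<kappa> *\<^sub>R h) (at 0)"
      using geodesic_field_components(1)[OF \<phi>'[OF \<zeta>, of 0]] T \<phi>0[OF \<zeta>] by simp
    then have 2: "((\<lambda>s. ?e (s *\<^sub>R (\<kappa> *\<^sub>R h))) has_vector_derivative \<kappa> *\<^sub>R h) (at 0)"
      by (rule has_vector_derivative_transform_within_open[of _ _ _ "{-T<..<T}"]) (use T exp[OF \<zeta>] in \<open>auto simp: abs_less_iff\<close>)
    have "fst (D t ?y (0, (1/t) *\<^sub>R (\<kappa> *\<^sub>R h))) = \<kappa> *\<^sub>R h" by (rule vector_derivative_unique_at[OF 1 2])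
    then have "\<kappa> *\<^sub>R fst (D t ?y (0, (1/t) *\<^sub>R h)) = \<kappa> *\<^sub>R h"
      using linear_scale[OF has_derivative_linear[OF de], of \<kappa> h] by argo
    then show ?thesis using \<kappa> by simp
  qed
  with de show ?thesis by simp
qed

end

section \<open>Taylor coefficients of curves\<close>

definition vderiv :: "(real \<Rightarrow> 'a::real_normed_vector) \<Rightarrow> real \<Rightarrow> 'a" where
  "vderiv f t = vector_derivative f (at t)"

definition taylor_coeff :: "(real \<Rightarrow> 'a::real_normed_vector) \<Rightarrow> nat \<Rightarrow> 'a" where
  "taylor_coeff f k = (1 / fact k) *\<^sub>R (vderiv ^^ k) f 0"

lemma smooth_has_vderiv: "smooth_on I f \<Longrightarrow> t \<in> I \<Longrightarrow> (f has_vector_derivative vderiv f t) (at t)"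
  unfolding vderiv_def by (rule hd_on_imp_vector_derivative[OF smooth_on_imp_hd_on])

lemma smooth_vderiv:
  assumes "open I" "smooth_on I f"
  shows "smooth_on I (vderiv f)"
  unfolding smooth_on_def
  using hd_on_Suc_vectorD[OF assms(1) smooth_on_imp_hd_on[OF assms(2)] smooth_has_vderiv[OF assms(2)]] by blast

lemma vderiv_eqI: "(f has_vector_derivative f') (at t) \<Longrightarrow> vderiv f t = f'"
  unfolding vderiv_def by (rule vector_derivative_at)

lemma vderiv_cong:
  assumes "open I" "\<And>t. t \<in> I \<Longrightarrow> f t = g t" "t \<in> I" "smooth_on I f"
  shows "vderiv f t = vderiv g t"
  using has_vector_derivative_transform_within_open[OF smooth_has_vderiv[OF assms(4,3)] assms(1,3,2)]
  by (simp add: vderiv_eqI)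

text \<open>Derivatives depend on germs only. Both functions are generalized in the induction, since
  their derivatives again agree only on the open set.\<close>

lemma vderiv_iterate_cong:
  assumes "open I" "\<And>t. t \<in> I \<Longrightarrow> f t = g t" "t \<in> I" "smooth_on I f"
  shows "(vderiv ^^ k) f t = (vderiv ^^ k) g t"
  using assms(2-4)
proof (induction k arbitrary: f g t)
  case (Suc k)
  have "(vderiv ^^ k) (vderiv f) t = (vderiv ^^ k) (vderiv g) t"
    using Suc.prems by (intro Suc.IH vderiv_cong[OF assms(1)] smooth_vderiv[OF assms(1)])
  then show ?case by (simp add: funpow_swap1)
qed simp

lemma taylor_coeff_cong:
  assumes "open I" "0 \<in> I" "\<And>t. t \<in> I \<Longrightarrow> f t = g t" "smooth_on I f"
  shows "taylor_coeff f k = taylor_coeff g k"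
  unfolding taylor_coeff_def using vderiv_iterate_cong[OF assms(1,3,2,4)] by simp

lemma taylor_coeff_0: "taylor_coeff f 0 = f 0"
  by (simp add: taylor_coeff_def)

lemma taylor_coeff_vderiv: "taylor_coeff (vderiv f) k = real (Suc k) *\<^sub>R taylor_coeff f (Suc k)"
  by (simp add: taylor_coeff_def funpow_swap1)

lemma taylor_coeff_Suc: "taylor_coeff f (Suc k) = (1 / real (Suc k)) *\<^sub>R taylor_coeff (vderiv f) k"
  by (simp add: taylor_coeff_vderiv)

lemma smooth_on_add: "open I \<Longrightarrow> smooth_on I f \<Longrightarrow> smooth_on I g \<Longrightarrow> smooth_on I (\<lambda>t. f t + g t)"
  unfolding smooth_on_def by (auto intro: hd_on_add)

lemma smooth_on_bounded_linear: "open I \<Longrightarrow> bounded_linear L \<Longrightarrow> smooth_on I f \<Longrightarrow> smooth_on I (\<lambda>t. L (f t))"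
  unfolding smooth_on_def by (auto intro: hd_on_bounded_linear)

lemma smooth_on_bilinear:
  "open I \<Longrightarrow> bounded_bilinear b \<Longrightarrow> smooth_on I f \<Longrightarrow> smooth_on I g \<Longrightarrow> smooth_on I (\<lambda>t. b (f t) (g t))"
  unfolding smooth_on_def by (auto intro: hd_on_bilinear)

lemma smooth_on_ident: "open I \<Longrightarrow> smooth_on I (\<lambda>t. t)"
  unfolding smooth_on_def by (auto intro: hd_on_ident)

lemma taylor_coeff_add:
  assumes "open I" "0 \<in> I" "smooth_on I f" "smooth_on I g"
  shows "taylor_coeff (\<lambda>t. f t + g t) k = taylor_coeff f k + taylor_coeff g k"
  using assms(3,4)
proof (induction k arbitrary: f g)
  case (Suc k)
  have "vderiv (\<lambda>t. f t + g t) t = vderiv f t + vderiv g t" if "t \<in> I" for t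
    by (intro vderiv_eqI has_vector_derivative_add smooth_has_vderiv[OF _ that] Suc.prems)
  then have "taylor_coeff (vderiv (\<lambda>t. f t + g t)) k = taylor_coeff (\<lambda>t. vderiv f t + vderiv g t) k"
    by (intro taylor_coeff_cong[OF assms(1,2)] smooth_vderiv assms(1) smooth_on_add Suc.prems)
  then show ?case
    using Suc.IH[OF smooth_vderiv[OF assms(1) Suc.prems(1)] smooth_vderiv[OF assms(1) Suc.prems(2)]]
    by (simp add: taylor_coeff_Suc scaleR_add_right)
qed (simp add: taylor_coeff_0)

lemma taylor_coeff_bounded_linear:
  assumes "open I" "0 \<in> I" "bounded_linear L" "smooth_on I f"
  shows "taylor_coeff (\<lambda>t. L (f t)) k = L (taylor_coeff f k)"
  using assms(4)
proof (induction k arbitrary: f)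
  case (Suc k)
  have "vderiv (\<lambda>t. L (f t)) t = L (vderiv f t)" if "t \<in> I" for t
    by (intro vderiv_eqI bounded_linear.has_vector_derivative[OF assms(3)] smooth_has_vderiv[OF _ that] Suc.prems)
  then have "taylor_coeff (vderiv (\<lambda>t. L (f t))) k = taylor_coeff (\<lambda>t. L (vderiv f t)) k"
    by (intro taylor_coeff_cong[OF assms(1,2)] smooth_vderiv assms(1) smooth_on_bounded_linear[OF _ assms(3)] Suc.prems)
  then show ?case
    using Suc.IH[OF smooth_vderiv[OF assms(1) Suc.prems(1)]]
    by (simp add: taylor_coeff_Suc linear_scale[OF bounded_linear.linear[OF assms(3)]])
qed (simp add: taylor_coeff_0)

text \<open>The Cauchy product, in a form that serves matrix and real multiplication alike. The two
  halves of the Leibniz rule give the term of index \<open>i\<close> the weights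
  \<open>k + 1 - i\<close> and \<open>i\<close>; their sum \<open>k + 1\<close> cancels against the
  factor from differentiation.\<close>

lemma taylor_coeff_bilinear:
  assumes I: "open I" "0 \<in> I" and b: "bounded_bilinear b" and "smooth_on I f" "smooth_on I g"
  shows "taylor_coeff (\<lambda>t. b (f t) (g t)) k = (\<Sum>i\<le>k. b (taylor_coeff f i) (taylor_coeff g (k - i)))"
  using assms(4,5)
proof (induction k arbitrary: f g)
  case (Suc k)
  note sf = smooth_vderiv[OF I(1) Suc.prems(1)] and sg = smooth_vderiv[OF I(1) Suc.prems(2)]
  interpret bounded_bilinear b by fact
  let ?f = "taylor_coeff f" and ?g = "taylor_coeff g"
  have "vderiv (\<lambda>t. b (f t) (g t)) t = b (f t) (vderiv g t) + b (vderiv f t) (g t)" if "t \<in> I" for t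
    by (intro vderiv_eqI has_vector_derivative smooth_has_vderiv[OF _ that] Suc.prems)
  then have "taylor_coeff (vderiv (\<lambda>t. b (f t) (g t))) k =
      taylor_coeff (\<lambda>t. b (f t) (vderiv g t) + b (vderiv f t) (g t)) k"
    by (intro taylor_coeff_cong[OF I] smooth_vderiv I(1) smooth_on_bilinear[OF _ b] Suc.prems)
  also have "\<dots> = taylor_coeff (\<lambda>t. b (f t) (vderiv g t)) k + taylor_coeff (\<lambda>t. b (vderiv f t) (g t)) k"
    by (intro taylor_coeff_add[OF I] smooth_on_bilinear[OF I(1) b] sf sg Suc.prems)
  also have "\<dots> = (\<Sum>i\<le>k. b (?f i) (real (Suc (k - i)) *\<^sub>R ?g (Suc (k - i))))
      + (\<Sum>i\<le>k. b (real (Suc i) *\<^sub>R ?f (Suc i)) (?g (k - i)))"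
    using Suc.IH[OF Suc.prems(1) sg] Suc.IH[OF sf Suc.prems(2)] by (simp only: taylor_coeff_vderiv)
  also have "\<dots> = (\<Sum>i\<le>k. (real (Suc k) - real i) *\<^sub>R b (?f i) (?g (Suc k - i)))
      + (\<Sum>i\<le>k. real (Suc i) *\<^sub>R b (?f (Suc i)) (?g (Suc k - Suc i)))"
    by (intro arg_cong2[of _ _ _ _ "(+)"] sum.cong refl) (simp_all add: scaleR_left scaleR_right of_nat_diff Suc_diff_le)
  \<comment> \<open>Both sums are extended to the range up to \<open>Suc k\<close>: the added terms,
    at \<open>i = Suc k\<close> here and at \<open>i = 0\<close> in the next sum, have weight
    0.\<close>
  also have "(\<Sum>i\<le>k. (real (Suc k) - real i) *\<^sub>R b (?f i) (?g (Suc k - i))) =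
      (\<Sum>i\<le>Suc k. (real (Suc k) - real i) *\<^sub>R b (?f i) (?g (Suc k - i)))" by simp
  also have "(\<Sum>i\<le>k. real (Suc i) *\<^sub>R b (?f (Suc i)) (?g (Suc k - Suc i))) =
      (\<Sum>i\<le>Suc k. real i *\<^sub>R b (?f i) (?g (Suc k - i)))"
    by (subst sum.atMost_Suc_shift[of "\<lambda>i. real i *\<^sub>R b (?f i) (?g (Suc k - i))"]) simp
  also have "(\<Sum>i\<le>Suc k. (real (Suc k) - real i) *\<^sub>R b (?f i) (?g (Suc k - i)))
      + (\<Sum>i\<le>Suc k. real i *\<^sub>R b (?f i) (?g (Suc k - i))) =
      real (Suc k) *\<^sub>R (\<Sum>i\<le>Suc k. b (?f i) (?g (Suc k - i)))"
    by (simp only: sum.distrib[symmetric] scaleR_sum_right scaleR_add_left[symmetric] diff_add_cancel)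
  finally show ?case by (simp add: taylor_coeff_Suc[of "\<lambda>t. b (f t) (g t)"])
qed (simp add: taylor_coeff_0)

text \<open>This index shift turns an equation that is singular at 0 into a recursion for
  coefficients.\<close>

lemma taylor_coeff_times_t:
  assumes I: "open I" "0 \<in> I" and f: "smooth_on I f"
  shows "taylor_coeff (\<lambda>t. t *\<^sub>R f t) (Suc k) = taylor_coeff f k"
  using f
proof (induction k arbitrary: f)
  case 0
  have "((\<lambda>t. t *\<^sub>R f t) has_vector_derivative 0 *\<^sub>R vderiv f 0 + 1 *\<^sub>R f 0) (at 0)"
    by (intro bounded_bilinear.has_vector_derivative[OF bounded_bilinear_scaleR] smooth_has_vderiv[OF 0 I(2)]
        has_vector_derivative_id)
  then show ?case by (simp add: taylor_coeff_Suc taylor_coeff_0 vderiv_eqI)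
next
  case (Suc k)
  note sf = smooth_vderiv[OF I(1) Suc.prems]
  have st: "smooth_on I (\<lambda>t. t *\<^sub>R h t)" if "smooth_on I h" for h :: "real \<Rightarrow> 'a"
    by (rule smooth_on_bilinear[OF I(1) bounded_bilinear_scaleR smooth_on_ident[OF I(1)] that])
  have "vderiv (\<lambda>t. t *\<^sub>R f t) t = t *\<^sub>R vderiv f t + f t" if "t \<in> I" for t
    using vderiv_eqI[OF bounded_bilinear.has_vector_derivative[OF bounded_bilinear_scaleR has_vector_derivative_id
          smooth_has_vderiv[OF Suc.prems that]]] by simp
  then have "taylor_coeff (vderiv (\<lambda>t. t *\<^sub>R f t)) (Suc k) = taylor_coeff (\<lambda>t. t *\<^sub>R vderiv f t + f t) (Suc k)"
    by (intro taylor_coeff_cong[OF I] smooth_vderiv I(1) st Suc.prems)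
  also have "\<dots> = taylor_coeff (vderiv f) k + taylor_coeff f (Suc k)"
    by (subst taylor_coeff_add[OF I st[OF sf] Suc.prems]) (simp only: Suc.IH[OF sf])
  also have "\<dots> = (real (Suc k) + 1) *\<^sub>R taylor_coeff f (Suc k)"
    by (simp only: taylor_coeff_vderiv scaleR_add_left scaleR_one)
  finally show ?case by (simp add: taylor_coeff_Suc[of "\<lambda>t. t *\<^sub>R f t"] add.commute)
qed

text \<open>Link from \<open>taylor_term\<close>, which iterates \<open>deriv\<close>, to the
  calculus of curves. Agreement is known on the open set \<open>I\<close> only, so the induction
  carries it on all of \<open>I\<close> rather than at 0.\<close>

lemma deriv_iterate_eq_taylor_coeff:
  fixes F D :: "real \<Rightarrow> real"
  assumes I: "open I" "0 \<in> I" and D: "smooth_on I D" and eq: "\<And>t. t \<in> I \<Longrightarrow> F t = D t"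
  shows "(deriv ^^ k) F 0 / fact k = taylor_coeff D k"
proof -
  have "\<forall>t\<in>I. (deriv ^^ k) F t = (vderiv ^^ k) D t \<and> smooth_on I ((vderiv ^^ k) D)"
  proof (induction k)
    case (Suc k)
    let ?h = "(vderiv ^^ k) D"
    have s: "smooth_on I ?h" using Suc I by blast
    have "deriv ((deriv ^^ k) F) t = vderiv ?h t" if t: "t \<in> I" for t
    proof -
      have "((deriv ^^ k) F has_vector_derivative vderiv ?h t) (at t)"
        by (rule has_vector_derivative_transform_within_open[OF smooth_has_vderiv[OF s t] I(1) t]) (use Suc in auto)
      then show ?thesis
        by (intro DERIV_imp_deriv) (simp add: has_real_derivative_iff_has_vector_derivative)
    qed
    then show ?case using smooth_vderiv[OF I(1) s] by simp
  qed (use eq D in auto)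
  then show ?thesis using I(2) by (simp add: taylor_coeff_def)
qed

text \<open>For functions whose successive derivatives are given in advance, as those of the
  curvature in a parallel frame are by the covariant derivatives.\<close>

lemma smooth_on_tower:
  assumes "open I" "\<And>k t. t \<in> I \<Longrightarrow> (R k has_vector_derivative R (Suc k) t) (at t)"
  shows "smooth_on I (R k)"
proof -
  have "hd_on I (R k) n" for n
  proof (induction n arbitrary: k)
    case 0
    have "continuous (at t within I) (R k)" if "t \<in> I" for t
      using has_vector_derivative_continuous[OF assms(2)[OF that]] by (rule continuous_at_imp_continuous_at_within)
    then show ?case by (simp add: continuous_on_eq_continuous_within)
  next
    case (Suc n)
    show ?case by (rule hd_on_Suc_vectorI[OF assms(1) assms(2) Suc])
  qed
  then show ?thesis by (simp add: smooth_on_def)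
qed

lemma taylor_coeff_tower:
  assumes "open I" "0 \<in> I" "\<And>k t. t \<in> I \<Longrightarrow> (R k has_vector_derivative R (Suc k) t) (at t)"
  shows "taylor_coeff (R 0) k = (1 / fact k) *\<^sub>R R k 0"
proof -
  have "(vderiv ^^ k) (R j) t = R (j + k) t" if "t \<in> I" for t j
    using that
  proof (induction k arbitrary: j t)
    case (Suc k)
    have "(vderiv ^^ k) (vderiv (R j)) t = (vderiv ^^ k) (R (Suc j)) t"
      by (rule vderiv_iterate_cong[OF assms(1) vderiv_eqI[OF assms(3)] Suc.prems
            smooth_vderiv[OF assms(1) smooth_on_tower[where R=R, OF assms(1,3)]]])
    then show ?case using Suc.IH[OF Suc.prems, of "Suc j"] by (simp add: funpow_swap1)
  qed simp
  then show ?thesis using assms(2) by (simp add: taylor_coeff_def)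
qed

text \<open>Hadamard's lemma: \<open>A(t) = t B(t)\<close> with \<open>B(t) = \<integral> A'(t s) ds\<close> over \<open>0 \<le> s \<le> 1\<close>.\<close>

lemma hd_on_hadamard_integral:
  fixes f :: "real \<Rightarrow> 'a::banach"
  assumes "hd_on {-\<tau><..<\<tau>} f n"
  shows "hd_on {-\<tau><..<\<tau>} (\<lambda>t. integral {0..1} (\<lambda>s. s ^ k *\<^sub>R f (t * s))) n"
proof -
  let ?I = "{-\<tau><..<\<tau>}"
  have mem: "t * s \<in> ?I" if "t \<in> ?I" "s \<in> {0..1}" for t s :: real
  proof -
    have "\<bar>t * s\<bar> \<le> \<bar>t\<bar> * 1" unfolding abs_mult using that by (intro mult_left_mono) auto
    then show ?thesis using that by (auto simp: abs_le_iff)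
  qed
  have cont: "continuous_on (?I \<times> {0..1}) (\<lambda>(t, s). s ^ k *\<^sub>R f (t * s))"
    if "continuous_on ?I f" for f :: "real \<Rightarrow> 'a" and k
    unfolding split_beta
    by (intro continuous_intros continuous_on_compose2[OF that]) (use mem in auto)
  show ?thesis
    using assms
  proof (induction n arbitrary: f k)
    case 0
    then show ?case
      using integral_continuous_on_param[of ?I 0 "1::real" "\<lambda>t s. s ^ k *\<^sub>R f (t * s)"] cont by simp
  next
    case (Suc n)
    have f': "(f has_vector_derivative vderiv f t) (at t)" if "t \<in> ?I" for t
      unfolding vderiv_def using hd_on_imp_vector_derivative[OF Suc.prems that] .
    have hf': "hd_on ?I (vderiv f) n" using hd_on_Suc_vectorD[OF _ Suc.prems f'] by simp
    \<comment> \<open>Each differentiation in \<open>t\<close> brings out a factor \<open>s\<close>;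
      hence the power \<open>k\<close> in the claim and its generalization in the induction.\<close>
    have D: "((\<lambda>t. integral (cbox 0 1) (\<lambda>s. s ^ k *\<^sub>R f (t * s))) has_vector_derivative
        integral (cbox 0 1) (\<lambda>s. s ^ Suc k *\<^sub>R vderiv f (t * s))) (at t within ?I)" if t: "t \<in> ?I" for t
    proof (rule leibniz_rule_vector_derivative[OF _ _ _ t])
      fix x s :: real assume x: "x \<in> ?I" and s: "s \<in> cbox 0 1"
      have "((\<lambda>x. x * s) has_vector_derivative s) (at x within ?I)" by (auto intro!: derivative_eq_intros)
      from vector_diff_chain_within[OF this has_vector_derivative_at_within[OF f'[OF mem[OF x]]]] s
      have "((\<lambda>x. f (x * s)) has_vector_derivative s *\<^sub>R vderiv f (x * s)) (at x within ?I)"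
        by (simp add: o_def)
      from bounded_linear.has_vector_derivative[OF bounded_linear_scaleR_right this, of "s ^ k"]
      show "((\<lambda>x. s ^ k *\<^sub>R f (x * s)) has_vector_derivative s ^ Suc k *\<^sub>R vderiv f (x * s)) (at x within ?I)"
        by (simp add: mult.commute)
    next
      fix x assume "x \<in> ?I"
      then show "(\<lambda>s. s ^ k *\<^sub>R f (x * s)) integrable_on cbox 0 1"
        by (intro integrable_continuous continuous_intros continuous_on_compose2[OF hd_on_imp_continuous_on[OF Suc.prems]])
          (use mem in auto)
    next
      show "continuous_on (?I \<times> cbox 0 1) (\<lambda>(x, s). s ^ Suc k *\<^sub>R vderiv f (x * s))"
        using cont[OF hd_on_imp_continuous_on[OF hf'], of "Suc k"] by simp
    qed simp
    have "((\<lambda>t. integral {0..1} (\<lambda>s. s ^ k *\<^sub>R f (t * s))) has_vector_derivative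
        integral {0..1} (\<lambda>s. s ^ Suc k *\<^sub>R vderiv f (t * s))) (at t)" if t: "t \<in> ?I" for t
      using D[OF t] unfolding at_within_open[OF t open_greaterThanLessThan] cbox_interval .
    from hd_on_Suc_vectorI[OF _ this Suc.IH[OF hf']] show ?case by simp
  qed
qed

lemma hadamard:
  fixes A :: "real \<Rightarrow> 'a::banach"
  assumes A: "smooth_on {-\<tau><..<\<tau>} A" "A 0 = 0" and \<tau>: "0 < \<tau>"
  obtains B where "smooth_on {-\<tau><..<\<tau>} B" "\<And>t. t \<in> {-\<tau><..<\<tau>} \<Longrightarrow> A t = t *\<^sub>R B t" "B 0 = vderiv A 0"
proof -
  let ?I = "{-\<tau><..<\<tau>}"
  define B where "B t = integral {0..1} (\<lambda>s. vderiv A (t * s))" for t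
  have "hd_on ?I B n" for n
    using hd_on_hadamard_integral[where k=0, OF smooth_on_imp_hd_on[OF smooth_vderiv[OF _ A(1)], of n]]
    by (simp add: B_def[abs_def])
  moreover have "A t = t *\<^sub>R B t" if t: "t \<in> ?I" for t
  proof -
    have mem: "t * s \<in> ?I" if "s \<in> {0..1}" for s :: real
    proof -
      have "\<bar>t * s\<bar> \<le> \<bar>t\<bar> * 1" unfolding abs_mult using that by (intro mult_left_mono) auto
      then show ?thesis using t by (auto simp: abs_le_iff)
    qed
    have "((\<lambda>s. t *\<^sub>R vderiv A (t * s)) has_integral A (t * 1) - A (t * 0)) {0..1}"
    proof (rule fundamental_theorem_of_calculus)
      fix s :: real assume s: "s \<in> {0..1}"
      have "((\<lambda>s. t * s) has_vector_derivative t) (at s within {0..1})" by (auto intro!: derivative_eq_intros)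
      from vector_diff_chain_within[OF this has_vector_derivative_at_within[OF smooth_has_vderiv[OF A(1) mem[OF s]]]]
      show "((\<lambda>s. A (t * s)) has_vector_derivative t *\<^sub>R vderiv A (t * s)) (at s within {0..1})" by (simp add: o_def)
    qed simp
    then have "integral {0..1} (\<lambda>s. t *\<^sub>R vderiv A (t * s)) = A (t * 1) - A (t * 0)" by (rule integral_unique)
    then show ?thesis using A(2) by (simp add: B_def)
  qed
  moreover have "B 0 = vderiv A 0" by (simp add: B_def)
  ultimately show ?thesis using that[of B] unfolding smooth_on_def by blast
qed

section \<open>The Riccati equation\<close>

text \<open>In the Leibniz expansion a permutation other than the identity moves at least two
  indices. With one factor differentiated, the rest of its product still contains an off-diagonal
  entry of the identity matrix; only the identity permutation contributes, and it contributes the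
  trace.\<close>

lemma det_has_vector_derivative_at_one:
  fixes C :: "real \<Rightarrow> real ^ 'm::finite ^ 'm"
  assumes C: "(C has_vector_derivative C') (at t)" and one: "C t = mat 1"
  shows "((\<lambda>s. det (C s)) has_vector_derivative trace C') (at t)"
proof -
  have e: "((\<lambda>s. C s $ i $ j) has_derivative (\<lambda>h. h * C' $ i $ j)) (at t)" for i j
    using bounded_linear.has_vector_derivative[OF bounded_linear_vec_nth bounded_linear.has_vector_derivative[OF bounded_linear_vec_nth C]]
    by (simp add: has_vector_derivative_def)
  have "((\<lambda>s. det (C s)) has_derivative
      (\<lambda>h. \<Sum>p\<in>{p. p permutes UNIV}. of_int (sign p) *
        (\<Sum>i\<in>UNIV. (h * C' $ i $ p i) * (\<Prod>j\<in>UNIV - {i}. C t $ j $ p j)))) (at t)"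
    unfolding det_def
    by (intro has_derivative_sum has_derivative_mult_right has_derivative_prod e)
  moreover have "(\<Sum>p\<in>{p. p permutes UNIV}. of_int (sign p) *
        (\<Sum>i\<in>UNIV. (h * C' $ i $ p i) * (\<Prod>j\<in>UNIV - {i}. C t $ j $ p j))) = h * trace C'" for h
  proof -
    have "of_int (sign p) * (\<Sum>i\<in>UNIV. (h * C' $ i $ p i) * (\<Prod>j\<in>UNIV - {i}. C t $ j $ p j)) =
        (if p = id then h * trace C' else 0)" if p: "p permutes UNIV" for p :: "'m \<Rightarrow> 'm"
    proof (cases "p = id")
      case True
      have "(\<Prod>j\<in>UNIV - {i}. C t $ j $ id j) = 1" for i :: 'm
        by (rule prod.neutral) (simp add: one mat_def)
      then show ?thesis using True by (simp add: trace_def sum_distrib_left sign_id)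
    next
      case False
      have z: "(\<Prod>j\<in>UNIV - {i}. C t $ j $ p j) = 0" for i
      proof -
        \<comment> \<open>\<open>k\<close> and \<open>p k\<close> are distinct and both moved by
          \<open>p\<close>, so one of them differs from the differentiated index
          \<open>i\<close>.\<close>
        obtain k where k: "p k \<noteq> k" using False by fastforce
        have "p (p k) \<noteq> p k" using k permutes_inj[OF p] by (metis injD)
        then obtain j where "j \<noteq> i" "p j \<noteq> j" using k by metis
        then show ?thesis by (intro prod_zero) (auto simp: one mat_def intro!: bexI[of _ j])
      qed
      show ?thesis using False unfolding z by simp
    qed
    then have "(\<Sum>p\<in>{p. p permutes UNIV}. of_int (sign p) *
        (\<Sum>i\<in>UNIV. (h * C' $ i $ p i) * (\<Prod>j\<in>UNIV - {i}. C t $ j $ p j))) =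
        (\<Sum>p\<in>{p. p permutes (UNIV :: 'm set)}. if p = id then h * trace C' else 0)"
      by (intro sum.cong) auto
    also have "\<dots> = h * trace C'" by (simp add: sum.delta permutes_id)
    finally show ?thesis .
  qed
  ultimately show ?thesis by (simp add: has_vector_derivative_def)
qed

text \<open>Jacobi's formula, reduced to a curve through the identity matrix by right multiplication
  with the constant inverse of \<open>B t\<close>.\<close>

lemma det_has_vector_derivative:
  fixes B :: "real \<Rightarrow> real ^ 'm::finite ^ 'm"
  assumes B: "(B has_vector_derivative B') (at t)" and inv: "invertible (B t)"
  shows "((\<lambda>s. det (B s)) has_vector_derivative det (B t) * trace (B' ** matrix_inv (B t))) (at t)"
proof -
  let ?N = "matrix_inv (B t)"
  have "((\<lambda>s. B s ** ?N) has_vector_derivative B' ** ?N) (at t)"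
    by (rule bounded_linear.has_vector_derivative[OF bounded_bilinear.bounded_linear_left[OF bounded_bilinear_matrix_mult] B])
  from det_has_vector_derivative_at_one[OF this matrix_inv_mult(1)[OF inv]]
  have "((\<lambda>s. det (B t) * det (B s ** ?N)) has_vector_derivative det (B t) * trace (B' ** ?N)) (at t)"
    by (rule has_vector_derivative_mult_right)
  moreover have "det (B t) * det (B s ** ?N) = det (B s)" for s
  proof -
    have "det ?N * det (B t) = 1"
      using matrix_inv_mult(2)[OF inv] by (metis det_mul det_I)
    then show ?thesis by (simp add: det_mul algebra_simps)
  qed
  ultimately show ?thesis by simp
qed

lemmas matrix_mult_bilinear =
  bounded_bilinear.add_left[OF bounded_bilinear_matrix_mult] bounded_bilinear.add_right[OF bounded_bilinear_matrix_mult]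
  bounded_bilinear.diff_left[OF bounded_bilinear_matrix_mult] bounded_bilinear.diff_right[OF bounded_bilinear_matrix_mult]
  bounded_bilinear.minus_left[OF bounded_bilinear_matrix_mult] bounded_bilinear.minus_right[OF bounded_bilinear_matrix_mult]
  bounded_bilinear.scaleR_left[OF bounded_bilinear_matrix_mult] bounded_bilinear.scaleR_right[OF bounded_bilinear_matrix_mult]
  bounded_bilinear.zero_left[OF bounded_bilinear_matrix_mult] bounded_bilinear.zero_right[OF bounded_bilinear_matrix_mult]

lemma trace_scaleR: "trace (c *\<^sub>R (A :: real ^ 'm::finite ^ 'm)) = c * trace A"
  by (simp add: trace_def sum_distrib_left)

lemma trace_minus: "trace (- (A :: real ^ 'm::finite ^ 'm)) = - trace A"
  by (simp add: trace_def sum_negf)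

lemma trace_zero: "trace (0 :: real ^ 'm::finite ^ 'm) = 0"
  by (simp add: trace_def)

section \<open>Comparison of coefficients\<close>

lemma sum_atMost_numeral:
  fixes f :: "nat \<Rightarrow> 'b::comm_monoid_add"
  shows "(\<Sum>i\<le>1. f i) = f 0 + f 1" "(\<Sum>i\<le>2. f i) = f 0 + f 1 + f 2" "(\<Sum>i\<le>3. f i) = f 0 + f 1 + f 2 + f 3"
    "(\<Sum>i\<le>4. f i) = f 0 + f 1 + f 2 + f 3 + f 4" "(\<Sum>i\<le>5. f i) = f 0 + f 1 + f 2 + f 3 + f 4 + f 5"
    "(\<Sum>i\<le>6. f i) = f 0 + f 1 + f 2 + f 3 + f 4 + f 5 + f 6"
    "(\<Sum>i\<le>7. f i) = f 0 + f 1 + f 2 + f 3 + f 4 + f 5 + f 6 + f 7"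
  by (simp_all add: eval_nat_numeral)

text \<open>Here \<open>V\<close> and \<open>D\<close> are the Taylor coefficients of the solution of the Riccati equation and of the
  density, and \<open>J k\<close> is the \<open>k\<close>-th derivative of the curvature along the geodesic.\<close>

lemma density_coefficients:
  fixes V J :: "nat \<Rightarrow> real ^ 'm::finite ^ 'm" and D :: "nat \<Rightarrow> real"
  assumes V0: "V 0 = 0"
    and V: "\<And>k. V (Suc k) = - (1 / real (k + 3)) *\<^sub>R ((1 / fact k) *\<^sub>R J k + (\<Sum>i\<le>k. V i ** V (k - i)))"
    and D0: "D 0 = 1" and D: "\<And>k. D (Suc k) = (\<Sum>i\<le>k. D i * trace (V (k - i))) / real (Suc k)"
  shows "D 2 = - trace (J 0) / 6" (is ?D2)
    and "D 3 = - trace (J 1) / 12" (is ?D3)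
    and "D 4 = trace (J 0) ^ 2 / 72 - trace (J 0 ** J 0) / 180 - trace (J 2) / 40" (is ?D4)
    and "D 5 = trace (J 0) * trace (J 1) / 72 - trace (J 0 ** J 1) / 180 - trace (J 3) / 180" (is ?D5)
    and "D 6 = - (trace (J 0) ^ 3) / 1296 + trace (J 0) * trace (J 0 ** J 0) / 1080
              + trace (J 0) * trace (J 2) / 240 - trace (J 0 ** J 0 ** J 0) / 2835
              - trace (J 0 ** J 2) / 630 + trace (J 1) ^ 2 / 288
              - trace (J 1 ** J 1) / 672 - trace (J 4) / 1008" (is ?D6)
    and "D 7 = trace (J 0) * trace (J 0 ** J 1) / 1080 - trace (J 0) ^ 2 * trace (J 1) / 864
              - trace (J 5) / 6720 + trace (J 0) * trace (J 3) / 1080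
              + trace (J 0 ** J 0) * trace (J 1) / 2160 - trace (J 0 ** J 0 ** J 1) / 1890
              - trace (J 0 ** J 3) / 3024 + trace (J 1) * trace (J 2) / 480
              - trace (J 1 ** J 2) / 1120" (is ?D7)
    and "D 8 = trace (J 0) ^ 4 / 31104 - trace (J 0) ^ 2 * trace (J 0 ** J 0) / 12960
              - trace (J 0) ^ 2 * trace (J 2) / 2880 + trace (J 0) * trace (J 0 ** J 0 ** J 0) / 17010
              + trace (J 0) * trace (J 0 ** J 2) / 3780 - trace (J 6) / 51840
              - trace (J 0) * trace (J 1) ^ 2 / 1728 + trace (J 0) * trace (J 1 ** J 1) / 4032
              - trace (J 2 ** J 2) / 7200 + trace (J 0) * trace (J 4) / 6048
              + trace (J 0 ** J 0) * trace (J 2) / 7200 + trace (J 0 ** J 0) ^ 2 / 64800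
              - trace (J 0 ** J 0 ** J 0 ** J 0) / 37800 - 17 * trace (J 0 ** J 0 ** J 2) / 113400
              + trace (J 0 ** J 1) * trace (J 1) / 2160 - 5 * trace (J 0 ** J 1 ** J 1) / 18144
              - trace (J 0 ** J 4) / 18144 + trace (J 1) * trace (J 3) / 2160
              - trace (J 1 ** J 3) / 5184 + trace (J 2) ^ 2 / 3200" (is ?D8)
proof -
  \<comment> \<open>The index 1 is kept as it stands; rewriting it to \<open>Suc 0\<close> would
    keep the facts on \<open>V 1\<close>, \<open>J 1\<close> and \<open>D 1\<close> from
    matching.\<close>
  note One_nat_def [simp del] One_nat_def [symmetric, simp]
  note mm = matrix_mult_bilinear matrix_mul_assoc scaleR_add_right scaleR_minus_right
  note tr = trace_add trace_sub trace_scaleR trace_minus trace_zero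
  have V1: "V 1 = - (1/3) *\<^sub>R J 0" using V[of 0] V0 by (simp add: mm)
  have V2: "V 2 = - (1/4) *\<^sub>R J 1" using V[of 1] V0 by (simp add: sum_atMost_numeral mm)
  have "V 3 = - (1/5) *\<^sub>R ((1/2) *\<^sub>R J 2 + V 1 ** V 1)"
    using V[of 2] V0 by (simp add: sum_atMost_numeral mm)
  then have V3: "V 3 = - (1/10) *\<^sub>R J 2 - (1/45) *\<^sub>R (J 0 ** J 0)"
    unfolding V1 by (simp add: mm vec_eq_iff field_simps)
  have "V 4 = - (1/6) *\<^sub>R ((1/6) *\<^sub>R J 3 + (V 1 ** V 2 + V 2 ** V 1))"
    using V[of 3] V0 by (simp add: sum_atMost_numeral mm fact_numeral)
  then have V4: "V 4 = - (1/36) *\<^sub>R J 3 - (1/72) *\<^sub>R (J 0 ** J 1 + J 1 ** J 0)"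
    unfolding V1 V2 by (simp add: mm vec_eq_iff field_simps)
  have "V 5 = - (1/7) *\<^sub>R ((1/24) *\<^sub>R J 4 + (V 1 ** V 3 + V 2 ** V 2 + V 3 ** V 1))"
    using V[of 4] V0 by (simp add: sum_atMost_numeral mm fact_numeral)
  also have "\<dots> = - (1/168) *\<^sub>R J 4 - (1/210) *\<^sub>R (J 0 ** J 2 + J 2 ** J 0)
      - (2/945) *\<^sub>R (J 0 ** J 0 ** J 0) - (1/112) *\<^sub>R (J 1 ** J 1)"
    unfolding V1 V2 V3 by (simp add: mm vec_eq_iff field_simps)
  finally have V5: "V 5 = - (1/168) *\<^sub>R J 4 - (1/210) *\<^sub>R (J 0 ** J 2 + J 2 ** J 0)
      - (2/945) *\<^sub>R (J 0 ** J 0 ** J 0) - (1/112) *\<^sub>R (J 1 ** J 1)" .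
  \<comment> \<open>Cyclic rotation brings each trace of a word in noncommuting matrices to the
    representative used in the statement.\<close>
  have c2: "trace (J i ** J j) = trace (J j ** J i)" for i j by (rule trace_mul_sym)
  have c3: "trace (J i ** J j ** J k) = trace (J k ** J i ** J j)" for i j k
    by (metis trace_mul_sym matrix_mul_assoc)
  have t1: "trace (V 1) = - trace (J 0) / 3" by (simp add: V1 tr)
  have t2: "trace (V 2) = - trace (J 1) / 4" by (simp add: V2 tr)
  have t3: "trace (V 3) = - trace (J 2) / 10 - trace (J 0 ** J 0) / 45" by (simp add: V3 tr)
  have t4: "trace (V 4) = - trace (J 3) / 36 - trace (J 0 ** J 1) / 36" by (simp add: V4 tr c2[of 1 0])
  have t5: "trace (V 5) = - trace (J 4) / 168 - trace (J 0 ** J 2) / 105 - 2 * trace (J 0 ** J 0 ** J 0) / 945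
      - trace (J 1 ** J 1) / 112" by (simp add: V5 tr c2[of 2 0])
  \<comment> \<open>Only traces matter from here on, since \<open>V 6\<close> and \<open>V 7\<close>
    enter no further matrix product. The factor is 1/8: the curvature term gets
    \<open>8 * fact 5 = 960\<close>, and cyclicity pairs the mixed products into 2/8.\<close>
  have t6: "trace (V 6) = - trace (J 5) / 960 - trace (V 1 ** V 4) / 4 - trace (V 2 ** V 3) / 4"
    using V[of 5] V0 trace_mul_sym[of "V 4" "V 1"] trace_mul_sym[of "V 3" "V 2"]
    by (simp add: sum_atMost_numeral mm tr fact_numeral)
  have t14: "trace (V 1 ** V 4) = trace (J 0 ** J 3) / 108 + trace (J 0 ** J 0 ** J 1) / 108"
    using c3[of 0 1 0] by (simp add: V1 V4 mm tr)
  have t23: "trace (V 2 ** V 3) = trace (J 1 ** J 2) / 40 + trace (J 0 ** J 0 ** J 1) / 180"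
    using c3[of 0 0 1] by (simp add: V2 V3 mm tr)
  \<comment> \<open>The factor is 1/9, and \<open>9 * fact 6 = 6480\<close>. The middle product
    \<open>V 3 ** V 3\<close> occurs once, the others twice.\<close>
  have t7: "trace (V 7) = - trace (J 6) / 6480 - 2 * trace (V 1 ** V 5) / 9 - 2 * trace (V 2 ** V 4) / 9 - trace (V 3 ** V 3) / 9"
    using V[of 6] V0 trace_mul_sym[of "V 5" "V 1"] trace_mul_sym[of "V 4" "V 2"]
    by (simp add: sum_atMost_numeral mm tr fact_numeral)
  have t15: "trace (V 1 ** V 5) = trace (J 0 ** J 4) / 504 + trace (J 0 ** J 0 ** J 2) / 315
      + 2 * trace (J 0 ** J 0 ** J 0 ** J 0) / 2835 + trace (J 0 ** J 1 ** J 1) / 336"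
    using c3[of 0 2 0] by (simp add: V1 V5 mm tr)
  have t24: "trace (V 2 ** V 4) = trace (J 1 ** J 3) / 144 + trace (J 0 ** J 1 ** J 1) / 144"
    using c3[of 0 1 1] c3[of 1 0 1] c3[of 1 1 0] by (simp add: V2 V4 mm tr)
  have t33: "trace (V 3 ** V 3) = trace (J 2 ** J 2) / 100 + trace (J 0 ** J 0 ** J 2) / 225
      + trace (J 0 ** J 0 ** J 0 ** J 0) / 2025"
    using c3[of 0 0 2] by (simp add: V3 mm tr field_simps)
  have t0: "trace (V 0) = 0" by (simp add: V0 tr)
  note t = t0 t1 t2 t3 t4 t5
  have D1: "D 1 = 0" using D[of 0] D0 t0 by simp
  show D2: ?D2
    using D[of 1] D0 D1 t by (simp add: sum_atMost_numeral)
  show D3: ?D3 using D[of 2] D0 D1 D2 t by (simp add: sum_atMost_numeral)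
  show D4: ?D4
    using D[of 3] D0 D1 D2 D3 t by (simp add: sum_atMost_numeral field_simps power2_eq_square)
  show D5: ?D5
    using D[of 4] D0 D1 D2 D3 D4 t by (simp add: sum_atMost_numeral field_simps power2_eq_square)
  show D6: ?D6
    using D[of 5] D0 D1 D2 D3 D4 D5 t by (simp add: sum_atMost_numeral field_simps power2_eq_square power3_eq_cube)
  show D7: ?D7
    using D[of 6] D0 D1 D2 D3 D4 D5 D6 t t6 t14 t23
    by (simp add: sum_atMost_numeral field_simps power2_eq_square power3_eq_cube)
  show ?D8
    using D[of 7] D0 D1 D2 D3 D4 D5 D6 D7 t t6 t14 t23 t7 t15 t24 t33
    by (simp add: sum_atMost_numeral field_simps power2_eq_square power3_eq_cube power4_eq_xxxx)
qed

text \<open>The logarithmic derivative \<open>V\<close> of \<open>B = A/t\<close> satisfies \<open>t V' + 2 V + t V\<^sup>2 = - t R\<close>,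
  and \<open>D = det B\<close> satisfies \<open>D' = D tr V\<close>.\<close>

theorem matrix_jacobi_expansion:
  fixes R :: "nat \<Rightarrow> real \<Rightarrow> real ^ 'm::finite ^ 'm" and A A' :: "real \<Rightarrow> real ^ 'm ^ 'm" and F :: "real \<Rightarrow> real"
  assumes \<tau>: "0 < \<tau>"
    and R: "\<And>k t. \<bar>t\<bar> < \<tau> \<Longrightarrow> (R k has_vector_derivative R (Suc k) t) (at t)"
    and A0: "A 0 = 0" "A' 0 = mat 1"
    and A: "\<And>t. \<bar>t\<bar> < \<tau> \<Longrightarrow> (A has_vector_derivative A' t) (at t)"
    and A': "\<And>t. \<bar>t\<bar> < \<tau> \<Longrightarrow> (A' has_vector_derivative - (R 0 t ** A t)) (at t)"
    and F0: "F 0 = 1" and F: "\<And>t. \<bar>t\<bar> < \<tau> \<Longrightarrow> t \<noteq> 0 \<Longrightarrow> F t = \<bar>det ((1/t) *\<^sub>R A t)\<bar>"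
  obtains V D where "V 0 = 0"
    "\<And>k. V (Suc k) = - (1 / real (k + 3)) *\<^sub>R ((1 / fact k) *\<^sub>R R k 0 + (\<Sum>i\<le>k. V i ** V (k - i)))"
    "D 0 = 1" "\<And>k. D (Suc k) = (\<Sum>i\<le>k. D i * trace (V (k - i))) / real (Suc k)"
    "\<And>k. (deriv ^^ k) F 0 / fact k = D k"
proof -
  let ?I = "{-\<tau><..<\<tau>}"
  have I: "t \<in> ?I \<longleftrightarrow> \<bar>t\<bar> < \<tau>" for t by auto
  have RI: "(R k has_vector_derivative R (Suc k) t) (at t)" if "t \<in> ?I" for k t using R that I by blast
  have sR: "smooth_on ?I (R 0)" using smooth_on_tower[where R=R, OF open_greaterThanLessThan RI] .
  \<comment> \<open>Smoothness is bootstrapped for the pair: order \<open>n\<close> of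
    \<open>A\<close> and \<open>A'\<close> gives order \<open>n\<close> of both right-hand sides,
    hence order \<open>n + 1\<close> of the pair.\<close>
  have "hd_on ?I A n \<and> hd_on ?I A' n" for n
  proof (induction n)
    case 0
    have "continuous_on ?I A" "continuous_on ?I A'"
      using A A' I by (auto intro!: continuous_at_imp_continuous_on has_vector_derivative_continuous)
    then show ?case by simp
  next
    case (Suc n)
    have "hd_on ?I (\<lambda>t. - (R 0 t ** A t)) n"
      using Suc smooth_on_imp_hd_on[OF sR] by (intro hd_on_minus hd_on_matrix_mult open_greaterThanLessThan) auto
    then have "hd_on ?I A' (Suc n)" using A' I by (intro hd_on_Suc_vectorI) auto
    moreover have "hd_on ?I A (Suc n)" using A I Suc by (intro hd_on_Suc_vectorI[where f'=A']) auto
    ultimately show ?case by simp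
  qed
  then have sA: "smooth_on ?I A" by (simp add: smooth_on_def)
  obtain B where sB: "smooth_on ?I B" and AB: "\<And>t. t \<in> ?I \<Longrightarrow> A t = t *\<^sub>R B t" and B0: "B 0 = vderiv A 0"
    using hadamard[OF sA A0(1) \<tau>] by blast
  have B0: "B 0 = mat 1" using B0 vderiv_eqI[OF A[of 0]] \<tau> A0(2) by simp
  have "continuous_on ?I (\<lambda>t. det (B t))"
    by (rule hd_on_imp_continuous_on[of _ _ 0], intro hd_on_det hd_on_vec_nth smooth_on_imp_hd_on[OF sB]
        open_greaterThanLessThan)
  then have "isCont (\<lambda>t. det (B t)) 0" using \<tau> by (simp add: continuous_on_eq_continuous_at)
  \<comment> \<open>Near 0 the determinant differs from its value 1 by less than 1 and is positive:
    \<open>B\<close> is invertible there, and the absolute value in the formula for \<open>F\<close>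
    disappears.\<close>
  then obtain \<delta>0 where \<delta>0: "\<delta>0 > 0" "\<And>t. dist t 0 < \<delta>0 \<Longrightarrow> dist (det (B t)) (det (B 0)) < 1"
    unfolding continuous_at_eps_delta by (metis zero_less_one)
  define \<delta> where "\<delta> = min \<tau> \<delta>0"
  let ?J = "{-\<delta><..<\<delta>}"
  have J: "open ?J" "0 \<in> ?J" "?J \<subseteq> ?I" using \<tau> \<delta>0 by (auto simp: \<delta>_def)
  have JI: "\<bar>t\<bar> < \<tau>" "t \<in> ?I" if "t \<in> ?J" for t using that by (auto simp: \<delta>_def)
  have pos: "det (B t) > 0" if "t \<in> ?J" for t
  proof -
    have "\<bar>det (B t) - 1\<bar> < 1" using \<delta>0(2)[of t] that by (auto simp: \<delta>_def dist_real_def B0)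
    then show ?thesis by linarith
  qed
  have inv: "invertible (B t)" if "t \<in> ?J" for t using pos[OF that] by (simp add: invertible_det_nz)
  have sBJ: "smooth_on ?J B" using sB hd_on_subset[OF _ J(3)] by (auto simp: smooth_on_def)
  have sRJ: "smooth_on ?J (R 0)" using sR hd_on_subset[OF _ J(3)] by (auto simp: smooth_on_def)
  note sB' = smooth_vderiv[OF J(1) sBJ]
  define V where "V t = vderiv B t ** matrix_inv (B t)" for t
  have sV: "smooth_on ?J V"
    unfolding V_def[abs_def] smooth_on_def
    by (intro allI hd_on_matrix_mult hd_on_matrix_inv J(1) smooth_on_imp_hd_on[OF sB'] smooth_on_imp_hd_on[OF sBJ] inv)
  note sV' = smooth_vderiv[OF J(1) sV]
  define D where "D t = det (B t)" for t
  have sD: "smooth_on ?J D"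
    unfolding D_def[abs_def] smooth_on_def
    by (intro allI hd_on_det J(1) hd_on_vec_nth smooth_on_imp_hd_on[OF sBJ])
  have VB: "V t ** B t = vderiv B t" if "t \<in> ?J" for t
    by (simp add: V_def matrix_mul_assoc[symmetric] matrix_inv_mult(2)[OF inv[OF that]])
  have DV: "vderiv D t = D t * trace (V t)" if "t \<in> ?J" for t
    unfolding V_def D_def[abs_def]
    by (rule vderiv_eqI[OF det_has_vector_derivative[OF smooth_has_vderiv[OF sBJ that] inv[OF that]]])
  have A'B: "A' t = t *\<^sub>R vderiv B t + B t" if "t \<in> ?J" for t
  proof -
    have "(A has_vector_derivative t *\<^sub>R vderiv B t + 1 *\<^sub>R B t) (at t)"
      by (rule has_vector_derivative_transform_within_open[OF
            bounded_bilinear.has_vector_derivative[OF bounded_bilinear_scaleR has_vector_derivative_id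
              smooth_has_vderiv[OF sBJ that]] J(1) that])
        (use AB J(3) in auto)
    from vector_derivative_unique_at[OF A[OF JI(1)[OF that]] this] show ?thesis by simp
  qed
  \<comment> \<open>The equation for \<open>A\<close> after the substitution \<open>A = t B\<close>,
    whose second derivative is \<open>2 B' + t B''\<close>.\<close>
  have B'': "2 *\<^sub>R vderiv B t + t *\<^sub>R vderiv (vderiv B) t = - t *\<^sub>R (R 0 t ** B t)" if "t \<in> ?J" for t
  proof -
    have "((\<lambda>t. t *\<^sub>R vderiv B t + B t) has_vector_derivative
        (t *\<^sub>R vderiv (vderiv B) t + 1 *\<^sub>R vderiv B t) + vderiv B t) (at t)"
      by (intro has_vector_derivative_add smooth_has_vderiv[OF sBJ that]
          bounded_bilinear.has_vector_derivative[OF bounded_bilinear_scaleR has_vector_derivative_id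
              smooth_has_vderiv[OF sB' that]])
    then have "(A' has_vector_derivative (t *\<^sub>R vderiv (vderiv B) t + 1 *\<^sub>R vderiv B t) + vderiv B t) (at t)"
      by (rule has_vector_derivative_transform_within_open[OF _ J(1) that]) (simp add: A'B)
    from vector_derivative_unique_at[OF A'[OF JI(1)[OF that]] this] AB[OF JI(2)[OF that]]
    show ?thesis by (simp add: matrix_mult_bilinear scaleR_2 algebra_simps)
  qed
  \<comment> \<open>From \<open>B' = V B\<close> follows \<open>B'' = V V B + V' B\<close>.
    Inserting both makes \<open>B\<close> a common right factor of the equation for
    \<open>B\<close>, cancelled by its inverse.\<close>
  have riccati: "t *\<^sub>R vderiv V t + 2 *\<^sub>R V t + t *\<^sub>R (V t ** V t) + t *\<^sub>R R 0 t = 0" if t: "t \<in> ?J" for t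
  proof -
    have "((\<lambda>t. V t ** B t) has_vector_derivative V t ** vderiv B t + vderiv V t ** B t) (at t)"
      by (intro bounded_bilinear.has_vector_derivative[OF bounded_bilinear_matrix_mult]
          smooth_has_vderiv[OF sV t] smooth_has_vderiv[OF sBJ t])
    then have "(vderiv B has_vector_derivative V t ** vderiv B t + vderiv V t ** B t) (at t)"
      by (rule has_vector_derivative_transform_within_open[OF _ J(1) t]) (simp add: VB)
    then have "vderiv (vderiv B) t = V t ** vderiv B t + vderiv V t ** B t" by (rule vderiv_eqI)
    then have "vderiv (vderiv B) t = V t ** V t ** B t + vderiv V t ** B t"
      by (simp add: VB[OF t] flip: matrix_mul_assoc)
    moreover have "2 *\<^sub>R vderiv B t + t *\<^sub>R vderiv (vderiv B) t + t *\<^sub>R (R 0 t ** B t) = 0"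
      using B''[OF t] by simp
    ultimately have "(t *\<^sub>R vderiv V t + 2 *\<^sub>R V t + t *\<^sub>R (V t ** V t) + t *\<^sub>R R 0 t) ** B t = 0"
      by (simp add: matrix_mult_bilinear VB[OF t] algebra_simps)
    then have "(t *\<^sub>R vderiv V t + 2 *\<^sub>R V t + t *\<^sub>R (V t ** V t) + t *\<^sub>R R 0 t) ** B t ** matrix_inv (B t) = 0"
      by (simp add: matrix_mult_bilinear)
    then show ?thesis by (simp add: matrix_mul_assoc[symmetric] matrix_inv_mult(1)[OF inv[OF t]])
  qed
  let ?v = "taylor_coeff V"
  have st: "smooth_on ?J (\<lambda>t. t *\<^sub>R h t)" if "smooth_on ?J h" for h :: "real \<Rightarrow> real ^ 'm ^ 'm"
    by (rule smooth_on_bilinear[OF J(1) bounded_bilinear_scaleR smooth_on_ident[OF J(1)] that])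
  have sVV: "smooth_on ?J (\<lambda>t. V t ** V t)"
    by (rule smooth_on_bilinear[OF J(1) bounded_bilinear_matrix_mult sV sV])
  have s2V: "smooth_on ?J (\<lambda>t. 2 *\<^sub>R V t)"
    by (rule smooth_on_bounded_linear[OF J(1) bounded_linear_scaleR_right sV])
  \<comment> \<open>At \<open>t = 0\<close> all terms of the equation but
    \<open>2 *\<^sub>R V 0\<close> vanish.\<close>
  have V0: "V 0 = 0" using riccati[OF J(2)] by simp
  \<comment> \<open>In order \<open>Suc k\<close> the term \<open>t V'\<close> contributes
    \<open>k + 1\<close> times and \<open>2 V\<close> twice the coefficient sought, which explains
    \<open>k + 3\<close>; the factor \<open>t\<close> lowers the other two terms to order
    \<open>k\<close>.\<close>
  have Vrec: "?v (Suc k) = - (1 / real (k + 3)) *\<^sub>R ((1 / fact k) *\<^sub>R R k 0 + (\<Sum>i\<le>k. ?v i ** ?v (k - i)))" for k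
  proof -
    have "taylor_coeff (\<lambda>t. t *\<^sub>R vderiv V t + 2 *\<^sub>R V t + t *\<^sub>R (V t ** V t) + t *\<^sub>R R 0 t) (Suc k) =
        taylor_coeff (vderiv V) k + 2 *\<^sub>R ?v (Suc k) + (\<Sum>i\<le>k. ?v i ** ?v (k - i)) + taylor_coeff (R 0) k"
      by (simp add: taylor_coeff_add[OF J(1,2)] smooth_on_add[OF J(1)] st sV' sVV s2V sRJ
          taylor_coeff_times_t[OF J(1,2)] taylor_coeff_bounded_linear[OF J(1,2) bounded_linear_scaleR_right sV]
          taylor_coeff_bilinear[OF J(1,2) bounded_bilinear_matrix_mult sV sV])
    moreover have "taylor_coeff (\<lambda>t. t *\<^sub>R vderiv V t + 2 *\<^sub>R V t + t *\<^sub>R (V t ** V t) + t *\<^sub>R R 0 t) (Suc k) =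
        taylor_coeff (\<lambda>t. 0 :: real ^ 'm ^ 'm) (Suc k)"
      by (rule taylor_coeff_cong[OF J(1,2) riccati])
        (auto intro!: smooth_on_add[OF J(1)] st sV' sVV s2V sRJ)
    moreover have "taylor_coeff (\<lambda>t. 0 :: real ^ 'm ^ 'm) (Suc k) = 0"
      using taylor_coeff_bounded_linear[OF J(1,2) bounded_linear_zero sV, of "Suc k"] by simp
    moreover have "taylor_coeff (R 0) k = (1 / fact k) *\<^sub>R R k 0"
      by (rule taylor_coeff_tower[OF J(1,2)]) (use RI J(3) in blast)
    ultimately have *: "real (k + 3) *\<^sub>R ?v (Suc k) = - ((1 / fact k) *\<^sub>R R k 0 + (\<Sum>i\<le>k. ?v i ** ?v (k - i)))"
      by (simp add: taylor_coeff_vderiv algebra_simps add_eq_0_iff2 flip: scaleR_add_left)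
    have "?v (Suc k) = (1 / real (k + 3)) *\<^sub>R (real (k + 3) *\<^sub>R ?v (Suc k))" by simp
    then show ?thesis by (simp only: * scaleR_minus_right scaleR_minus_left)
  qed
  have Drec: "taylor_coeff D (Suc k) = (\<Sum>i\<le>k. taylor_coeff D i * trace (?v (k - i))) / real (Suc k)" for k
  proof -
    have str: "smooth_on ?J (\<lambda>t. trace (V t))" by (rule smooth_on_bounded_linear[OF J(1) bounded_linear_trace sV])
    have "taylor_coeff (vderiv D) k = taylor_coeff (\<lambda>t. D t * trace (V t)) k"
      by (rule taylor_coeff_cong[OF J(1,2) DV smooth_vderiv[OF J(1) sD]])
    also have "\<dots> = (\<Sum>i\<le>k. taylor_coeff D i * trace (?v (k - i)))"
      by (simp add: taylor_coeff_bilinear[OF J(1,2) bounded_bilinear_mult sD str]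
          taylor_coeff_bounded_linear[OF J(1,2) bounded_linear_trace sV])
    finally show ?thesis by (simp add: taylor_coeff_Suc)
  qed
  have FD: "F t = D t" if "t \<in> ?J" for t
  proof (cases "t = 0")
    case False
    then show ?thesis using F[OF JI(1)[OF that]] AB[OF JI(2)[OF that]] pos[OF that] by (simp add: D_def)
  qed (simp add: F0 D_def B0)
  show ?thesis
  proof (rule that[of ?v "taylor_coeff D"])
    show "?v 0 = 0" by (simp add: taylor_coeff_0 V0)
    show "taylor_coeff D 0 = 1" by (simp add: taylor_coeff_0 D_def B0)
    show "(deriv ^^ k) F 0 / fact k = taylor_coeff D k" for k
      by (rule deriv_iterate_eq_taylor_coeff[OF J(1,2) sD FD])
  qed (fact Vrec Drec)+
qed

section \<open>Jacobi fields in a parallel frame\<close>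

lemma has_vector_derivative_componentwise:
  fixes f :: "real \<Rightarrow> 'b::euclidean_space ^ 'm::finite"
  assumes "\<And>i. ((\<lambda>t. f t $ i) has_vector_derivative f' $ i) (at t)"
  shows "(f has_vector_derivative f') (at t)"
proof -
  have "((\<lambda>t. \<Sum>i\<in>UNIV. axis i (f t $ i)) has_vector_derivative (\<Sum>i\<in>UNIV. axis i (f' $ i))) (at t)"
    by (intro has_vector_derivative_sum
        bounded_linear.has_vector_derivative[OF linear_conv_bounded_linear[THEN iffD1, OF linear_axis]] assms)
  then show ?thesis by (simp flip: vec_lambda_eq_sum_axis)
qed

text \<open>Orthonormality says that \<open>transpose P ** G x ** P\<close> is the identity, so
  \<open>transpose P ** G x\<close> is the inverse of the basis matrix and turns coordinates into
  components in the basis.\<close>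

lemma orthonormal_matrix:
  fixes G :: "real ^ 'm::finite \<Rightarrow> real ^ 'm ^ 'm" and E :: "'m \<Rightarrow> real ^ 'm"
  assumes "\<And>i j. metric_at G x (E i) (E j) = (if i = j then 1 else 0)"
  defines "P \<equiv> \<chi> i k. E k $ i"
  shows "P ** (transpose P ** G x) = mat 1" "(transpose P ** G x) ** P = mat 1"
proof -
  have "(transpose P *v w) $ i = E i \<bullet> w" for w i
    by (simp add: P_def transpose_def matrix_vector_mult_def inner_vec_def)
  then have "(transpose P ** G x ** P) $ i $ j = metric_at G x (E i) (E j)" for i j
  proof -
    have "(transpose P ** G x ** P) $ i $ j = ((transpose P ** G x ** P) *v axis j 1) $ i"
      by (simp add: matrix_vector_mul_component inner_axis)
    also have "\<dots> = (transpose P *v (G x *v (P *v axis j 1))) $ i"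
      by (simp only: matrix_vector_mul_assoc matrix_mul_assoc)
    also have "P *v axis j 1 = E j"
      by (simp add: P_def matrix_vector_mult_basis column_def)
    finally show ?thesis using \<open>\<And>w i. (transpose P *v w) $ i = E i \<bullet> w\<close> by (simp add: metric_at_def)
  qed
  then show "(transpose P ** G x) ** P = mat 1"
    using assms(1) by (simp add: vec_eq_iff mat_def)
  then show "P ** (transpose P ** G x) = mat 1" by (simp only: matrix_left_right_inverse)
qed

lemma orthonormal_expansion:
  fixes G :: "real ^ 'm::finite \<Rightarrow> real ^ 'm ^ 'm" and E :: "'m \<Rightarrow> real ^ 'm"
  assumes "\<And>i j. metric_at G x (E i) (E j) = (if i = j then 1 else 0)"
  shows "z = (\<Sum>k\<in>UNIV. metric_at G x (E k) z *\<^sub>R E k)"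
proof -
  define P where "P = (\<chi> i k. E k $ i)"
  have "z = P *v (transpose P *v (G x *v z))"
    using orthonormal_matrix(1)[of G x E, OF assms] by (simp add: matrix_vector_mul_assoc matrix_mul_assoc P_def)
  also have "\<dots> = (\<Sum>k\<in>UNIV. (transpose P *v (G x *v z)) $ k *\<^sub>R E k)"
    unfolding matrix_mult_sum[of P] by (simp add: P_def column_def scalar_mult_eq_scaleR)
  also have "\<dots> = (\<Sum>k\<in>UNIV. metric_at G x (E k) z *\<^sub>R E k)"
  proof (rule sum.cong[OF refl])
    fix k
    have "(transpose P *v w) $ k = E k \<bullet> w" for w
      by (simp add: P_def transpose_def matrix_vector_mult_def inner_vec_def)
    then show "(transpose P *v (G x *v z)) $ k *\<^sub>R E k = metric_at G x (E k) z *\<^sub>R E k"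
      by (simp only: metric_at_def)
  qed
  finally show ?thesis .
qed

context metric_chart
begin

lemma riemann_linear_first:
  assumes "x \<in> S"
  shows "linear (\<lambda>u. (tensor_cov_deriv G ^^ k) (riemann_tensor G) x ([u, a, b, c] @ replicate k w))"
  using tensor_field_linear[OF tensor_field_cov_deriv_riemann assms, of "[0, a, b, c] @ replicate k w" k 0] by simp

lemma riemann_linear_fourth:
  assumes "x \<in> S"
  shows "linear (\<lambda>u. (tensor_cov_deriv G ^^ k) (riemann_tensor G) x ([a, b, c, u] @ replicate k w))"
  using tensor_field_linear[OF tensor_field_cov_deriv_riemann assms, of "[a, b, c, 0] @ replicate k w" k 3]
  by (simp add: numeral_3_eq_3)

text \<open>\<open>W + \<Gamma> v Z\<close> is the covariant derivative of \<open>Z\<close>, and the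
  linearized geodesic equation says that its own covariant derivative is minus the curvature term.
  Pairing with a parallel field replaces covariant by ordinary derivatives, so that the components
  of \<open>Z\<close> obey a linear second-order system.\<close>

lemma jacobi_equation:
  assumes I: "open I" "t \<in> I" "x ` I \<subseteq> S"
    and x: "(x has_vector_derivative v t) (at t)"
    and v: "(v has_vector_derivative - \<Gamma> (x t) (v t) (v t)) (at t)"
    and Z: "(Z has_vector_derivative W t) (at t)"
    and W: "(W has_vector_derivative - (frechet_derivative (\<lambda>y. \<Gamma> y (v t) (v t)) (at (x t)) (Z t)
        + \<Gamma> (x t) (W t) (v t) + \<Gamma> (x t) (v t) (W t))) (at t)"
    and E: "(E has_vector_derivative - \<Gamma> (x t) (v t) (E t)) (at t)"
  shows "((\<lambda>t. gm (x t) (Z t) (E t)) has_vector_derivative gm (x t) (W t + \<Gamma> (x t) (v t) (Z t)) (E t)) (at t)"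
    and "((\<lambda>t. gm (x t) (W t + \<Gamma> (x t) (v t) (Z t)) (E t)) has_vector_derivative
      - riemann_tensor G (x t) [Z t, v t, v t, E t]) (at t)"
proof -
  have xS: "x t \<in> S" using I by auto
  have gm0: "gm (x t) u 0 = 0" for u by (simp add: linear_0[OF linear_metric_at_right])
  show "((\<lambda>t. gm (x t) (Z t) (E t)) has_vector_derivative gm (x t) (W t + \<Gamma> (x t) (v t) (Z t)) (E t)) (at t)"
    using gm_along_curve[OF xS x Z E] by (simp add: gm0)
  let ?d = "\<lambda>a b c. frechet_derivative (\<lambda>y. \<Gamma> y b c) (at (x t)) a" and ?G = "\<Gamma> (x t)"
  let ?z = "Z t" and ?v = "v t" and ?w = "W t"
  let ?U' = "- (?d ?z ?v ?v + ?G ?w ?v + ?G ?v ?w) + (?d ?v ?v ?z + ?G (- ?G ?v ?v) ?z + ?G ?v ?w)"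
  have U: "((\<lambda>t. W t + \<Gamma> (x t) (v t) (Z t)) has_vector_derivative ?U') (at t)"
    by (intro has_vector_derivative_add W christoffel_along_curve[OF I x v Z])
  have "((\<lambda>t. gm (x t) (W t + \<Gamma> (x t) (v t) (Z t)) (E t)) has_vector_derivative
      gm (x t) (?U' + ?G ?v (?w + ?G ?v ?z)) (E t)) (at t)"
    using gm_along_curve[OF xS x U E] by (simp add: gm0)
  \<comment> \<open>By symmetry of \<open>\<Gamma>\<close> the terms in \<open>?w\<close> cancel;
    the derivative terms and those quadratic in \<open>\<Gamma>\<close> that remain make up the
    curvature with a minus sign.\<close>
  moreover have "?U' + ?G ?v (?w + ?G ?v ?z) =
      - (?d ?z ?v ?v + ?G ?z (?G ?v ?v) - (?d ?v ?z ?v + ?G ?v (?G ?z ?v)))"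
  proof -
    have "?d ?v ?v ?z = ?d ?v ?z ?v"
      using frechet_derivative_transform_within_open[of "\<lambda>y. \<Gamma> y ?v ?z" "x t" S "\<lambda>y. \<Gamma> y ?z ?v"]
        christoffel_form_differentiable[OF xS] open_S xS christoffel_form_sym by metis
    moreover have "?G (- ?G ?v ?v) ?z = - ?G ?z (?G ?v ?v)"
      using linear_neg[OF linear_christoffel_form_left] christoffel_form_sym[OF xS] by metis
    ultimately show ?thesis
      using christoffel_form_sym[OF xS, of ?w ?v] christoffel_form_sym[OF xS, of ?z ?v]
      by (simp add: linear_add[OF linear_christoffel_form_right])
  qed
  ultimately show "((\<lambda>t. gm (x t) (W t + \<Gamma> (x t) (v t) (Z t)) (E t)) has_vector_derivative
      - riemann_tensor G (x t) [Z t, v t, v t, E t]) (at t)"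
    by (simp only: riemann_tensor_eq linear_neg[OF linear_metric_at_left])
qed

text \<open>By metric compatibility the inner product of parallel fields has derivative 0, so a
  frame that is orthonormal at 0 stays so.\<close>

lemma parallel_orthonormal:
  assumes I: "x ` {-\<tau><..<\<tau>} \<subseteq> S" "0 < \<tau>"
    and x: "\<And>t. \<bar>t\<bar> < \<tau> \<Longrightarrow> (x has_vector_derivative v t) (at t)"
    and E: "\<And>t. \<bar>t\<bar> < \<tau> \<Longrightarrow> (E has_vector_derivative - \<Gamma> (x t) (v t) (E t)) (at t)"
    and F: "\<And>t. \<bar>t\<bar> < \<tau> \<Longrightarrow> (F has_vector_derivative - \<Gamma> (x t) (v t) (F t)) (at t)"
    and t: "\<bar>t\<bar> < \<tau>"
  shows "gm (x t) (E t) (F t) = gm (x 0) (E 0) (F 0)"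
proof -
  have "((\<lambda>t. gm (x t) (E t) (F t)) has_vector_derivative 0) (at s within {-\<tau><..<\<tau>})" if "s \<in> {-\<tau><..<\<tau>}" for s
  proof -
    have s: "\<bar>s\<bar> < \<tau>" "x s \<in> S" using that I(1) by auto
    have "gm (x s) u 0 = 0" "gm (x s) 0 u = 0" for u
      by (simp_all add: linear_0[OF linear_metric_at_right] linear_0[OF linear_metric_at_left])
    with gm_along_curve[OF s(2) x[OF s(1)] E[OF s(1)] F[OF s(1)]] show ?thesis
      by (simp add: has_vector_derivative_at_within)
  qed
  then obtain c where "\<And>s. s \<in> {-\<tau><..<\<tau>} \<Longrightarrow> gm (x s) (E s) (F s) = c"
    using has_vector_derivative_zero_constant[of "{-\<tau><..<\<tau>}" "\<lambda>t. gm (x t) (E t) (F t)"] convex_real_interval(8)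
    by blast
  then show ?thesis using t I(2) by (simp add: abs_less_iff)
qed

text \<open>Resolves the definite description in \<open>jacobi_operator\<close>: nondegeneracy of
  the metric gives uniqueness, and the matrix in the orthonormal basis, conjugated to coordinates,
  gives existence. In \<open>M\<close> the column index sits in the first slot, on which the
  operator acts, and the row index in the fourth.\<close>

lemma jacobi_operator_orthonormal:
  fixes e :: "'m \<Rightarrow> real ^ 'm" and \<xi> :: "real ^ 'm" and k :: nat
  assumes x: "x \<in> S" and e: "\<And>i j. gm x (e i) (e j) = (if i = j then 1 else 0)"
  defines "Q \<equiv> \<chi> i k. e k $ i"
  defines "M \<equiv> \<chi> i j. (tensor_cov_deriv G ^^ k) (riemann_tensor G) x ([e j, \<xi>, \<xi>, e i] @ replicate k \<xi>)"
  shows "jacobi_operator G x k \<xi> = Q ** M ** (transpose Q ** G x)"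
  unfolding jacobi_operator_def
proof (rule the_equality)
  let ?T = "\<lambda>u v. (tensor_cov_deriv G ^^ k) (riemann_tensor G) x ([u, \<xi>, \<xi>, v] @ replicate k \<xi>)"
  let ?N = "transpose Q ** G x" and ?J = "Q ** M ** (transpose Q ** G x)"
  have N: "(?N *v w) $ i = gm x (e i) w" for w i
  proof -
    have "(transpose Q *v w) $ i = e i \<bullet> w" for w
      by (simp add: Q_def transpose_def matrix_vector_mult_def inner_vec_def)
    then show ?thesis by (simp only: metric_at_def matrix_vector_mul_assoc[symmetric])
  qed
  have NQ: "?N ** Q = mat 1" using orthonormal_matrix(2)[of G x e, OF e] by (simp only: Q_def)
  have T1: "?T u v = (\<Sum>j\<in>UNIV. gm x (e j) u *\<^sub>R ?T (e j) v)" for u v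
  proof -
    note l = riemann_linear_first[OF x, of k \<xi> \<xi> v \<xi>]
    have "?T (\<Sum>j\<in>UNIV. gm x (e j) u *\<^sub>R e j) v = (\<Sum>j\<in>UNIV. gm x (e j) u *\<^sub>R ?T (e j) v)"
      by (simp only: linear_sum[OF l] linear_scale[OF l])
    then show ?thesis using orthonormal_expansion[of G x e u, OF e] by metis
  qed
  have T2: "?T u v = (\<Sum>i\<in>UNIV. gm x (e i) v *\<^sub>R ?T u (e i))" for u v
  proof -
    note l = riemann_linear_fourth[OF x, of k u \<xi> \<xi> \<xi>]
    have "?T u (\<Sum>i\<in>UNIV. gm x (e i) v *\<^sub>R e i) = (\<Sum>i\<in>UNIV. gm x (e i) v *\<^sub>R ?T u (e i))"
      by (simp only: linear_sum[OF l] linear_scale[OF l])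
    then show ?thesis using orthonormal_expansion[of G x e v, OF e] by metis
  qed
  have J1: "gm x (e i) (?J *v u) = ?T u (e i)" for i u
  proof -
    have "gm x (e i) (?J *v u) = ((?N ** Q) *v (M *v (?N *v u))) $ i"
      by (simp only: N[symmetric] matrix_vector_mul_assoc matrix_mul_assoc)
    also have "\<dots> = (M *v (?N *v u)) $ i" by (simp add: NQ)
    also have "\<dots> = (\<Sum>j\<in>UNIV. M $ i $ j * (?N *v u) $ j)" by (simp add: matrix_vector_mult_def)
    also have "\<dots> = (\<Sum>j\<in>UNIV. gm x (e j) u *\<^sub>R ?T (e j) (e i))"
      by (rule sum.cong[OF refl]) (simp add: N M_def)
    finally show ?thesis using T1[of u "e i"] by simp
  qed
  show J: "\<forall>u v. gm x (?J *v u) v = ?T u v"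
  proof (intro allI)
    fix u v
    note l = linear_metric_at_left[of G x v]
    have "gm x (?J *v u) v = gm x v (?J *v u)" by (rule gm_sym[OF x])
    also have "\<dots> = gm x (\<Sum>i\<in>UNIV. gm x (e i) v *\<^sub>R e i) (?J *v u)"
      using orthonormal_expansion[of G x e v, OF e] by metis
    also have "\<dots> = (\<Sum>i\<in>UNIV. gm x (e i) v *\<^sub>R gm x (e i) (?J *v u))"
      by (simp only: linear_sum[OF linear_metric_at_left] linear_scale[OF linear_metric_at_left])
    also have "\<dots> = ?T u v" using T2[of u v] by (simp only: J1)
    finally show "gm x (?J *v u) v = ?T u v" .
  qed
  fix K assume K: "\<forall>u v. gm x (K *v u) v = ?T u v"
  have "K *v u = ?J *v u" for u
    by (rule gm_eqI[OF x]) (use K J in metis)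
  then show "K = ?J" by (simp add: matrix_eq)
qed

end

section \<open>The density along a ray\<close>

context manifold_chart
begin

text \<open>Normal coordinates are linear in the tangent vector, so the matrix under the root is the
  Gram matrix of the images of the basis under the differential of the exponential map. That
  differential is a parameter \<open>L\<close> because it is found differently at the origin and
  away from it.\<close>

lemma volume_density_eq:
  assumes e: "orthonormal_basis_at (g c) (snd c P) e"
    and L: "((\<lambda>\<eta>. snd c (exp_map A g c P \<eta>)) has_derivative L) (at \<eta>)"
  shows "volume_density A g c P e \<eta> = sqrt (det (\<chi> i j. gm (snd c (exp_map A g c P \<eta>)) (L (e i)) (L (e j))))"
proof -
  let ?x0 = "snd c P" and ?lin = "\<lambda>z :: real ^ 'm. \<Sum>i\<in>UNIV. z $ i *\<^sub>R e i"
  define y where "y = (\<chi> i. gm ?x0 \<eta> (e i))"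
  have x0: "?x0 \<in> S" using P by simp
  have on: "gm ?x0 (e i) (e j) = (if i = j then 1 else 0)" for i j using e by (simp add: orthonormal_basis_at_def)
  have y: "?lin y = \<eta>"
    using orthonormal_expansion[of "g c" ?x0 e \<eta>, OF on] gm_sym[OF x0, of \<eta>] by (simp add: y_def)
  have "linear ?lin" by (rule linearI) (auto simp: scaleR_add_left sum.distrib scaleR_sum_right)
  then have l: "(?lin has_derivative ?lin) (at y)" by (rule linear_imp_has_derivative)
  let ?F = "\<lambda>z. snd c (exp_map A g c P (?lin z))"
  have "(?F has_derivative (\<lambda>z. L (?lin z))) (at y)"
    using diff_chain_at[OF l, of "\<lambda>\<eta>. snd c (exp_map A g c P \<eta>)" L] L y by (simp add: o_def)
  then have D: "frechet_derivative ?F (at y) = (\<lambda>z. L (?lin z))" by (rule frechet_derivativeI)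
  have ax: "?lin (axis i 1) = e i" for i
  proof -
    have "?lin (axis i 1) = (\<Sum>j\<in>UNIV. if j = i then e j else 0)"
      by (rule sum.cong[OF refl]) (simp add: axis_def)
    then show ?thesis by simp
  qed
  have "normal_metric A g c P e y = (\<chi> i j. gm (snd c (exp_map A g c P \<eta>)) (L (e i)) (L (e j)))"
    unfolding normal_metric_def Let_def D ax y ..
  then show ?thesis unfolding volume_density_def y_def by simp
qed

theorem volume_density_expansion:
  fixes \<xi> :: "real ^ 'm"
  assumes e: "orthonormal_basis_at (g c) (snd c P) e"
  defines "M \<equiv> \<lambda>k. \<chi> i j. (tensor_cov_deriv (g c) ^^ k) (riemann_tensor (g c)) (snd c P)
    ([e j, \<xi>, \<xi>, e i] @ replicate k \<xi>)"
  obtains V D where "V 0 = 0"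
    "\<And>k. V (Suc k) = - (1 / real (k + 3)) *\<^sub>R ((1 / fact k) *\<^sub>R M k + (\<Sum>i\<le>k. V i ** V (k - i)))"
    "D 0 = 1" "\<And>k. D (Suc k) = (\<Sum>i\<le>k. D i * trace (V (k - i))) / real (Suc k)"
    "\<And>k. taylor_term (volume_density A g c P e) k \<xi> = D k"
proof -
  have on: "gm (snd c P) (e i) (e j) = (if i = j then 1 else 0)" for i j using e by (simp add: orthonormal_basis_at_def)
  obtain T x v Z W where T: "0 < T" and x0: "x 0 = snd c P" and v0: "v 0 = \<xi>"
    and xS: "\<And>t. \<bar>t\<bar> < T \<Longrightarrow> x t \<in> S"
    and x: "\<And>t. \<bar>t\<bar> < T \<Longrightarrow> (x has_vector_derivative v t) (at t)"
    and v: "\<And>t. \<bar>t\<bar> < T \<Longrightarrow> (v has_vector_derivative - \<Gamma> (x t) (v t) (v t)) (at t)"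
    and Z0: "\<And>h. Z h 0 = 0" and W0: "\<And>h. W h 0 = h"
    and Z: "\<And>t h. \<bar>t\<bar> < T \<Longrightarrow> (Z h has_vector_derivative W h t) (at t)"
    and W: "\<And>t h. \<bar>t\<bar> < T \<Longrightarrow> (W h has_vector_derivative
       - (frechet_derivative (\<lambda>y. \<Gamma> y (v t) (v t)) (at (x t)) (Z h t) + \<Gamma> (x t) (W h t) (v t) + \<Gamma> (x t) (v t) (W h t))) (at t)"
    and ex: "\<And>t. \<bar>t\<bar> < T \<Longrightarrow> snd c (exp_map A g c P (t *\<^sub>R \<xi>)) = x t"
    and ed: "\<And>t. \<bar>t\<bar> < T \<Longrightarrow> t \<noteq> 0 \<Longrightarrow>
       ((\<lambda>\<eta>. snd c (exp_map A g c P \<eta>)) has_derivative (\<lambda>h. (1/t) *\<^sub>R Z h t)) (at (t *\<^sub>R \<xi>))"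
    by (rule exp_map_ray[of \<xi>]) (rule that; assumption)
  let ?K = "{-T<..<T}"
  have K: "t \<in> ?K \<longleftrightarrow> \<bar>t\<bar> < T" for t by auto
  have xK: "x ` ?K \<subseteq> S" using xS K by blast
  have lin: "linear (\<lambda>w. - \<Gamma> (x t) (v t) w)" for t
    using linear_compose_neg[OF linear_christoffel_form_right] .
  have "continuous_on ?K (\<lambda>t. - \<Gamma> (x t) (v t) w)" for w
  proof (intro continuous_on_minus continuous_at_imp_continuous_on ballI)
    fix t assume t: "t \<in> ?K"
    then have t': "\<bar>t\<bar> < T" using K by blast
    show "isCont (\<lambda>t. \<Gamma> (x t) (v t) w) t"
      by (rule has_vector_derivative_continuous[OF christoffel_along_curve[OF open_greaterThanLessThan t xK x[OF t'] v[OF t']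
            has_vector_derivative_const]])
  qed
  then obtain \<tau> where \<tau>: "0 < \<tau>" "\<tau> \<le> T" and par: "\<And>y0. \<exists>y. y 0 = y0 \<and>
      (\<forall>t. \<bar>t\<bar> < \<tau> \<longrightarrow> (y has_vector_derivative - \<Gamma> (x t) (v t) (y t)) (at t))"
    using linear_ode_solution[of T "\<lambda>t w. - \<Gamma> (x t) (v t) w"] T lin by blast
  \<comment> \<open>Parallel transport of the basis \<open>e\<close>; the interval is common to all
    members.\<close>
  have "\<exists>E. \<forall>i. E i 0 = e i \<and> (\<forall>t. \<bar>t\<bar> < \<tau> \<longrightarrow> (E i has_vector_derivative - \<Gamma> (x t) (v t) (E i t)) (at t))"
    by (rule choice) (use par in blast)
  then obtain E where E0: "\<And>i. E i 0 = e i"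
    and E: "\<And>i t. \<bar>t\<bar> < \<tau> \<Longrightarrow> (E i has_vector_derivative - \<Gamma> (x t) (v t) (E i t)) (at t)" by blast
  let ?I = "{-\<tau><..<\<tau>}"
  have I: "t \<in> ?I \<longleftrightarrow> \<bar>t\<bar> < \<tau>" for t by auto
  have xI: "x ` ?I \<subseteq> S" using xS I \<tau>(2) by force
  have IT: "\<bar>t\<bar> < T" if "\<bar>t\<bar> < \<tau>" for t using that \<tau>(2) by simp
  have gE: "gm (x t) (E i t) (E j t) = (if i = j then 1 else 0)" if t: "\<bar>t\<bar> < \<tau>" for t i j
    using parallel_orthonormal[OF xI \<tau>(1) x[OF IT] E E t, of i j] by (simp add: E0 x0 on)
  define R where "R k t = (\<chi> i j. (tensor_cov_deriv (g c) ^^ k) (riemann_tensor (g c)) (x t)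
    ([E j t, v t, v t, E i t] @ replicate k (v t)))" for k t
  \<comment> \<open>Column \<open>j\<close> holds the frame components of the Jacobi field with
    initial derivative \<open>e j\<close>, and \<open>B'\<close> those of its covariant
    derivative.\<close>
  define B where "B t = (\<chi> i j. gm (x t) (Z (e j) t) (E i t))" for t
  define B' where "B' t = (\<chi> i j. gm (x t) (W (e j) t + \<Gamma> (x t) (v t) (Z (e j) t)) (E i t))" for t
  have Zexp: "Z h t = (\<Sum>k\<in>UNIV. gm (x t) (Z h t) (E k t) *\<^sub>R E k t)" if t: "\<bar>t\<bar> < \<tau>" for h t
    using orthonormal_expansion[of "g c" "x t" "\<lambda>i. E i t" "Z h t", OF gE[OF t]] gm_sym[OF xS[OF IT[OF t]], of "Z h t"]
    by simp
  have R': "(R k has_vector_derivative R (Suc k) t) (at t)" if t: "\<bar>t\<bar> < \<tau>" for k t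
  proof (intro has_vector_derivative_componentwise)
    fix i j
    have tI: "t \<in> ?I" using t I by blast
    show "((\<lambda>t. R k t $ i $ j) has_vector_derivative R (Suc k) t $ i $ j) (at t)"
      using riemann_derivatives_along_geodesic[OF open_greaterThanLessThan tI xI x[OF IT[OF t]] v[OF IT[OF t]] E[OF t] E[OF t],
          of k j i] by (simp only: R_def vec_lambda_beta)
  qed
  note jac = jacobi_equation[OF open_greaterThanLessThan _ xI x[OF IT] v[OF IT] Z[OF IT] W[OF IT] E]
  have B: "(B has_vector_derivative B' t) (at t)" if t: "\<bar>t\<bar> < \<tau>" for t
  proof (intro has_vector_derivative_componentwise)
    fix i j
    show "((\<lambda>t. B t $ i $ j) has_vector_derivative B' t $ i $ j) (at t)"
      using jac(1)[of t "e j" i] t I by (simp add: B_def B'_def)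
  qed
  have B': "(B' has_vector_derivative - (R 0 t ** B t)) (at t)" if t: "\<bar>t\<bar> < \<tau>" for t
  proof (intro has_vector_derivative_componentwise)
    fix i j
    have l: "linear (\<lambda>u. riemann_tensor (g c) (x t) [u, v t, v t, E i t])"
      using riemann_linear_first[OF xS[OF IT[OF t]], of 0 "v t" "v t" "E i t"] by simp
    \<comment> \<open>Expanding the Jacobi field in the frame inside the first slot of the curvature
      produces the matrix product.\<close>
    have "riemann_tensor (g c) (x t) [Z (e j) t, v t, v t, E i t] =
        riemann_tensor (g c) (x t) [\<Sum>k\<in>UNIV. gm (x t) (Z (e j) t) (E k t) *\<^sub>R E k t, v t, v t, E i t]"
      using Zexp[OF t, of "e j"] by metis
    also have "\<dots> = (\<Sum>k\<in>UNIV. gm (x t) (Z (e j) t) (E k t) *\<^sub>R riemann_tensor (g c) (x t) [E k t, v t, v t, E i t])"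
      by (simp only: linear_sum[OF l] linear_scale[OF l])
    also have "\<dots> = (R 0 t ** B t) $ i $ j"
      by (simp add: matrix_matrix_mult_def R_def B_def mult.commute)
    finally show "((\<lambda>t. B' t $ i $ j) has_vector_derivative (- (R 0 t ** B t)) $ i $ j) (at t)"
      using jac(2)[of t "e j" i] t I by (simp add: B'_def)
  qed
  have B0: "B 0 = 0" by (simp add: B_def Z0 vec_eq_iff linear_0[OF linear_metric_at_left])
  have B'0: "B' 0 = mat 1"
    by (simp add: B'_def Z0 W0 x0 E0 on linear_0[OF linear_christoffel_form_right] vec_eq_iff mat_def)
  let ?F = "\<lambda>t. volume_density A g c P e (t *\<^sub>R \<xi>)"
  have F0: "?F 0 = 1"
  proof -
    have "?F 0 = sqrt (det (\<chi> i j. gm (x 0) (e i) (e j)))"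
      using volume_density_eq[OF e exp_map_derivative_at_0] ex[of 0] T by simp
    also have "(\<chi> i j. gm (x 0) (e i) (e j)) = mat 1" by (simp add: x0 on mat_def)
    finally show ?thesis by simp
  qed
  \<comment> \<open>In an orthonormal frame the Gram matrix of the rescaled Jacobi fields is
    \<open>transpose ?C ** ?C\<close>. Its determinant is a square, and the root leaves the absolute
    value.\<close>
  have F: "?F t = \<bar>det ((1/t) *\<^sub>R B t)\<bar>" if t: "\<bar>t\<bar> < \<tau>" "t \<noteq> 0" for t
  proof -
    let ?C = "(1/t) *\<^sub>R B t"
    have "gm (x t) ((1/t) *\<^sub>R Z (e i) t) ((1/t) *\<^sub>R Z (e j) t) = (transpose ?C ** ?C) $ i $ j" for i j
    proof -
      have "gm (x t) (Z (e i) t) (Z (e j) t) =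
          gm (x t) (Z (e i) t) (\<Sum>k\<in>UNIV. gm (x t) (Z (e j) t) (E k t) *\<^sub>R E k t)"
        using Zexp[OF t(1), of "e j"] by metis
      also have "\<dots> = (\<Sum>k\<in>UNIV. B t $ k $ j * B t $ k $ i)"
        by (simp add: linear_sum[OF linear_metric_at_right] linear_scale[OF linear_metric_at_right] B_def)
      finally have "gm (x t) (Z (e i) t) (Z (e j) t) = (\<Sum>k\<in>UNIV. B t $ k $ j * B t $ k $ i)" .
      then show ?thesis
        by (simp add: linear_scale[OF linear_metric_at_right] linear_scale[OF linear_metric_at_left]
            matrix_matrix_mult_def transpose_def sum_distrib_left mult_ac)
    qed
    then have "(\<chi> i j. gm (x t) ((1/t) *\<^sub>R Z (e i) t) ((1/t) *\<^sub>R Z (e j) t)) = transpose ?C ** ?C"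
      by (simp add: vec_eq_iff)
    with volume_density_eq[OF e ed[OF IT[OF t(1)] t(2)]] ex[OF IT[OF t(1)]]
    have "?F t = sqrt (det (transpose ?C ** ?C))" by simp
    also have "\<dots> = sqrt (det ?C * det ?C)" by (simp only: det_mul det_transpose)
    finally show ?thesis by (simp only: real_sqrt_abs2)
  qed
  obtain V D where VD: "V 0 = 0"
    "\<And>k. V (Suc k) = - (1 / real (k + 3)) *\<^sub>R ((1 / fact k) *\<^sub>R R k 0 + (\<Sum>i\<le>k. V i ** V (k - i)))"
    "D 0 = 1" "\<And>k. D (Suc k) = (\<Sum>i\<le>k. D i * trace (V (k - i))) / real (Suc k)"
    "\<And>k. (deriv ^^ k) ?F 0 / fact k = D k"
    by (rule matrix_jacobi_expansion[where R=R and A=B and A'=B' and F="?F" and \<tau>=\<tau>,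
          OF \<tau>(1) R' B0 B'0 B B' F0 F]) (assumption | rule that; assumption)+
  have RM: "R k 0 = M k" for k by (simp only: R_def M_def x0 v0 E0)
  show ?thesis
    by (rule that[OF VD(1) VD(2)[unfolded RM] VD(3,4)]) (simp add: taylor_term_def VD(5))
qed

end

theorem theorem1p1:
  fixes A :: "('a::{t2_space, second_countable_topology}, 'm::finite) chart set"
    and g :: "('a, 'm) metric"
    and c :: "('a, 'm) chart" and P :: 'a
    and e :: "'m \<Rightarrow> real ^ 'm" and \<xi> :: "real ^ 'm"
  assumes "riemannian_manifold A g"
    and "c \<in> A" and "P \<in> fst c"
    and "orthonormal_basis_at (g c) (snd c P) e"
  shows
    "let H = (\<lambda>k. taylor_term (volume_density A g c P e) k \<xi>);
         J = jacobi_operator (g c) (snd c P) 0 \<xi>;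
         J1 = jacobi_operator (g c) (snd c P) 1 \<xi>;
         J2 = jacobi_operator (g c) (snd c P) 2 \<xi>;
         J3 = jacobi_operator (g c) (snd c P) 3 \<xi>;
         J4 = jacobi_operator (g c) (snd c P) 4 \<xi>;
         J5 = jacobi_operator (g c) (snd c P) 5 \<xi>;
         J6 = jacobi_operator (g c) (snd c P) 6 \<xi>
     in H 2 = - trace J / 6 \<and>
        H 3 = - trace J1 / 12 \<and>
        H 4 = trace J ^ 2 / 72 - trace (J ** J) / 180 - trace J2 / 40 \<and>
        H 5 = trace J * trace J1 / 72 - trace (J ** J1) / 180 - trace J3 / 180 \<and>
        H 6 = - (trace J ^ 3) / 1296 + trace J * trace (J ** J) / 1080
              + trace J * trace J2 / 240 - trace (J ** J ** J) / 2835
              - trace (J ** J2) / 630 + trace J1 ^ 2 / 288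
              - trace (J1 ** J1) / 672 - trace J4 / 1008 \<and>
        H 7 = trace J * trace (J ** J1) / 1080 - trace J ^ 2 * trace J1 / 864
              - trace J5 / 6720 + trace J * trace J3 / 1080
              + trace (J ** J) * trace J1 / 2160 - trace (J ** J ** J1) / 1890
              - trace (J ** J3) / 3024 + trace J1 * trace J2 / 480
              - trace (J1 ** J2) / 1120 \<and>
        H 8 = trace J ^ 4 / 31104 - trace J ^ 2 * trace (J ** J) / 12960
              - trace J ^ 2 * trace J2 / 2880 + trace J * trace (J ** J ** J) / 17010
              + trace J * trace (J ** J2) / 3780 - trace J6 / 51840
              - trace J * trace J1 ^ 2 / 1728 + trace J * trace (J1 ** J1) / 4032
              - trace (J2 ** J2) / 7200 + trace J * trace J4 / 6048
              + trace (J ** J) * trace J2 / 7200 + trace (J ** J) ^ 2 / 64800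
              - trace (J ** J ** J ** J) / 37800 - 17 * trace (J ** J ** J2) / 113400
              + trace (J ** J1) * trace J1 / 2160 - 5 * trace (J ** J1 ** J1) / 18144
              - trace (J ** J4) / 18144 + trace J1 * trace J3 / 2160
              - trace (J1 ** J3) / 5184 + trace J2 ^ 2 / 3200"
proof -
  interpret manifold_chart A g c P by unfold_locales fact+
  let ?x = "snd c P"
  define M where "M k = (\<chi> i j. (tensor_cov_deriv (g c) ^^ k) (riemann_tensor (g c)) ?x
    ([e j, \<xi>, \<xi>, e i] @ replicate k \<xi>))" for k
  define Q where "Q = (\<chi> i k. e k $ i)"
  define N where "N = transpose Q ** g c ?x"
  have on: "gm ?x (e i) (e j) = (if i = j then 1 else 0)" for i j
    using assms(4) by (simp add: orthonormal_basis_at_def)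
  have NQ: "N ** Q = mat 1" using orthonormal_matrix(2)[of "g c" ?x e, OF on] by (simp only: Q_def N_def)
  have x: "?x \<in> S" using assms(3) by simp
  have J: "jacobi_operator (g c) ?x k \<xi> = Q ** M k ** N" for k
    using jacobi_operator_orthonormal[OF x on, of k \<xi>] by (simp only: Q_def N_def M_def)
  \<comment> \<open>As \<open>N\<close> is the inverse of \<open>Q\<close>, passing from the basis
    \<open>e\<close> to the chart is a conjugation. It respects products and traces, from which
    every term of the formulas is built.\<close>
  have mult: "(Q ** X ** N) ** (Q ** Y ** N) = Q ** (X ** Y) ** N" for X Y
  proof -
    have "(Q ** X ** N) ** (Q ** Y ** N) = Q ** X ** (N ** Q) ** Y ** N" by (simp only: matrix_mul_assoc)
    then show ?thesis by (simp add: NQ matrix_mul_assoc)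
  qed
  have tr: "trace (Q ** X ** N) = trace X" for X
  proof -
    have "trace (Q ** X ** N) = trace (N ** Q ** X)" using trace_mul_sym[of "Q ** X" N] by (simp add: matrix_mul_assoc)
    then show ?thesis by (simp add: NQ)
  qed
  obtain V D where VD: "V 0 = 0"
    "\<And>k. V (Suc k) = - (1 / real (k + 3)) *\<^sub>R ((1 / fact k) *\<^sub>R M k + (\<Sum>i\<le>k. V i ** V (k - i)))"
    "D 0 = 1" "\<And>k. D (Suc k) = (\<Sum>i\<le>k. D i * trace (V (k - i))) / real (Suc k)"
    and H: "\<And>k. taylor_term (volume_density A g c P e) k \<xi> = D k"
    using volume_density_expansion[OF assms(4), of \<xi>] unfolding M_def by blast
  show ?thesis
    unfolding Let_def J mult tr H
    by (intro conjI density_coefficients[OF VD])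
qed

end
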